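(* Let $g\in M^1(\mathbb{R}^d)$ and $\Lambda\subseteq\mathbb{R}^{2d}$, and assume that $\mathcal{G}(g,\Lambda)$ is a Riesz sequence in $L^2(\mathbb{R}^d)$. If the deformation $\{\Lambda_n:n\ge1\}$ of $\Lambda$ is Lipschitz convergent to $\Lambda$, then $\mathcal{G}(g,\Lambda_n)$ is a Riesz sequence in $L^2(\mathbb{R}^d)$ for all sufficiently large $n$.
   Context: For $z=(x,\xi)\in\mathbb{R}^d\times\mathbb{R}^d\simeq\mathbb{R}^{2d}$, the time-frequency shift is $\pi(z)g(t)=e^{2\pi i\xi\cdot t}g(t-x)$. $M^1(\mathbb{R}^d)$ consists of all $g\in L^2(\mathbb{R}^d)$ with $\int_{\mathbb{R}^{2d}}|\langle g,\pi(z)g\rangle|\,dz<\infty$. For a set $\Lambda\subseteq\mathbb{R}^{2d}$, $\mathcal{G}(g,\Lambda)=\{\pi(\lambda)g:\lambda\in\Lambda\}$ (indexed by $\Lambda$) is a Riesz sequence in $L^2(\mathbb{R}^d)$ if there are constants $0<A\le B<\infty$ with $A\|c\|_2\le\|\sum_{\lambda\in\Lambda}c_\lambda\pi(\lambda)g\|_2\le B\|c\|_2$ for all $c\in\ell^2(\Lambda)$. A deformation of a (countable) set $\Lambda\subseteq\mathbb{R}^{2d}$ is a sequence of sets $\Lambda_n=\tau_n(\Lambda)=\{\tau_n(\lambda):\lambda\in\Lambda\}$, $n\ge1$, together with maps $\tau_n:\Lambda\to\mathbb{R}^{2d}$ such that $\tau_n(\lambda)\to\lambda$ as $n\to\infty$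 for every $\lambda\in\Lambda$. The deformation is called Lipschitz (and $\Lambda_n$ Lipschitz convergent to $\Lambda$) if: (L1) for every $R>0$, $\sup_{\lambda,\lambda'\in\Lambda,\ |\lambda-\lambda'|\le R}|(\tau_n(\lambda)-\tau_n(\lambda'))-(\lambda-\lambda')|\to0$ as $n\to\infty$; (L2) for every $R>0$ there exist $R'>0$ and $n_0\in\mathbb{N}$ such that if $|\tau_n(\lambda)-\tau_n(\lambda')|\le R$ for some $n\ge n_0$ and some $\lambda,\lambda'\in\Lambda$, then $|\lambda-\lambda'|\le R'$. *)

theory Defs
  imports "HOL-Analysis.Analysis"
begin

text \<open>
  Elements of \<open>L\<^sup>2(\<real>\<^sup>d)\<close> are represented by Borel measurable functions on \<^typ>\<open>real ^ 'd\<close>;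
  every class modulo null sets has such a representative, and all notions below depend only
  on the class.
\<close>

definition L2 :: "('a::euclidean_space \<Rightarrow> complex) set" where
  "L2 = {f \<in> borel_measurable lborel. integrable lborel (\<lambda>t. (cmod (f t))\<^sup>2)}"

definition L2_inner :: "('a::euclidean_space \<Rightarrow> complex) \<Rightarrow> ('a \<Rightarrow> complex) \<Rightarrow> complex" where
  "L2_inner f h = (\<integral>t. f t * cnj (h t) \<partial>lborel)"

definition L2_norm :: "('a::euclidean_space \<Rightarrow> complex) \<Rightarrow> real" where
  "L2_norm f = sqrt (\<integral>t. (cmod (f t))\<^sup>2 \<partial>lborel)"

text \<open>Unconditional convergence in the \<open>L\<^sup>2\<close> norm (the analogue of \<^const>\<open>has_sum\<close>).\<close>

definition L2_has_sum ::
  "('i \<Rightarrow> 'a::euclidean_space \<Rightarrow> complex) \<Rightarrow> ('a \<Rightarrow> complex) \<Rightarrow> 'i set \<Rightarrow> bool" where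
  "L2_has_sum u f I \<longleftrightarrow>
     (\<forall>i\<in>I. u i \<in> L2) \<and> f \<in> L2 \<and>
     ((\<lambda>F. L2_norm (\<lambda>t. (\<Sum>i\<in>F. u i t) - f t)) \<longlongrightarrow> 0) (finite_subsets_at_top I)"

definition ell2 :: "'i set \<Rightarrow> ('i \<Rightarrow> complex) set" where
  "ell2 I = {c. (\<lambda>i. (cmod (c i))\<^sup>2) summable_on I}"

definition ell2_norm :: "'i set \<Rightarrow> ('i \<Rightarrow> complex) \<Rightarrow> real" where
  "ell2_norm I c = sqrt (\<Sum>\<^sub>\<infinity>i\<in>I. (cmod (c i))\<^sup>2)"

text \<open>
  The sum \<open>f\<close> is determined up to null sets, so its norm is well defined; that
  the series converges for every \<open>c \<in> \<ell>\<^sup>2(I)\<close> is part of the definition.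
\<close>

definition riesz_sequence :: "'i set \<Rightarrow> ('i \<Rightarrow> 'a::euclidean_space \<Rightarrow> complex) \<Rightarrow> bool" where
  "riesz_sequence I \<phi> \<longleftrightarrow>
     (\<forall>i\<in>I. \<phi> i \<in> L2) \<and>
     (\<exists>A B. 0 < A \<and> A \<le> B \<and>
       (\<forall>c\<in>ell2 I. \<exists>f. L2_has_sum (\<lambda>i t. c i * \<phi> i t) f I \<and>
          A * ell2_norm I c \<le> L2_norm f \<and> L2_norm f \<le> B * ell2_norm I c))"

definition tf_shift ::
  "(real ^ 'd) \<times> (real ^ 'd) \<Rightarrow> (real ^ 'd \<Rightarrow> complex) \<Rightarrow> real ^ 'd \<Rightarrow> complex" where
  "tf_shift z g t = (case z of (x, \<xi>) \<Rightarrow>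
     exp (2 * complex_of_real pi * \<i> * complex_of_real (\<xi> \<bullet> t)) * g (t - x))"

definition M1 :: "(real ^ 'd \<Rightarrow> complex) set" where
  "M1 = {g \<in> L2. integrable lborel (\<lambda>z. cmod (L2_inner g (tf_shift z g)))}"

abbreviation gabor_riesz_sequence ::
  "(real ^ 'd \<Rightarrow> complex) \<Rightarrow> ((real ^ 'd) \<times> (real ^ 'd)) set \<Rightarrow> bool" where
  "gabor_riesz_sequence g \<Lambda> \<equiv> riesz_sequence \<Lambda> (\<lambda>z. tf_shift z g)"

text \<open>
  Sequences start at index 1; the values at 0, and those of \<open>\<tau> n\<close> outside \<open>\<Lambda>\<close>, are irrelevant.
\<close>

definition deformation ::
  "'a::euclidean_space set \<Rightarrow> (nat \<Rightarrow> 'a \<Rightarrow> 'a) \<Rightarrow> (nat \<Rightarrow> 'a set) \<Rightarrow> bool" where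
  "deformation \<Lambda> \<tau> \<Lambda>s \<longleftrightarrow>
     countable \<Lambda> \<and>
     (\<forall>n\<ge>1. \<Lambda>s n = \<tau> n ` \<Lambda>) \<and>
     (\<forall>l\<in>\<Lambda>. (\<lambda>n. \<tau> n l) \<longlonglongrightarrow> l)"

text \<open>
  The supremum is taken in \<^typ>\<open>ennreal\<close>: it may be infinite for some \<open>n\<close>, and is 0 if \<open>\<Lambda>\<close> is empty.
\<close>

definition lipschitz_deformation ::
  "'a::euclidean_space set \<Rightarrow> (nat \<Rightarrow> 'a \<Rightarrow> 'a) \<Rightarrow> (nat \<Rightarrow> 'a set) \<Rightarrow> bool" where
  "lipschitz_deformation \<Lambda> \<tau> \<Lambda>s \<longleftrightarrow>
     deformation \<Lambda> \<tau> \<Lambda>s \<and>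
     (\<forall>R>0. (\<lambda>n. SUP (l, l') \<in> {(l, l') \<in> \<Lambda> \<times> \<Lambda>. norm (l - l') \<le> R}.
               ennreal (norm ((\<tau> n l - \<tau> n l') - (l - l')))) \<longlonglongrightarrow> 0) \<and>
     (\<forall>R>0. \<exists>R'>0. \<exists>n0\<ge>1. \<forall>n\<ge>n0. \<forall>l\<in>\<Lambda>. \<forall>l'\<in>\<Lambda>.
        norm (\<tau> n l - \<tau> n l') \<le> R \<longrightarrow> norm (l - l') \<le> R')"

end

theory Submission
  imports Defs "HOL-Probability.Characteristic_Functions"
begin

text \<open>
  Write \<open>V z = \<langle>g, \<pi>(z) g\<rangle>\<close>. The Gram matrix of the deformed system is not close to that of the original
  one, since its phases depend on the absolute position of the points; but on a bounded region it is
  close after conjugation by a diagonal unitary matrix. So the lower Riesz bound is inherited by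
  sections supported in balls of a large radius \<open>R\<close>, and the full quadratic form differs from the
  average of its restrictions to these balls only by terms
  \<open>\<bar>V (\<tau> \<lambda> - \<tau> \<lambda>')\<bar> (1 - \<Psi> ((\<lambda> - \<lambda>') / R))\<close>, where \<open>\<Psi>\<close> is the normalised overlap of two unit balls.
  By Schur's test these are negligible once the sums of \<open>\<bar>V\<bar>\<close> over separated sets are finite with
  uniformly small tails. For \<open>g \<in> M\<^sup>1\<close> this follows from
  \<open>\<bar>V z\<bar> \<bar>V u\<bar> \<le> \<integral> \<bar>V (w + u)\<bar> \<bar>V (w - z)\<bar> dw\<close>, which comes from Moyal's
  identity, regularised by a Gaussian weight in the frequency variable.
\<close>

section \<open>The space \<open>L\<^sup>2\<close>\<close>

text \<open>The phases that bring the two Gram matrices together depend on the ball, so no single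
  diagonal unitary repairs the whole matrix. This is why local bounds are averaged, and why the
  error of averaging must be controlled uniformly in n. The balls are drawn around the undeformed
  points. There (L1) makes differences uniformly close and the number of points is bounded, while
  (L2) converts a small deformed difference, where V may be large, into a bounded original
  difference, where 1 - \<Psi> is small once R is large. The budget: half of the lower constant A is
  spent on each ball, which leaves A^2/4 in the quadratic form; the averaging error is at most
  A^2/8, split equally between far and near pairs; A^2/8 remains. The product bound on V replaces a
  local regularity statement about V: since V is bounded below near 0, averaging over small u
  dominates V z by integrals over balls, and these can be summed over separated z.\<close>

lemma L2_measurable [measurable_dest]: "f \<in> L2 \<Longrightarrow> f \<in> borel_measurable lborel"
  by (simp add: L2_def)

lemma L2_integrable_sq: "f \<in> L2 \<Longrightarrow> integrable lborel (\<lambda>t. (cmod (f t))\<^sup>2)"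
  by (simp add: L2_def)

lemma L2_norm_nonneg [simp]: "0 \<le> L2_norm f"
  by (simp add: L2_norm_def)

lemma L2_norm_sq: "(L2_norm f)\<^sup>2 = (\<integral>t. (cmod (f t))\<^sup>2 \<partial>lborel)"
  by (simp add: L2_norm_def)

lemma L2_nn_integral_sq:
  assumes "f \<in> L2"
  shows "(\<integral>\<^sup>+ t. ennreal ((cmod (f t))\<^sup>2) \<partial>lborel) = ennreal ((L2_norm f)\<^sup>2)"
  unfolding L2_norm_sq using L2_integrable_sq[OF assms] by (intro nn_integral_eq_integral) auto

text \<open>No integrability is presupposed, which is the form in which Fatou's lemma delivers its
  conclusion.\<close>

lemma L2I_nn_integral:
  assumes [measurable]: "f \<in> borel_measurable lborel"
    and "(\<integral>\<^sup>+ t. ennreal ((cmod (f t))\<^sup>2) \<partial>lborel) \<le> ennreal (C\<^sup>2)" "0 \<le> C"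
  shows "f \<in> L2" "L2_norm f \<le> C"
proof -
  have "integrable lborel (\<lambda>t. (cmod (f t))\<^sup>2)"
    using assms(2) by (intro integrableI_nonneg) (auto simp: order_le_less_trans)
  then show f: "f \<in> L2" by (simp add: L2_def)
  have "ennreal ((L2_norm f)\<^sup>2) \<le> ennreal (C\<^sup>2)"
    using assms(2) L2_nn_integral_sq[OF f] by simp
  then show "L2_norm f \<le> C"
    using assms(3) by (simp add: power2_le_iff_abs_le)
qed

lemma L2_Cauchy_Schwarz:
  assumes "f \<in> L2" "h \<in> L2"
  shows "integrable lborel (\<lambda>t. cmod (f t) * cmod (h t))"
    and "(\<integral>t. cmod (f t) * cmod (h t) \<partial>lborel) \<le> L2_norm f * L2_norm h"
proof -
  note [measurable] = L2_measurable[OF assms(1)] L2_measurable[OF assms(2)]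
  show i: "integrable lborel (\<lambda>t. cmod (f t) * cmod (h t))"
  proof (rule Bochner_Integration.integrable_bound)
    show "integrable lborel (\<lambda>t. (cmod (f t))\<^sup>2 + (cmod (h t))\<^sup>2)"
      using assms by (intro Bochner_Integration.integrable_add L2_integrable_sq)
    show "AE x in lborel. norm (cmod (f x) * cmod (h x)) \<le> norm ((cmod (f x))\<^sup>2 + (cmod (h x))\<^sup>2)"
    proof (intro AE_I2)
      fix x
      have "2 * (cmod (f x) * cmod (h x)) \<le> (cmod (f x))\<^sup>2 + (cmod (h x))\<^sup>2"
        using sum_squares_bound[of "cmod (f x)" "cmod (h x)"] by (simp add: mult.assoc)
      moreover have "0 \<le> cmod (f x) * cmod (h x)" by simp
      ultimately show "norm (cmod (f x) * cmod (h x)) \<le> norm ((cmod (f x))\<^sup>2 + (cmod (h x))\<^sup>2)"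
        unfolding real_norm_def by linarith
    qed
  qed measurable
  let ?I = "\<integral>t. cmod (f t) * cmod (h t) \<partial>lborel"
  have nn: "0 \<le> ?I" by (intro integral_nonneg_AE) auto
  have "(\<integral>\<^sup>+ t. ennreal (cmod (f t)) * ennreal (cmod (h t)) \<partial>lborel) = ennreal ?I"
    using i by (subst ennreal_mult[symmetric]) (auto intro!: nn_integral_eq_integral)
  then have "(ennreal ?I)\<^sup>2 \<le> ennreal ((L2_norm f)\<^sup>2) * ennreal ((L2_norm h)\<^sup>2)"
    using Cauchy_Schwarz_nn_integral[of "\<lambda>t. ennreal (cmod (f t))" lborel "\<lambda>t. ennreal (cmod (h t))"]
    by (simp add: ennreal_power L2_nn_integral_sq assms)
  then have "?I\<^sup>2 \<le> (L2_norm f)\<^sup>2 * (L2_norm h)\<^sup>2"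
    by (simp add: ennreal_power nn ennreal_mult[symmetric])
  then have "?I\<^sup>2 \<le> (L2_norm f * L2_norm h)\<^sup>2" by (simp add: power_mult_distrib)
  then show "?I \<le> L2_norm f * L2_norm h"
    by (rule power2_le_imp_le) simp
qed

lemma L2_integrable_mult:
  assumes "f \<in> L2" "h \<in> L2"
  shows "integrable lborel (\<lambda>t. f t * cnj (h t))"
proof -
  note [measurable] = L2_measurable[OF assms(1)] L2_measurable[OF assms(2)]
  have "(\<lambda>t. f t * cnj (h t)) \<in> borel_measurable lborel"
    by (intro borel_measurable_times measurable_compose[OF _ borel_measurable_continuous_onI[of cnj]])
      (auto intro: continuous_intros)
  with L2_Cauchy_Schwarz(1)[OF assms] show ?thesis
    by (rule Bochner_Integration.integrable_bound) (auto simp: norm_mult)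
qed

lemma norm_L2_inner_le:
  assumes "f \<in> L2" "h \<in> L2"
  shows "cmod (L2_inner f h) \<le> L2_norm f * L2_norm h"
proof -
  have "cmod (L2_inner f h) \<le> (\<integral>t. cmod (f t) * cmod (h t) \<partial>lborel)"
    unfolding L2_inner_def by (rule order_trans[OF integral_norm_bound]) (simp add: norm_mult)
  with L2_Cauchy_Schwarz(2)[OF assms] show ?thesis by simp
qed

lemma L2_norm_sq_inner: "complex_of_real ((L2_norm f)\<^sup>2) = L2_inner f f"
  unfolding L2_norm_sq L2_inner_def integral_complex_of_real[symmetric]
  by (simp only: complex_norm_square)

lemma L2_inner_commute: "L2_inner f h = cnj (L2_inner h f)"
  unfolding L2_inner_def by (subst Bochner_Integration.integral_cnj[symmetric]) (simp add: mult.commute)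

lemma zero_in_L2 [simp]: "(\<lambda>_. 0) \<in> L2"
  by (simp add: L2_def)

lemma L2_scale: "f \<in> L2 \<Longrightarrow> (\<lambda>t. a * f t) \<in> L2"
  by (auto simp: L2_def norm_mult power_mult_distrib)

lemma L2_norm_scale: "L2_norm (\<lambda>t. a * f t) = cmod a * L2_norm f"
  by (simp add: L2_norm_def norm_mult power_mult_distrib real_sqrt_mult)

lemma L2_add:
  assumes "f \<in> L2" "h \<in> L2"
  shows "(\<lambda>t. f t + h t) \<in> L2" and "L2_norm (\<lambda>t. f t + h t) \<le> L2_norm f + L2_norm h"
proof -
  note [measurable] = L2_measurable[OF assms(1)] L2_measurable[OF assms(2)]
  have le: "(cmod (f x + h x))\<^sup>2 \<le> (cmod (f x))\<^sup>2 + 2 * (cmod (f x) * cmod (h x)) + (cmod (h x))\<^sup>2" for x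
    using power_mono[OF norm_triangle_ineq[of "f x" "h x"], of 2]
    by (simp add: power2_sum algebra_simps)
  have i: "integrable lborel (\<lambda>x. (cmod (f x))\<^sup>2 + 2 * (cmod (f x) * cmod (h x)) + (cmod (h x))\<^sup>2)"
    using assms L2_Cauchy_Schwarz(1)[OF assms]
    by (intro Bochner_Integration.integrable_add L2_integrable_sq integrable_mult_right) auto
  have i2: "integrable lborel (\<lambda>x. (cmod (f x + h x))\<^sup>2)"
    by (rule Bochner_Integration.integrable_bound[OF i]) (auto intro!: AE_I2 order_trans[OF le])
  then show "(\<lambda>t. f t + h t) \<in> L2" by (simp add: L2_def)
  have "(L2_norm (\<lambda>t. f t + h t))\<^sup>2
      \<le> (\<integral>x. (cmod (f x))\<^sup>2 + 2 * (cmod (f x) * cmod (h x)) + (cmod (h x))\<^sup>2 \<partial>lborel)"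
    unfolding L2_norm_sq using i i2 le by (intro integral_mono)
  also have "\<dots> = (L2_norm f)\<^sup>2 + 2 * (\<integral>t. cmod (f t) * cmod (h t) \<partial>lborel) + (L2_norm h)\<^sup>2"
    unfolding L2_norm_sq
    using L2_Cauchy_Schwarz(1)[OF assms] L2_integrable_sq[OF assms(1)] L2_integrable_sq[OF assms(2)]
    by (subst Bochner_Integration.integral_add, auto intro: Bochner_Integration.integrable_add)+
  also have "\<dots> \<le> (L2_norm f + L2_norm h)\<^sup>2"
    using L2_Cauchy_Schwarz(2)[OF assms] by (simp add: power2_sum)
  finally show "L2_norm (\<lambda>t. f t + h t) \<le> L2_norm f + L2_norm h"
    by (rule power2_le_imp_le) simp
qed

lemma L2_diff: "f \<in> L2 \<Longrightarrow> h \<in> L2 \<Longrightarrow> (\<lambda>t. f t - h t) \<in> L2"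
  using L2_add(1)[of f "\<lambda>t. - 1 * h t"] L2_scale[of h "-1"] by simp

lemma L2_norm_minus_commute: "L2_norm (\<lambda>t. f t - h t) = L2_norm (\<lambda>t. h t - f t)"
  by (simp add: L2_norm_def norm_minus_commute)

lemma L2_norm_triangle_diff:
  assumes "f \<in> L2" "h \<in> L2"
  shows "L2_norm f \<le> L2_norm h + L2_norm (\<lambda>t. f t - h t)"
  using L2_add(2)[OF assms(2) L2_diff[OF assms]] by simp

lemma L2_norm_abs_diff:
  assumes "f \<in> L2" "h \<in> L2"
  shows "\<bar>L2_norm f - L2_norm h\<bar> \<le> L2_norm (\<lambda>t. f t - h t)"
  using L2_norm_triangle_diff[OF assms] L2_norm_triangle_diff[OF assms(2,1)]
  by (simp add: L2_norm_minus_commute[of h f] abs_le_iff)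

lemma L2_norm_triangle3:
  assumes "f \<in> L2" "h \<in> L2" "k \<in> L2"
  shows "L2_norm (\<lambda>t. f t - k t) \<le> L2_norm (\<lambda>t. f t - h t) + L2_norm (\<lambda>t. h t - k t)"
  using L2_add(2)[OF L2_diff[OF assms(1,2)] L2_diff[OF assms(2,3)]] by simp

lemma L2_sum:
  assumes "\<And>i. i \<in> F \<Longrightarrow> u i \<in> L2"
  shows "(\<lambda>t. \<Sum>i\<in>F. u i t) \<in> L2"
    and "L2_norm (\<lambda>t. \<Sum>i\<in>F. u i t) \<le> (\<Sum>i\<in>F. L2_norm (u i))"
proof -
  have *: "(\<lambda>t. \<Sum>i\<in>F. u i t) \<in> L2 \<and> L2_norm (\<lambda>t. \<Sum>i\<in>F. u i t) \<le> (\<Sum>i\<in>F. L2_norm (u i))"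
    using assms
  proof (induction F rule: infinite_finite_induct)
    case (insert x F)
    then have x: "u x \<in> L2" and F: "(\<lambda>t. \<Sum>i\<in>F. u i t) \<in> L2"
      "L2_norm (\<lambda>t. \<Sum>i\<in>F. u i t) \<le> (\<Sum>i\<in>F. L2_norm (u i))" by auto
    show ?case
      using L2_add[OF x F(1)] F(2) insert.hyps by (simp add: order_trans)
  qed (auto simp: L2_norm_def)
  then show "(\<lambda>t. \<Sum>i\<in>F. u i t) \<in> L2"
    and "L2_norm (\<lambda>t. \<Sum>i\<in>F. u i t) \<le> (\<Sum>i\<in>F. L2_norm (u i))" by auto
qed

lemma L2_norm_sum_sq:
  assumes u: "\<And>i. i \<in> F \<Longrightarrow> u i \<in> L2"
  shows "complex_of_real ((L2_norm (\<lambda>t. \<Sum>i\<in>F. c i * u i t))\<^sup>2) =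
    (\<Sum>i\<in>F. \<Sum>j\<in>F. c i * cnj (c j) * L2_inner (u i) (u j))"
proof -
  have int: "integrable lborel (\<lambda>t. c i * cnj (c j) * (u i t * cnj (u j t)))"
    if "i \<in> F" "j \<in> F" for i j
    using L2_integrable_mult[OF u u, OF that] by simp
  have "complex_of_real ((L2_norm (\<lambda>t. \<Sum>i\<in>F. c i * u i t))\<^sup>2) =
     (\<integral>t. (\<Sum>i\<in>F. \<Sum>j\<in>F. c i * cnj (c j) * (u i t * cnj (u j t))) \<partial>lborel)"
    unfolding L2_norm_sq_inner L2_inner_def
    by (intro Bochner_Integration.integral_cong refl)
      (simp add: sum_product cnj_sum mult_ac)
  also have "\<dots> = (\<Sum>i\<in>F. \<Sum>j\<in>F. (\<integral>t. c i * cnj (c j) * (u i t * cnj (u j t)) \<partial>lborel))"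
    using int
    by (subst Bochner_Integration.integral_sum, (intro Bochner_Integration.integrable_sum; simp))
      (intro sum.cong refl Bochner_Integration.integral_sum; simp)
  finally show ?thesis by (simp add: L2_inner_def)
qed

section \<open>Completeness\<close>

text \<open>The weights \<open>2^k\<close> are heavy enough to control the series pointwise and
  light enough to be summed: the integrals of \<open>2^k * |d k|^2\<close> are at most
  \<open>2^k * 4^(-k)\<close>. Where the weighted series is finite, \<open>x \<le> 1 + x^2\<close>
  with \<open>x = 2^k * |d k t|\<close> gives absolute convergence.\<close>

lemma L2_AE_convergent:
  assumes d: "\<And>k. d k \<in> L2" "\<And>k. L2_norm (d k) \<le> (1/2)^k"
  shows "AE t in lborel. summable (\<lambda>k. d k t)"
proof -
  note [measurable] = L2_measurable[OF d(1)]
  have "(\<integral>\<^sup>+ t. (\<Sum>k. ennreal (2^k * (cmod (d k t))\<^sup>2)) \<partial>lborel)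
      = (\<Sum>k. \<integral>\<^sup>+t. ennreal (2^k * (cmod (d k t))\<^sup>2) \<partial>lborel)"
    by (rule nn_integral_suminf) measurable
  also have "\<dots> \<le> (\<Sum>k. ennreal ((1/2)^k))"
  proof (rule suminf_le)
    fix k
    have "(\<integral>\<^sup>+ t. ennreal (2^k * (cmod (d k t))\<^sup>2) \<partial>lborel) = ennreal (2^k) * ennreal ((L2_norm (d k))\<^sup>2)"
      by (simp add: ennreal_mult nn_integral_cmult L2_nn_integral_sq d del: ennreal_power)
    also have "\<dots> \<le> ennreal (2^k) * ennreal (((1/2)^k)\<^sup>2)"
      using d(2)[of k] by (intro mult_left_mono ennreal_leI power_mono) auto
    also have "\<dots> = ennreal ((1/2)^k)"
      by (simp add: ennreal_mult[symmetric] power2_eq_square power_mult_distrib[symmetric]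
            mult.assoc[symmetric] del: ennreal_power)
    finally show "(\<integral>\<^sup>+ t. ennreal (2^k * (cmod (d k t))\<^sup>2) \<partial>lborel) \<le> ennreal ((1/2)^k)" .
  qed auto
  also have "\<dots> < \<infinity>"
    by (subst suminf_ennreal2) (auto simp: summable_geometric)
  finally have fin: "(\<integral>\<^sup>+ t. (\<Sum>k. ennreal (2^k * (cmod (d k t))\<^sup>2)) \<partial>lborel) \<noteq> \<infinity>" by simp
  have "AE t in lborel. (\<Sum>k. ennreal (2^k * (cmod (d k t))\<^sup>2)) \<noteq> \<infinity>"
    by (rule nn_integral_PInf_AE) (use fin in auto)
  then show ?thesis
  proof eventually_elim
    case (elim t)
    then have s: "summable (\<lambda>k. 2^k * (cmod (d k t))\<^sup>2)"
      by (intro summable_suminf_not_top) auto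
    have "summable (\<lambda>k. (1/2)^k + 2^k * (cmod (d k t))\<^sup>2)"
      by (intro summable_add s summable_geometric) auto
    then show ?case
    proof (rule summable_comparison_test[rotated], intro exI allI impI)
      fix k
      define x where "x = (2::real)^k * cmod (d k t)"
      have "x * 1 \<le> 1 + x * x"
        using zero_le_power2[of "x - 1"] zero_le_square[of x]
        unfolding power2_eq_square by (simp only: algebra_simps)
      then have "x / 2^k \<le> (1 + x * x) / 2^k" by (intro divide_right_mono) auto
      then show "norm (d k t) \<le> (1/2)^k + 2^k * (cmod (d k t))\<^sup>2"
        by (simp add: x_def power2_eq_square field_simps)
    qed
  qed
qed

text \<open>The Riesz-Fischer argument: a rapidly converging subsequence converges almost
  everywhere, and Fatou's lemma transfers the Cauchy estimate to the limit.\<close>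

theorem L2_complete:
  assumes S: "\<And>n. S n \<in> L2"
    and Cauchy: "\<And>e. e > 0 \<Longrightarrow> \<exists>N. \<forall>m\<ge>N. \<forall>n\<ge>N. L2_norm (\<lambda>t. S m t - S n t) < e"
  obtains f where "f \<in> L2" "(\<lambda>n. L2_norm (\<lambda>t. S n t - f t)) \<longlonglongrightarrow> 0"
proof -
  note [measurable] = L2_measurable[OF S]
  have "\<exists>N. \<forall>m\<ge>N. \<forall>n\<ge>N. L2_norm (\<lambda>t. S m t - S n t) < (1/2)^k" for k :: nat
    by (rule Cauchy) simp
  then obtain N where N: "\<And>k m n. m \<ge> N k \<Longrightarrow> n \<ge> N k \<Longrightarrow> L2_norm (\<lambda>t. S m t - S n t) < (1/2)^k"
    by metis
  \<comment> \<open>The subsequence has to be nondecreasing as well as dominate \<open>N\<close>;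
    partial sums give both.\<close>
  define r where "r k = (\<Sum>i\<le>k. N i)" for k
  have rN: "N k \<le> r k" for k unfolding r_def by (rule member_le_sum) auto
  have rS: "r k \<le> r (Suc k)" for k by (simp add: r_def)
  define d where "d k t = S (r (Suc k)) t - S (r k) t" for k t
  have dL: "d k \<in> L2" for k unfolding d_def[abs_def] by (intro L2_diff S)
  have dn: "L2_norm (d k) \<le> (1/2)^k" for k
    unfolding d_def[abs_def] using N[of k "r (Suc k)" "r k"] rN[of k] rS[of k] by simp
  define f where "f t = lim (\<lambda>k. S (r k) t)" for t
  have [measurable]: "d k \<in> borel_measurable lborel" for k using dL by (rule L2_measurable)
  have fm [measurable]: "f \<in> borel_measurable lborel"
    unfolding f_def[abs_def] by (rule borel_measurable_lim_metric) measurable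
  have lim: "AE t in lborel. (\<lambda>k. S (r k) t) \<longlonglongrightarrow> f t"
    using L2_AE_convergent[OF dL dn]
  proof eventually_elim
    case (elim t)
    have "(\<Sum>k<n. d k t) = S (r n) t - S (r 0) t" for n
      unfolding d_def by (rule sum_lessThan_telescope)
    with summable_LIMSEQ[OF elim] have "(\<lambda>n. S (r n) t - S (r 0) t) \<longlonglongrightarrow> (\<Sum>k. d k t)" by simp
    from tendsto_add[OF tendsto_const[of "S (r 0) t"] this]
    have "convergent (\<lambda>n. S (r n) t)" by (auto simp: convergent_def)
    then show ?case by (simp add: f_def convergent_LIMSEQ_iff)
  qed
  \<comment> \<open>Fatou's lemma is applied to the distance of an arbitrary late \<open>S n\<close>
    from the subsequence, so the full sequence converges without a further triangle inequality, and
    membership of the difference in \<open>L2\<close> comes along.\<close>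
  have close: "(\<lambda>t. S n t - f t) \<in> L2 \<and> L2_norm (\<lambda>t. S n t - f t) \<le> (1/2)^k" if n: "n \<ge> N k" for n k
  proof -
    have "(\<integral>\<^sup>+ t. ennreal ((cmod (S n t - f t))\<^sup>2) \<partial>lborel)
       = (\<integral>\<^sup>+ t. liminf (\<lambda>j. ennreal ((cmod (S n t - S (r j) t))\<^sup>2)) \<partial>lborel)"
    proof (rule nn_integral_cong_AE, use lim in eventually_elim)
      case (elim t)
      then have "(\<lambda>j. ennreal ((cmod (S n t - S (r j) t))\<^sup>2)) \<longlonglongrightarrow> ennreal ((cmod (S n t - f t))\<^sup>2)"
        by (intro tendsto_intros tendsto_ennrealI)
      then show ?case by (intro lim_imp_Liminf[symmetric]) auto
    qed
    also have "\<dots> \<le> liminf (\<lambda>j. \<integral>\<^sup>+t. ennreal ((cmod (S n t - S (r j) t))\<^sup>2) \<partial>lborel)"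
      by (rule nn_integral_liminf) measurable
    also have "\<dots> \<le> ennreal (((1/2)^k)\<^sup>2)"
    proof (rule Liminf_le)
      show "\<forall>\<^sub>F j in sequentially. (\<integral>\<^sup>+ t. ennreal ((cmod (S n t - S (r j) t))\<^sup>2) \<partial>lborel) \<le> ennreal (((1/2)^k)\<^sup>2)"
        using eventually_ge_at_top[of k]
      proof eventually_elim
        case (elim j)
        have "r k \<le> r j" using elim rS by (metis lift_Suc_mono_le)
        then have "L2_norm (\<lambda>t. S n t - S (r j) t) < (1/2)^k"
          using rN[of k] n by (intro N) auto
        then show ?case
          unfolding L2_nn_integral_sq[OF L2_diff[OF S S]] by (intro ennreal_leI power_mono) auto
      qed
    qed auto
    finally show ?thesis
      using L2I_nn_integral[of "\<lambda>t. S n t - f t" "(1/2)^k"] by auto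
  qed
  have "f \<in> L2"
    using L2_diff[OF S conjunct1[OF close[of 0 "N 0"]], of "N 0"] by simp
  moreover have "(\<lambda>n. L2_norm (\<lambda>t. S n t - f t)) \<longlonglongrightarrow> 0"
  proof (rule LIMSEQ_I)
    fix e :: real assume "e > 0"
    then obtain k :: nat where k: "(1/2)^k < e" using real_arch_pow_inv[of e "1/2"] by auto
    show "\<exists>no. \<forall>n\<ge>no. norm (L2_norm (\<lambda>t. S n t - f t) - 0) < e"
      using close[of k] k by (intro exI[of _ "N k"]) (auto intro: order_le_less_trans)
  qed
  ultimately show thesis by (rule that)
qed

section \<open>Continuity of translations\<close>

lemma nn_integral_lborel_affine:
  fixes t :: "'a::euclidean_space"
  assumes "c \<noteq> 0" and [measurable]: "f \<in> borel_measurable borel"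
  shows "(\<integral>\<^sup>+ x. f x \<partial>lborel) = ennreal (\<bar>c\<bar> ^ DIM('a)) * (\<integral>\<^sup>+ x. f (t + c *\<^sub>R x) \<partial>lborel)"
  by (subst lborel_affine[OF assms(1), of t])
    (simp add: nn_integral_density nn_integral_distr nn_integral_cmult)

lemma integrable_lborel_affine:
  fixes t :: "'a::euclidean_space" and f :: "'a \<Rightarrow> 'b::{banach, second_countable_topology}"
  assumes "c \<noteq> 0" "integrable lborel f"
  shows "integrable lborel (\<lambda>x. f (t + c *\<^sub>R x))"
proof -
  have [measurable]: "f \<in> borel_measurable borel"
    using borel_measurable_integrable[OF assms(2)] by simp
  have "integrable (density (distr lborel borel (\<lambda>x. t + c *\<^sub>R x)) (\<lambda>_. ennreal (\<bar>c\<bar> ^ DIM('a)))) f"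
    using assms lborel_affine[of c t] by simp
  then have "integrable lborel (\<lambda>x. \<bar>c\<bar> ^ DIM('a) *\<^sub>R f (t + c *\<^sub>R x))"
    by (subst (asm) integrable_density) (auto simp: integrable_distr_eq)
  from integrable_scaleR_right[OF this, of "inverse (\<bar>c\<bar> ^ DIM('a))"]
  show ?thesis using assms(1) by simp
qed

lemma integral_lborel_affine:
  fixes t :: "'a::euclidean_space" and f :: "'a \<Rightarrow> 'b::{banach, second_countable_topology}"
  assumes "c \<noteq> 0" and [measurable]: "f \<in> borel_measurable borel"
  shows "(\<integral>x. f x \<partial>lborel) = \<bar>c\<bar> ^ DIM('a) *\<^sub>R (\<integral>x. f (t + c *\<^sub>R x) \<partial>lborel)"
  by (subst lborel_affine[OF assms(1), of t]) (simp add: integral_density integral_distr)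

lemmas nn_integral_lborel_translate = nn_integral_lborel_affine[where c=1, simplified]
lemmas integrable_lborel_translate = integrable_lborel_affine[where c=1, simplified]
lemmas integral_lborel_translate = integral_lborel_affine[where c=1, simplified]
lemmas nn_integral_lborel_reflect = nn_integral_lborel_affine[where c="-1", simplified]
lemmas integral_lborel_reflect = integral_lborel_affine[where c="-1", simplified]

text \<open>
  For an open set, dominated convergence controls the positive part of
  \<open>1\<^sub>U - 1\<^sub>U(\<cdot> + X n)\<close>, and the negative part has the same integral.
\<close>

lemma translation_tendsto_open:
  fixes U :: "'a::euclidean_space set"
  assumes U: "open U" "emeasure lborel U < \<infinity>" and X: "X \<longlonglongrightarrow> 0"
  shows "(\<lambda>n. \<integral>t. \<bar>indicator U (t + X n) - indicator U t :: real\<bar> \<partial>lborel) \<longlonglongrightarrow> 0"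
proof -
  have [measurable]: "U \<in> sets borel" using U by simp
  have iU: "integrable lborel (indicator U :: 'a \<Rightarrow> real)"
    using U by (simp add: integrable_indicator_iff)
  have iUX: "integrable lborel (\<lambda>t. indicator U (t + X n) :: real)" for n
    using integrable_lborel_translate[OF iU, of "X n"] by (simp add: add.commute)
  \<comment> \<open>The positive part is at most \<open>indicator U\<close> and vanishes off
    \<open>U\<close>. Openness enters only at points of \<open>U\<close>, where
    \<open>t + X n\<close> eventually lies in \<open>U\<close>.\<close>
  have "(\<lambda>n. \<integral>t. max 0 (indicator U t - indicator U (t + X n)) \<partial>lborel) \<longlonglongrightarrow> (\<integral>t. (0::real) \<partial>(lborel :: 'a measure))"
  proof (rule integral_dominated_convergence[where w="indicator U :: 'a \<Rightarrow> real"])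
    show "AE t in lborel. (\<lambda>n. max 0 (indicator U t - indicator U (t + X n)) :: real) \<longlonglongrightarrow> 0"
    proof (intro AE_I2)
      fix t
      show "(\<lambda>n. max 0 (indicator U t - indicator U (t + X n)) :: real) \<longlonglongrightarrow> 0"
      proof (cases "t \<in> U")
        case True
        have "(\<lambda>n. t + X n) \<longlonglongrightarrow> t" using tendsto_add[OF tendsto_const[of t] X] by simp
        then have "\<forall>\<^sub>F n in sequentially. t + X n \<in> U" using True U(1) by (auto simp: tendsto_def)
        then show ?thesis
          by (intro tendsto_eventually) (auto elim!: eventually_mono simp: True)
      qed (auto simp: indicator_def)
    qed
  qed (auto simp: iU split: split_indicator)
  moreover have "(\<integral>t. \<bar>indicator U (t + X n) - indicator U t :: real\<bar> \<partial>lborel)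
      = 2 * (\<integral>t. max 0 (indicator U t - indicator U (t + X n)) \<partial>lborel)" for n
  proof -
    have eq: "\<bar>indicator U (t + X n) - indicator U t :: real\<bar>
       = 2 * max 0 (indicator U t - indicator U (t + X n)) + (indicator U (t + X n) - indicator U t)" for t
      by (auto split: split_indicator)
    have i: "integrable lborel (\<lambda>t. max 0 (indicator U t - indicator U (t + X n)) :: real)"
      by (rule Bochner_Integration.integrable_bound[OF iU]) (auto split: split_indicator)
    have "(\<integral>t. (indicator U (t + X n) - indicator U t :: real) \<partial>lborel) = 0"
      using integral_lborel_translate[of "indicator U :: 'a \<Rightarrow> real" "X n"] iU iUX[of n]
      by (simp add: Bochner_Integration.integral_diff add.commute)
    then show ?thesis
      unfolding eq using i iU iUX[of n]
      by (subst Bochner_Integration.integral_add) auto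
  qed
  ultimately show ?thesis using tendsto_mult_left[of _ 0 _ "2::real"] by simp
qed

lemma translation_diff_integrable:
  fixes F :: "'a::euclidean_space \<Rightarrow> 'b::{banach, second_countable_topology}"
  assumes "integrable lborel F"
  shows "integrable lborel (\<lambda>t. F (t + a) - F t)"
  using assms integrable_lborel_translate[OF assms, of a]
  by (intro Bochner_Integration.integrable_diff) (simp_all add: add.commute)

text \<open>Translation is an isometry of the integral norm, so replacing \<open>F\<close> by
  \<open>G\<close> costs their distance once for \<open>F (t + a)\<close> and once for
  \<open>F t\<close>. This carries the continuity from open sets to Borel sets and from approximants
  to their limit.\<close>

lemma translation_approx:
  fixes F G :: "'a::euclidean_space \<Rightarrow> 'b::{banach, second_countable_topology}"
  assumes F: "integrable lborel F" and G: "integrable lborel G"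
  shows "(\<integral>t. norm (F (t + a) - F t) \<partial>lborel) \<le>
    2 * (\<integral>t. norm (F t - G t) \<partial>lborel) + (\<integral>t. norm (G (t + a) - G t) \<partial>lborel)"
proof -
  let ?D = "\<lambda>t. norm (F t - G t)"
  have D: "integrable lborel ?D" using F G by auto
  have Da: "integrable lborel (\<lambda>t. ?D (t + a))"
    using integrable_lborel_translate[OF D, of a] by (simp add: add.commute)
  have Deq: "(\<integral>t. ?D (t + a) \<partial>lborel) = (\<integral>t. ?D t \<partial>lborel)"
    using integral_lborel_translate[of ?D a] borel_measurable_integrable[OF D]
    by (simp add: add.commute)
  have G': "integrable lborel (\<lambda>t. norm (G (t + a) - G t))"
    by (intro integrable_norm translation_diff_integrable G)
  have "(\<integral>t. norm (F (t + a) - F t) \<partial>lborel) \<le> (\<integral>t. ?D (t + a) + ?D t + norm (G (t + a) - G t) \<partial>lborel)"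
  proof (rule integral_mono)
    fix t
    have "F (t + a) - F t = (F (t + a) - G (t + a)) - (F t - G t) + (G (t + a) - G t)" by simp
    then show "norm (F (t + a) - F t) \<le> ?D (t + a) + ?D t + norm (G (t + a) - G t)"
      using norm_triangle_ineq[of "(F (t + a) - G (t + a)) - (F t - G t)" "G (t + a) - G t"]
        norm_triangle_ineq4[of "F (t + a) - G (t + a)" "F t - G t"] by simp
  qed (use D Da G' translation_diff_integrable[OF F] in auto)
  also have "\<dots> = 2 * (\<integral>t. ?D t \<partial>lborel) + (\<integral>t. norm (G (t + a) - G t) \<partial>lborel)"
    using D Da G' Deq by simp
  finally show ?thesis .
qed

text \<open>An approximation argument in which the null sequence \<open>y\<close> may depend on the
  tolerance \<open>e\<close>.\<close>

lemma tendsto_zero_approx: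
  fixes x :: "nat \<Rightarrow> real"
  assumes "\<And>n. 0 \<le> x n"
    and "\<And>e. e > 0 \<Longrightarrow> \<exists>y. y \<longlonglongrightarrow> 0 \<and> (\<forall>n. x n \<le> e + y n)"
  shows "x \<longlonglongrightarrow> 0"
proof (rule LIMSEQ_I)
  fix r :: real assume r: "r > 0"
  then obtain y where y: "y \<longlonglongrightarrow> 0" "\<And>n. x n \<le> r/2 + y n" using assms(2)[of "r/2"] by auto
  from LIMSEQ_D[OF y(1), of "r/2"] r obtain N where "\<And>n. n \<ge> N \<Longrightarrow> \<bar>y n\<bar> < r/2" by auto
  then have "norm (x n - 0) < r" if "n \<ge> N" for n
    using that y(2)[of n] assms(1)[of n] by (smt (verit) field_sum_of_halves real_norm_def)
  then show "\<exists>no. \<forall>n\<ge>no. norm (x n - 0) < r" by blast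
qed

text \<open>Induction over integrable functions: indicators reduce to open sets by outer regularity,
  sums follow from the triangle inequality, and limits from approximation in mean.\<close>

theorem L1_translation_tendsto:
  fixes F :: "'a::euclidean_space \<Rightarrow> 'b::{banach, second_countable_topology}"
  assumes "integrable lborel F" and X: "X \<longlonglongrightarrow> 0"
  shows "(\<lambda>n. \<integral>t. norm (F (t + X n) - F t) \<partial>lborel) \<longlonglongrightarrow> 0"
  using assms(1)
proof (induction rule: integrable_induct)
  case (base A c)
  have [measurable]: "A \<in> sets borel" using base by simp
  have *: "(\<lambda>n. \<integral>t. norm (indicator A (t + X n) - indicator A t :: real) \<partial>lborel) \<longlonglongrightarrow> 0"
  proof (rule tendsto_zero_approx)
    fix e :: real assume e: "e > 0"
    \<comment> \<open>The tolerance is \<open>e/2\<close> because \<open>translation_approx\<close>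
      counts the approximation error twice.\<close>
    obtain U where U: "open U" "A \<subseteq> U" "emeasure lborel (U - A) < ennreal (e/2)"
      using outer_regular_lborel[of A "e/2"] e by auto
    have [measurable]: "U \<in> sets borel" using U by simp
    have "emeasure lborel U = emeasure lborel A + emeasure lborel (U - A)"
      using U by (subst plus_emeasure) (auto intro!: arg_cong[where f="emeasure lborel"])
    then have finU: "emeasure lborel U < \<infinity>" using base U(3) by (auto simp: less_top[symmetric])
    have iA: "integrable lborel (indicator A :: 'a \<Rightarrow> real)" using base by (simp add: integrable_indicator_iff)
    have iU: "integrable lborel (indicator U :: 'a \<Rightarrow> real)" using finU by (simp add: integrable_indicator_iff)
    have "(\<integral>t. norm (indicator A t - indicator U t :: real) \<partial>lborel) = (\<integral>t. indicator (U - A) t \<partial>lborel)"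
      using U(2) by (intro Bochner_Integration.integral_cong) (auto split: split_indicator)
    also have "\<dots> = measure lborel (U - A)" by simp
    also have "\<dots> \<le> e/2"
      using U(3) e unfolding measure_def by (intro enn2real_leI) auto
    finally have "(\<integral>t. norm (indicator A (t + X n) - indicator A t :: real) \<partial>lborel) \<le>
        e + (\<integral>t. \<bar>indicator U (t + X n) - indicator U t :: real\<bar> \<partial>lborel)" for n
      using translation_approx[OF iA iU, of "X n"] by simp
    then show "\<exists>y. y \<longlonglongrightarrow> 0 \<and> (\<forall>n. (\<integral>t. norm (indicator A (t + X n) - indicator A t :: real) \<partial>lborel) \<le> e + y n)"
      using translation_tendsto_open[OF U(1) finU X] by (intro exI conjI) auto
  qed simp
  have "norm (indicator A (t + X n) *\<^sub>R c - indicator A t *\<^sub>R c)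
    = norm (indicator A (t + X n) - indicator A t :: real) * norm c" for t n
    by (simp flip: scaleR_diff_left)
  then show ?case using tendsto_mult_right[OF *, of "norm c"] by simp
next
  case (add f g)
  show ?case
  proof (rule tendsto_sandwich[OF _ _ tendsto_const])
    show "(\<lambda>n. (\<integral>t. norm (f (t + X n) - f t) \<partial>lborel) + (\<integral>t. norm (g (t + X n) - g t) \<partial>lborel)) \<longlonglongrightarrow> 0"
      using tendsto_add[OF add.IH] by simp
    have "(\<integral>t. norm (f (t + X n) + g (t + X n) - (f t + g t)) \<partial>lborel)
      \<le> (\<integral>t. norm (f (t + X n) - f t) + norm (g (t + X n) - g t) \<partial>lborel)" for n
    proof (rule integral_mono)
      show "norm (f (t + X n) + g (t + X n) - (f t + g t)) \<le> norm (f (t + X n) - f t) + norm (g (t + X n) - g t)" for t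
        by (metis add_diff_add norm_triangle_ineq)
      show "integrable lborel (\<lambda>t. norm (f (t + X n) + g (t + X n) - (f t + g t)))"
        using translation_diff_integrable[of "\<lambda>t. f t + g t" "X n"] add.hyps by auto
    qed (auto intro!: Bochner_Integration.integrable_add integrable_norm translation_diff_integrable add.hyps)
    then show "\<forall>\<^sub>F n in sequentially. (\<integral>t. norm (f (t + X n) + g (t + X n) - (f t + g t)) \<partial>lborel)
      \<le> (\<integral>t. norm (f (t + X n) - f t) \<partial>lborel) + (\<integral>t. norm (g (t + X n) - g t) \<partial>lborel)"
      by (simp add: Bochner_Integration.integral_add[OF
            integrable_norm[OF translation_diff_integrable[OF add.hyps(1)]]
            integrable_norm[OF translation_diff_integrable[OF add.hyps(2)]], symmetric])
  qed simp
next
  case (lim f s)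
  show ?case
  proof (rule tendsto_zero_approx)
    fix e :: real assume e: "e > 0"
    have [measurable]: "f \<in> borel_measurable lborel" "\<And>i. s i \<in> borel_measurable lborel"
      using lim.hyps by auto
    \<comment> \<open>The induction supplies approximants with
      \<open>norm (s i x) \<le> 2 * norm (f x)\<close>, whence the dominating function
      \<open>3 * norm (f t)\<close>.\<close>
    have "(\<lambda>i. \<integral>t. norm (f t - s i t) \<partial>lborel) \<longlonglongrightarrow> (\<integral>t. 0 \<partial>(lborel :: 'a measure))"
    proof (rule integral_dominated_convergence[where w="\<lambda>t. 3 * norm (f t)"])
      show "AE x in lborel. (\<lambda>i. norm (f x - s i x)) \<longlonglongrightarrow> 0"
      proof (intro AE_I2)
        fix x
        have "(\<lambda>i. norm (f x - s i x)) \<longlonglongrightarrow> norm (f x - f x)"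
          using lim.hyps(2)[of x] by (intro tendsto_intros) auto
        then show "(\<lambda>i. norm (f x - s i x)) \<longlonglongrightarrow> 0" by simp
      qed
      show "AE x in lborel. norm (norm (f x - s i x)) \<le> 3 * norm (f x)" for i
      proof (intro AE_I2)
        fix x
        show "norm (norm (f x - s i x)) \<le> 3 * norm (f x)"
          using lim.hyps(3)[of x i] norm_triangle_ineq4[of "f x" "s i x"] by simp
      qed
    qed (use lim.hyps in auto)
    from LIMSEQ_D[OF this, of "e/2"] e obtain i where i: "(\<integral>t. norm (f t - s i t) \<partial>lborel) < e/2"
      by (auto simp: abs_less_iff)
    show "\<exists>y. y \<longlonglongrightarrow> 0 \<and> (\<forall>n. (\<integral>t. norm (f (t + X n) - f t) \<partial>lborel) \<le> e + y n)"
    proof (intro exI conjI allI)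
      show "(\<lambda>n. \<integral>t. norm (s i (t + X n) - s i t) \<partial>lborel) \<longlonglongrightarrow> 0" by (rule lim.IH)
      show "(\<integral>t. norm (f (t + X n) - f t) \<partial>lborel) \<le> e + (\<integral>t. norm (s i (t + X n) - s i t) \<partial>lborel)" for n
        using translation_approx[OF lim.hyps(4) lim.hyps(1)[of i], of "X n"] i by linarith
    qed
  qed simp
qed

text \<open>The map \<open>w \<mapsto> \<bar>w\<bar> w\<close> from \<open>L\<^sup>2\<close> to \<open>L\<^sup>1\<close> has a \<open>1/2\<close>-Hoelder inverse.\<close>

lemma norm_diff_sq_le:
  fixes w z :: "'a::real_inner"
  shows "(norm (w - z))\<^sup>2 \<le> 2 * norm (norm w *\<^sub>R w - norm z *\<^sub>R z)"
proof (cases "w = z")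
  case False
  \<comment> \<open>Both terms on the right are nonnegative. Dropping the second, bounding
    \<open>norm w + norm z\<close> below by \<open>norm (w - z)\<close> and the left side above by
    Cauchy-Schwarz leaves the claim multiplied by \<open>norm (w - z)\<close>.\<close>
  have "2 * ((norm w *\<^sub>R w - norm z *\<^sub>R z) \<bullet> (w - z))
    = (norm w + norm z) * (norm (w - z))\<^sup>2 + (norm w + norm z) * (norm w - norm z)\<^sup>2"
  proof -
    have sq: "(norm (w - z))\<^sup>2 = (norm w)\<^sup>2 + (norm z)\<^sup>2 - 2 * (w \<bullet> z)"
      by (simp add: power2_norm_eq_inner inner_diff_left inner_diff_right inner_commute[of z w])
    have "(norm w *\<^sub>R w - norm z *\<^sub>R z) \<bullet> (w - z)
      = norm w * (norm w)\<^sup>2 + norm z * (norm z)\<^sup>2 - (norm w + norm z) * (w \<bullet> z)"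
      by (simp add: power2_norm_eq_inner inner_diff_left inner_diff_right inner_commute[of z w] ring_distribs)
    then show ?thesis
      by (simp only: sq) (simp add: power2_eq_square algebra_simps)
  qed
  moreover have "(norm w *\<^sub>R w - norm z *\<^sub>R z) \<bullet> (w - z) \<le> norm (norm w *\<^sub>R w - norm z *\<^sub>R z) * norm (w - z)"
    by (rule norm_cauchy_schwarz)
  moreover have "norm (w - z) * (norm (w - z))\<^sup>2 \<le> (norm w + norm z) * (norm (w - z))\<^sup>2"
    by (intro mult_right_mono norm_triangle_ineq4) auto
  moreover have "0 \<le> (norm w + norm z) * (norm w - norm z)\<^sup>2" by simp
  ultimately have "(norm (w - z))\<^sup>2 * norm (w - z) \<le> 2 * norm (norm w *\<^sub>R w - norm z *\<^sub>R z) * norm (w - z)"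
    unfolding mult.commute[of "(norm (w - z))\<^sup>2" "norm (w - z)"] by linarith
  then show ?thesis using False by (simp add: mult_le_cancel_right)
qed auto

lemma L2_translate:
  assumes "f \<in> L2"
  shows "(\<lambda>t. f (t + a)) \<in> L2" "L2_norm (\<lambda>t. f (t + a)) = L2_norm f"
proof -
  have [measurable]: "f \<in> borel_measurable borel" using L2_measurable[OF assms] by simp
  show "(\<lambda>t. f (t + a)) \<in> L2"
    using integrable_lborel_translate[OF L2_integrable_sq[OF assms], of a]
    by (simp add: L2_def add.commute)
  show "L2_norm (\<lambda>t. f (t + a)) = L2_norm f"
    using integral_lborel_translate[of "\<lambda>t. (cmod (f t))\<^sup>2" a]
    by (simp add: L2_norm_def add.commute)
qed

text \<open>For square integrable \<open>g\<close> the function \<open>cmod (g t) * g t\<close> is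
  integrable and determines \<open>g\<close> with Hoelder control, so continuity in mean square is
  inherited from continuity in mean, with no separate density argument.\<close>

theorem L2_translation_tendsto:
  assumes g: "g \<in> L2" and X: "X \<longlonglongrightarrow> 0"
  shows "(\<lambda>n. L2_norm (\<lambda>t. g (t + X n) - g t)) \<longlonglongrightarrow> 0"
proof -
  have [measurable]: "g \<in> borel_measurable borel" using L2_measurable[OF g] by simp
  let ?F = "\<lambda>t. cmod (g t) *\<^sub>R g t"
  have F: "integrable lborel ?F"
    by (rule Bochner_Integration.integrable_bound[OF L2_integrable_sq[OF g]])
      (auto simp: power2_eq_square)
  have le: "(L2_norm (\<lambda>t. g (t + X n) - g t))\<^sup>2 \<le> 2 * (\<integral>t. norm (?F (t + X n) - ?F t) \<partial>lborel)" for n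
  proof -
    have "(\<integral>t. (cmod (g (t + X n) - g t))\<^sup>2 \<partial>lborel)
        \<le> (\<integral>t. 2 * norm (?F (t + X n) - ?F t) \<partial>lborel)"
    proof (rule integral_mono)
      show "integrable lborel (\<lambda>t. (cmod (g (t + X n) - g t))\<^sup>2)"
        by (rule L2_integrable_sq[OF L2_diff[OF L2_translate(1)[OF g] g]])
      show "integrable lborel (\<lambda>t. 2 * norm (?F (t + X n) - ?F t))"
        by (rule integrable_mult_right[OF integrable_norm[OF translation_diff_integrable[OF F]]])
    qed (rule norm_diff_sq_le)
    then show ?thesis by (simp add: L2_norm_sq)
  qed
  have lim: "(\<lambda>n. 2 * (\<integral>t. norm (?F (t + X n) - ?F t) \<partial>lborel)) \<longlonglongrightarrow> 0"
    using tendsto_mult_left[OF L1_translation_tendsto[OF F X], of 2] by simp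
  have "(\<lambda>n. (L2_norm (\<lambda>t. g (t + X n) - g t))\<^sup>2) \<longlonglongrightarrow> 0"
    by (rule tendsto_sandwich[OF _ _ tendsto_const lim]) (simp_all only: le zero_le_power2 eventually_True)
  from tendsto_real_sqrt[OF this] show ?thesis by simp
qed

section \<open>Time-frequency shifts\<close>

lemma tf_shift_cis: "tf_shift z g t = cis (2 * pi * (snd z \<bullet> t)) * g (t - fst z)"
  by (cases z) (simp add: tf_shift_def cis_conv_exp mult_ac)

lemma tf_shift_zero [simp]: "tf_shift 0 g = g"
  by (simp add: tf_shift_cis fun_eq_iff)

text \<open>Moving the translation by \<open>fst z\<close> past the modulation by
  \<open>snd w\<close> produces the phase: the shifts form only a projective representation. All
  position-dependent phases of the Gram matrix originate here.\<close>

lemma tf_shift_add: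
  "tf_shift (z + w) g t = cis (2 * pi * (snd w \<bullet> fst z)) * tf_shift z (tf_shift w g) t"
proof -
  have "cis (2 * pi * ((snd z + snd w) \<bullet> t)) =
      cis (2 * pi * (snd w \<bullet> fst z)) * (cis (2 * pi * (snd z \<bullet> t)) * cis (2 * pi * (snd w \<bullet> (t - fst z))))"
    by (simp add: cis_mult inner_simps algebra_simps)
  then show ?thesis by (simp add: tf_shift_cis diff_diff_eq mult.assoc)
qed

lemma tf_shift_sum: "tf_shift z (\<lambda>t. \<Sum>i\<in>F. c i * u i t) t = (\<Sum>i\<in>F. c i * tf_shift z (u i) t)"
  by (simp add: tf_shift_cis sum_distrib_left mult_ac)

lemma borel_measurable_cis [measurable]:
  assumes [measurable]: "r \<in> borel_measurable M"
  shows "(\<lambda>x. cis (r x)) \<in> borel_measurable M"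
  unfolding cis_conv_exp by measurable

lemma borel_measurable_tf_shift [measurable]:
  assumes [measurable]: "g \<in> borel_measurable borel"
  shows "tf_shift z g \<in> borel_measurable borel"
  unfolding tf_shift_cis[abs_def] by measurable

lemma tf_shift_L2:
  assumes g: "g \<in> L2"
  shows "tf_shift z g \<in> L2" "L2_norm (tf_shift z g) = L2_norm g"
proof -
  have eq: "(cmod (tf_shift z g t))\<^sup>2 = (cmod (g (t + - fst z)))\<^sup>2" for t
    by (simp add: tf_shift_cis norm_mult)
  have "integrable lborel (\<lambda>t. (cmod (tf_shift z g t))\<^sup>2)"
    unfolding eq using L2_integrable_sq[OF L2_translate(1)[OF g]] .
  then show "tf_shift z g \<in> L2"
    using L2_measurable[OF g] by (simp add: L2_def)
  show "L2_norm (tf_shift z g) = L2_norm g"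
    using L2_translate(2)[OF g, of "- fst z"] by (simp add: L2_norm_def eq)
qed

lemma L2_inner_tf_shift:
  assumes "f \<in> L2" "h \<in> L2"
  shows "L2_inner (tf_shift z f) (tf_shift z h) = L2_inner f h"
proof -
  have [measurable]: "f \<in> borel_measurable borel" "h \<in> borel_measurable borel"
    using assms[THEN L2_measurable] by auto
  have "L2_inner (tf_shift z f) (tf_shift z h) = (\<integral>t. f (- fst z + t) * cnj (h (- fst z + t)) \<partial>lborel)"
  proof -
    have "(cis a * x) * cnj (cis a * y) = x * cnj y" for a x y
    proof -
      have "(cis a * x) * cnj (cis a * y) = (cis a * cnj (cis a)) * (x * cnj y)" by (simp add: mult_ac)
      also have "cis a * cnj (cis a) = 1" by (simp add: cis_cnj cis_mult)
      finally show ?thesis by simp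
    qed
    then show ?thesis unfolding L2_inner_def tf_shift_cis by (simp only: uminus_add_conv_diff)
  qed
  also have "\<dots> = L2_inner f h"
    unfolding L2_inner_def
    using borel_measurable_integrable[OF L2_integrable_mult[OF assms]]
    by (intro integral_lborel_translate[symmetric]) simp
  finally show ?thesis .
qed

lemma L2_inner_scale_right: "L2_inner f (\<lambda>t. a * h t) = cnj a * L2_inner f h"
  by (simp add: L2_inner_def mult_ac flip: integral_mult_right_zero)

text \<open>By unitarity of \<open>tf_shift z\<close>, a Gram entry is the ambiguity function at the
  difference of the two points times a phase. Only the phase remembers the absolute position, so
  estimates by modulus see differences alone.\<close>

lemma L2_inner_tf_shift_tf_shift:
  assumes "g \<in> L2"
  shows "L2_inner (tf_shift z g) (tf_shift w g) =
    cis (- 2 * pi * ((snd w - snd z) \<bullet> fst z)) * L2_inner g (tf_shift (w - z) g)"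
proof -
  have "tf_shift w g = (\<lambda>t. cis (2 * pi * ((snd w - snd z) \<bullet> fst z)) * tf_shift z (tf_shift (w - z) g) t)"
    using tf_shift_add[of z "w - z" g] by (simp add: fun_eq_iff)
  then have "L2_inner (tf_shift z g) (tf_shift w g) =
      cnj (cis (2 * pi * ((snd w - snd z) \<bullet> fst z))) * L2_inner (tf_shift z g) (tf_shift z (tf_shift (w - z) g))"
    by (simp add: L2_inner_scale_right)
  then show ?thesis
    using assms by (simp add: L2_inner_tf_shift tf_shift_L2 cis_cnj)
qed

lemma norm_L2_inner_tf_shift_tf_shift:
  "g \<in> L2 \<Longrightarrow> cmod (L2_inner (tf_shift z g) (tf_shift w g)) = cmod (L2_inner g (tf_shift (w - z) g))"
  by (simp add: L2_inner_tf_shift_tf_shift norm_mult)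

text \<open>Conjugate symmetry of the inner product; it supplies the symmetric weights that Schur's
  test asks for.\<close>

lemma norm_L2_inner_tf_shift_minus:
  assumes "g \<in> L2"
  shows "cmod (L2_inner g (tf_shift (- z) g)) = cmod (L2_inner g (tf_shift z g))"
  using norm_L2_inner_tf_shift_tf_shift[OF assms, of z 0] L2_inner_commute[of "tf_shift z g" g]
  by simp

text \<open>The shift is a translation followed by a modulation. The translation is continuous in
  mean square, and the modulation is handled by dominated convergence with bound
  \<open>4 * |g|^2\<close>.\<close>

lemma tf_shift_tendsto:
  assumes g: "g \<in> L2" and Z: "Z \<longlonglongrightarrow> 0"
  shows "(\<lambda>n. L2_norm (\<lambda>t. tf_shift (Z n) g t - g t)) \<longlonglongrightarrow> 0"
proof -
  have [measurable]: "g \<in> borel_measurable borel" using L2_measurable[OF g] by simp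
  define p where "p n t = cis (2 * pi * (snd (Z n) \<bullet> t))" for n t
  have [measurable]: "p n \<in> borel_measurable borel" for n unfolding p_def[abs_def] by measurable
  have X: "(\<lambda>n. - fst (Z n)) \<longlonglongrightarrow> 0" using tendsto_minus[OF tendsto_fst[OF Z]] by simp
  have Xi: "(\<lambda>n. snd (Z n)) \<longlonglongrightarrow> 0" using tendsto_snd[OF Z] by simp
  have pg: "(\<lambda>t. p n t * g t) \<in> L2" for n
    using L2_integrable_sq[OF g] by (simp add: L2_def p_def norm_mult)
  have "(\<lambda>n. \<integral>t. (cmod (p n t * g t - g t))\<^sup>2 \<partial>lborel) \<longlonglongrightarrow> (\<integral>t. 0 \<partial>(lborel :: (real ^ 'a) measure))"
  proof (rule integral_dominated_convergence[where w="\<lambda>t. 4 * (cmod (g t))\<^sup>2"])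
    show "AE t in lborel. (\<lambda>n. (cmod (p n t * g t - g t))\<^sup>2) \<longlonglongrightarrow> 0"
    proof (intro AE_I2)
      fix t
      have "(\<lambda>n. (cmod (p n t * g t - g t))\<^sup>2) \<longlonglongrightarrow> (cmod (cis (2 * pi * (0 \<bullet> t)) * g t - g t))\<^sup>2"
        unfolding p_def cis_conv_exp by (intro tendsto_intros Xi)
      then show "(\<lambda>n. (cmod (p n t * g t - g t))\<^sup>2) \<longlonglongrightarrow> 0" by simp
    qed
    show "AE t in lborel. norm ((cmod (p n t * g t - g t))\<^sup>2) \<le> 4 * (cmod (g t))\<^sup>2" for n
    proof (intro AE_I2)
      fix t
      have "cmod (p n t * g t - g t) \<le> 2 * cmod (g t)"
        using norm_triangle_ineq4[of "p n t * g t" "g t"] by (simp add: norm_mult p_def)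
      then have "(cmod (p n t * g t - g t))\<^sup>2 \<le> (2 * cmod (g t))\<^sup>2" by (intro power_mono) auto
      then show "norm ((cmod (p n t * g t - g t))\<^sup>2) \<le> 4 * (cmod (g t))\<^sup>2"
        by (simp add: power_mult_distrib)
    qed
    show "integrable lborel (\<lambda>t. 4 * (cmod (g t))\<^sup>2)" using L2_integrable_sq[OF g] by simp
  qed auto
  from tendsto_real_sqrt[OF this]
  have 1: "(\<lambda>n. L2_norm (\<lambda>t. p n t * g t - g t)) \<longlonglongrightarrow> 0" by (simp add: L2_norm_def)
  \<comment> \<open>The factor \<open>p n t\<close> is common to both terms and has modulus 1, so
    only the translation is left.\<close>
  have 2: "L2_norm (\<lambda>t. tf_shift (Z n) g t - p n t * g t) = L2_norm (\<lambda>t. g (t + - fst (Z n)) - g t)" for n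
    unfolding L2_norm_def by (simp add: tf_shift_cis p_def norm_mult flip: right_diff_distrib)
  show ?thesis
  proof (rule tendsto_sandwich[OF _ _ tendsto_const])
    show "(\<lambda>n. L2_norm (\<lambda>t. g (t + - fst (Z n)) - g t) + L2_norm (\<lambda>t. p n t * g t - g t)) \<longlonglongrightarrow> 0"
      using tendsto_add[OF L2_translation_tendsto[OF g X] 1] by simp
    show "\<forall>\<^sub>F n in sequentially. L2_norm (\<lambda>t. tf_shift (Z n) g t - g t) \<le>
      L2_norm (\<lambda>t. g (t + - fst (Z n)) - g t) + L2_norm (\<lambda>t. p n t * g t - g t)"
      unfolding 2[symmetric] by (intro always_eventually allI L2_norm_triangle3 tf_shift_L2 g pg)
  qed simp
qed

text \<open>Dominated convergence speaks about sequences; a sequence of counterexamples within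
  \<open>1/(n+1)\<close> of 0 turns that into a neighbourhood.\<close>

lemma tf_shift_near_zero:
  assumes g: "g \<in> L2" and e: "e > 0"
  obtains d where "d > 0" "\<And>z. norm z < d \<Longrightarrow> L2_norm (\<lambda>t. tf_shift z g t - g t) < e"
proof (rule ccontr)
  assume "\<not> thesis"
  with that have "\<forall>d>0. \<exists>z. norm z < d \<and> \<not> L2_norm (\<lambda>t. tf_shift z g t - g t) < e" by blast
  then have "\<forall>n. \<exists>z. norm z < inverse (real (Suc n)) \<and> \<not> L2_norm (\<lambda>t. tf_shift z g t - g t) < e" by simp
  then obtain Z where Z: "\<And>n. norm (Z n) < inverse (real (Suc n))"
    "\<And>n. \<not> L2_norm (\<lambda>t. tf_shift (Z n) g t - g t) < e" by metis
  have "Z \<longlonglongrightarrow> 0"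
    by (rule Lim_null_comparison[OF _ LIMSEQ_inverse_real_of_nat], rule always_eventually)
      (use Z(1) less_imp_le in blast)
  from LIMSEQ_D[OF tf_shift_tendsto[OF g this] e] Z(2) show False
    by auto
qed

text \<open>
  Up to a phase, \<open>tf_shift w g\<close> is \<open>tf_shift z\<close> of \<open>tf_shift (w - z) g\<close>, and on bounded sets
  that phase is close to 1; so strong continuity at 0 suffices.
\<close>

lemma tf_shift_uniform:
  assumes g: "g \<in> L2" and e: "e > 0"
  obtains d where "d > 0"
    "\<And>z w. norm z \<le> R \<Longrightarrow> norm (w - z) < d \<Longrightarrow> L2_norm (\<lambda>t. tf_shift w g t - tf_shift z g t) < e"
proof -
  obtain d1 where d1: "d1 > 0" "\<And>z. norm z < d1 \<Longrightarrow> L2_norm (\<lambda>t. tf_shift z g t - g t) < e/2"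
    using tf_shift_near_zero[OF g, of "e/2"] e by auto
  \<comment> \<open>The phase differs from 1 by at most \<open>2 * pi * d * |R|\<close>, and this is
    multiplied by the norm of \<open>g\<close>. The summand 1 keeps \<open>K\<close> positive when
    \<open>R\<close> or the norm vanishes; \<open>d * K \<le> e/2\<close> is what is used.\<close>
  define K where "K = 2 * pi * \<bar>R\<bar> * L2_norm g + 1"
  have K: "K > 0" unfolding K_def by (intro add_nonneg_pos mult_nonneg_nonneg) auto
  define d where "d = min d1 (e / (2 * K))"
  show thesis
  proof
    show "d > 0" using d1(1) K e by (simp add: d_def)
  next
    fix z w :: "(real ^ 'a) \<times> (real ^ 'a)"
    assume z: "norm z \<le> R" and w: "norm (w - z) < d"
    let ?u = "w - z" and ?r = "2 * pi * (snd (w - z) \<bullet> fst z)"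
    have [measurable]: "g \<in> borel_measurable borel" using L2_measurable[OF g] by simp
    have L: "(\<lambda>t. cis ?r * tf_shift ?u g t) \<in> L2" by (intro L2_scale tf_shift_L2 g)
    have "tf_shift w g t - tf_shift z g t = tf_shift z (\<lambda>t. cis ?r * tf_shift ?u g t - g t) t" for t
      using tf_shift_add[of z ?u g t] by (simp add: tf_shift_cis algebra_simps)
    then have "L2_norm (\<lambda>t. tf_shift w g t - tf_shift z g t) = L2_norm (\<lambda>t. cis ?r * tf_shift ?u g t - g t)"
      using tf_shift_L2(2)[OF L2_diff[OF L g], of z] by presburger
    also have "\<dots> \<le> L2_norm (\<lambda>t. cis ?r * tf_shift ?u g t - cis ?r * g t) + L2_norm (\<lambda>t. cis ?r * g t - g t)"
      by (intro L2_norm_triangle3 L L2_scale g)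
    also have "L2_norm (\<lambda>t. cis ?r * tf_shift ?u g t - cis ?r * g t) = L2_norm (\<lambda>t. tf_shift ?u g t - g t)"
      using L2_norm_scale[of "cis ?r" "\<lambda>t. tf_shift ?u g t - g t"] by (simp add: right_diff_distrib)
    also have "\<dots> < e/2" using w by (intro d1) (simp add: d_def)
    also have "L2_norm (\<lambda>t. cis ?r * g t - g t) = cmod (cis ?r - 1) * L2_norm g"
      using L2_norm_scale[of "cis ?r - 1" g] by (simp add: left_diff_distrib)
    also have "cmod (cis ?r - 1) \<le> \<bar>?r\<bar>"
      using iexp_approx1[of ?r 0] by (simp add: cis_conv_exp)
    also have "\<bar>?r\<bar> \<le> 2 * pi * (d * \<bar>R\<bar>)"
    proof -
      have "\<bar>snd ?u \<bullet> fst z\<bar> \<le> norm (snd ?u) * norm (fst z)" by (rule Cauchy_Schwarz_ineq2)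
      also have "\<dots> \<le> d * \<bar>R\<bar>"
      proof (rule mult_mono)
        show "norm (snd ?u) \<le> d" using norm_snd_le[of "snd ?u" "fst ?u", unfolded prod.collapse] w by linarith
        show "norm (fst z) \<le> \<bar>R\<bar>" using norm_fst_le[of "fst z" "snd z", unfolded prod.collapse] z by linarith
        show "0 \<le> d" using w norm_ge_zero[of ?u] by linarith
      qed simp
      finally show ?thesis by (simp add: abs_mult)
    qed
    also have "2 * pi * (d * \<bar>R\<bar>) * L2_norm g \<le> d * K" 
      using w norm_ge_zero[of "w - z"] order_le_less_trans[of 0 "norm (w - z)" d]
      by (simp add: K_def algebra_simps)
    also have "d * K \<le> e / 2" using K by (simp add: d_def min_def field_simps)
    finally show "L2_norm (\<lambda>t. tf_shift w g t - tf_shift z g t) < e"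
      by (simp add: mult_right_mono)
  qed
qed

section \<open>Gaussians and Moyal's inequality\<close>

lemma fst_borel_measurable [measurable]:
  "(fst :: 'a::{second_countable_topology} \<times> 'b::{second_countable_topology} \<Rightarrow> 'a) \<in> borel \<rightarrow>\<^sub>M borel"
  by (intro borel_measurable_continuous_onI continuous_intros)

lemma snd_borel_measurable [measurable]:
  "(snd :: 'a::{second_countable_topology} \<times> 'b::{second_countable_topology} \<Rightarrow> 'b) \<in> borel \<rightarrow>\<^sub>M borel"
  by (intro borel_measurable_continuous_onI continuous_intros)

lemma cnj_borel_measurable [measurable]: "cnj \<in> borel \<rightarrow>\<^sub>M borel"
  by (intro borel_measurable_continuous_onI continuous_intros)

lemma nn_integral_lborel_fst:
  fixes f :: "'a::euclidean_space \<times> 'b::euclidean_space \<Rightarrow> ennreal"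
  assumes [measurable]: "f \<in> borel_measurable borel"
  shows "(\<integral>\<^sup>+ z. f z \<partial>lborel) = (\<integral>\<^sup>+ x. \<integral>\<^sup>+ y. f (x, y) \<partial>lborel \<partial>lborel)"
  using lborel.nn_integral_fst[of f "lborel :: 'a measure"] by (simp add: lborel_prod)

lemma nn_integral_lborel_snd:
  fixes f :: "'a::euclidean_space \<times> 'b::euclidean_space \<Rightarrow> ennreal"
  assumes [measurable]: "f \<in> borel_measurable borel"
  shows "(\<integral>\<^sup>+ z. f z \<partial>lborel) = (\<integral>\<^sup>+ y. \<integral>\<^sup>+ x. f (x, y) \<partial>lborel \<partial>lborel)"
  using lborel_pair.nn_integral_snd[of f] by (simp add: lborel_prod)

lemma integrable_lborel_pairI:
  fixes f :: "'a::euclidean_space \<times> 'b::euclidean_space \<Rightarrow> 'c::{banach, second_countable_topology}"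
  assumes [measurable]: "f \<in> borel_measurable borel"
    and "(\<integral>\<^sup>+ x. \<integral>\<^sup>+ y. ennreal (norm (f (x, y))) \<partial>lborel \<partial>lborel) < \<infinity>"
  shows "integrable lborel f"
  unfolding integrable_iff_bounded using assms by (simp add: nn_integral_lborel_fst)

lemma integral_lborel_fst:
  fixes f :: "'a::euclidean_space \<times> 'b::euclidean_space \<Rightarrow> 'c::{banach, second_countable_topology}"
  assumes "integrable lborel f"
  shows "(\<integral>z. f z \<partial>lborel) = (\<integral>x. \<integral>y. f (x, y) \<partial>lborel \<partial>lborel)"
  using lborel_pair.integral_fst'[of f] assms by (simp add: lborel_prod)

lemma integral_lborel_snd:
  fixes f :: "'a::euclidean_space \<times> 'b::euclidean_space \<Rightarrow> 'c::{banach, second_countable_topology}"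
  assumes "integrable lborel f"
  shows "(\<integral>z. f z \<partial>lborel) = (\<integral>y. \<integral>x. f (x, y) \<partial>lborel \<partial>lborel)"
  using lborel_pair.integral_snd[of "\<lambda>x y. f (x, y)"] assms by (simp add: lborel_prod)

section \<open>Fourier transform of Gaussians\<close>

text \<open>Up to the factor \<open>sqrt (2 * pi)\<close> this is the characteristic function of the
  standard normal distribution.\<close>

lemma gaussian_1d:
  shows "integrable lborel (\<lambda>x. complex_of_real (exp (- x\<^sup>2 / 2)) * cis (x * t))"
    and "(\<integral>x. complex_of_real (exp (- x\<^sup>2 / 2)) * cis (x * t) \<partial>lborel)
      = complex_of_real (sqrt (2 * pi) * exp (- t\<^sup>2 / 2))"
proof -
  have eq: "complex_of_real (exp (- x\<^sup>2 / 2)) * cis (x * t)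
    = complex_of_real (sqrt (2 * pi)) * (std_normal_density x *\<^sub>R iexp (t * x))" for x
    by (simp add: std_normal_density_def scaleR_conv_of_real cis_conv_exp mult_ac)
  have i: "integrable lborel (\<lambda>x. std_normal_density x *\<^sub>R iexp (t * x))"
    by (rule Bochner_Integration.integrable_bound[OF integrable_std_normal_moment[of 0]]) simp_all
  then show "integrable lborel (\<lambda>x. complex_of_real (exp (- x\<^sup>2 / 2)) * cis (x * t))"
    unfolding eq by (intro integrable_mult_right) simp
  have "(\<integral>x. std_normal_density x *\<^sub>R iexp (t * x) \<partial>lborel) = char std_normal_distribution t"
    unfolding char_def by (subst integral_density) auto
  then show "(\<integral>x. complex_of_real (exp (- x\<^sup>2 / 2)) * cis (x * t) \<partial>lborel)
      = complex_of_real (sqrt (2 * pi) * exp (- t\<^sup>2 / 2))"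
    unfolding eq integral_mult_right_zero by (simp add: char_std_normal_distribution)
qed

lemma cis_sum: "finite I \<Longrightarrow> cis (\<Sum>i\<in>I. f i) = (\<Prod>i\<in>I. cis (f i))"
  by (induction I rule: finite_induct) (auto simp: cis_mult[symmetric])

text \<open>Lebesgue measure is the image of a product measure under the coordinates of the
  orthonormal \<open>Basis\<close>, and both the Gaussian and the character factor along it.\<close>

lemma gaussian_fourier:
  fixes y :: "'a::euclidean_space"
  shows "integrable lborel (\<lambda>x. complex_of_real (exp (- (norm x)\<^sup>2 / 2)) * cis (x \<bullet> y))" (is ?int)
    and "(\<integral>x. complex_of_real (exp (- (norm x)\<^sup>2 / 2)) * cis (x \<bullet> y) \<partial>lborel)
      = complex_of_real (sqrt (2 * pi) ^ DIM('a) * exp (- (norm y)\<^sup>2 / 2))" (is ?eq)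
proof -
  interpret product_sigma_finite "\<lambda>_::'a. lborel :: real measure" ..
  let ?G = "\<lambda>x::'a. complex_of_real (exp (- (norm x)\<^sup>2 / 2)) * cis (x \<bullet> y)"
  let ?S = "\<lambda>f::'a \<Rightarrow> real. \<Sum>b\<in>Basis. f b *\<^sub>R b"
  let ?g = "\<lambda>b x. complex_of_real (exp (- x\<^sup>2 / 2)) * cis (x * (y \<bullet> b))"
  have exp_norm: "complex_of_real (exp (- (norm x)\<^sup>2 / 2)) = (\<Prod>b\<in>Basis. complex_of_real (exp (- (x \<bullet> b)\<^sup>2 / 2)))"
    for x :: 'a
    unfolding power2_norm_eq_inner euclidean_inner[of x x]
    by (simp add: exp_sum[symmetric] power2_eq_square sum_negf sum_divide_distrib flip: of_real_prod)
  have "?G x = (\<Prod>b\<in>Basis. ?g b (x \<bullet> b))" for x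
    unfolding exp_norm euclidean_inner[of x y] by (simp add: cis_sum prod.distrib)
  then have G: "?G (?S f) = (\<Prod>b\<in>Basis. ?g b (f b))" for f
    by (simp cong: prod.cong)
  have gi: "integrable lborel (?g b)" for b by (rule gaussian_1d)
  show ?int
  proof (subst lborel_eq, subst integrable_distr_eq)
    show "integrable (\<Pi>\<^sub>M b\<in>Basis. lborel) (\<lambda>f. ?G (?S f))"
      unfolding G by (intro product_integrable_prod gi) auto
  qed auto
  have "(\<integral>x. ?G x \<partial>lborel) = (\<integral>f. (\<Prod>b\<in>Basis. ?g b (f b)) \<partial>(\<Pi>\<^sub>M b\<in>Basis. lborel))"
    unfolding G[symmetric] by (subst lborel_eq, subst integral_distr) auto
  also have "\<dots> = (\<Prod>b\<in>Basis. \<integral>x. ?g b x \<partial>lborel)"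
    by (intro product_integral_prod gi) auto
  also have "\<dots> = complex_of_real (sqrt (2 * pi) ^ DIM('a) * exp (- (norm y)\<^sup>2 / 2))"
    unfolding gaussian_1d of_real_mult exp_norm by (simp add: prod.distrib del: real_sqrt_mult)
  finally show ?eq .
qed

lemma gaussian_fourier_scaled:
  fixes a :: "'a::euclidean_space"
  assumes e: "e > 0"
  shows "integrable lborel (\<lambda>x. complex_of_real (exp (- (e * norm x)\<^sup>2 / 2)) * cis (x \<bullet> a))" (is ?int)
    and "(\<integral>x. complex_of_real (exp (- (e * norm x)\<^sup>2 / 2)) * cis (x \<bullet> a) \<partial>lborel)
      = complex_of_real ((sqrt (2 * pi) / e) ^ DIM('a) * exp (- (norm a / e)\<^sup>2 / 2))" (is ?eq)
proof -
  let ?G = "\<lambda>x::'a. complex_of_real (exp (- (norm x)\<^sup>2 / 2)) * cis (x \<bullet> ((1/e) *\<^sub>R a))"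
  let ?H = "\<lambda>x::'a. complex_of_real (exp (- (e * norm x)\<^sup>2 / 2)) * cis (x \<bullet> a)"
  have GH: "?G (0 + e *\<^sub>R x) = ?H x" for x using e by simp
  show ?int
    using integrable_lborel_affine[OF _ gaussian_fourier(1), of e 0 "(1/e) *\<^sub>R a"] e unfolding GH by simp
  have "(\<integral>x. ?G x \<partial>lborel) = \<bar>e\<bar> ^ DIM('a) *\<^sub>R (\<integral>x. ?H x \<partial>lborel)"
    using e by (subst integral_lborel_affine[of e _ 0]) (auto simp: GH)
  then have "\<bar>e\<bar> ^ DIM('a) *\<^sub>R (\<integral>x. ?H x \<partial>lborel)
     = complex_of_real (sqrt (2 * pi) ^ DIM('a) * exp (- (norm a / e)\<^sup>2 / 2))"
    using e gaussian_fourier(2)[of "(1/e) *\<^sub>R a"] by simp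
  then have "complex_of_real (e ^ DIM('a)) * (\<integral>x. ?H x \<partial>lborel)
     = complex_of_real (sqrt (2 * pi) ^ DIM('a) * exp (- (norm a / e)\<^sup>2 / 2))"
    using e by (simp add: scaleR_conv_of_real)
  then have "(\<integral>x. ?H x \<partial>lborel)
     = complex_of_real (sqrt (2 * pi) ^ DIM('a) * exp (- (norm a / e)\<^sup>2 / 2)) / complex_of_real (e ^ DIM('a))"
    using e by (simp add: field_simps)
  then show ?eq by (simp add: power_divide)
qed

lemma L2_nn_integral_mult_le:
  assumes "f \<in> L2" "h \<in> L2"
  shows "(\<integral>\<^sup>+ t. ennreal (cmod (f t) * cmod (h t)) \<partial>lborel) \<le> ennreal (L2_norm f * L2_norm h)"
  using L2_Cauchy_Schwarz[OF assms] by (simp add: nn_integral_eq_integral ennreal_leI)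

lemma integrable_lborel_pairI_snd:
  fixes f :: "'a::euclidean_space \<times> 'b::euclidean_space \<Rightarrow> 'c::{banach, second_countable_topology}"
  assumes [measurable]: "f \<in> borel_measurable borel"
    and "(\<integral>\<^sup>+ y. \<integral>\<^sup>+ x. ennreal (norm (f (x, y))) \<partial>lborel \<partial>lborel) < \<infinity>"
  shows "integrable lborel f"
  unfolding integrable_iff_bounded using assms by (simp add: nn_integral_lborel_snd)

lemma integrable_lborel_snd:
  fixes f :: "'a::euclidean_space \<times> 'b::euclidean_space \<Rightarrow> 'c::{banach, second_countable_topology}"
  assumes "integrable lborel f"
  shows "integrable lborel (\<lambda>y. \<integral>x. f (x, y) \<partial>lborel)"
  using lborel_pair.integrable_snd[of "\<lambda>x y. f (x, y)"] assms by (simp add: lborel_prod)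

text \<open>The Fourier transform of the weight \<open>exp (- (e * norm x)^2 / 2)\<close> with
  respect to the characters \<open>cis (2 * pi * (x \<bullet> a))\<close>. It has integral 1 and
  concentrates at 0 as \<open>e\<close> tends to 0.\<close>

definition gauss_kernel :: "real \<Rightarrow> 'a::euclidean_space \<Rightarrow> real" where
  "gauss_kernel e a = (sqrt (2 * pi) / e) ^ DIM('a) * exp (- (2 * pi * norm a / e)\<^sup>2 / 2)"

lemma gauss_kernel_measurable [measurable]: "gauss_kernel e \<in> borel_measurable borel"
  unfolding gauss_kernel_def[abs_def] by measurable

lemma gauss_weight_transform:
  assumes e: "e > 0"
  shows "(\<integral>x. complex_of_real (exp (- (e * norm x)\<^sup>2 / 2)) * cis (2 * pi * (x \<bullet> a)) \<partial>lborel)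
    = complex_of_real (gauss_kernel e a)"
  using gaussian_fourier_scaled(2)[OF e, of "(2 * pi) *\<^sub>R a"] by (simp add: gauss_kernel_def)

lemma gauss_weight_integrable:
  assumes e: "e > 0"
  shows "integrable lborel (\<lambda>x::'a::euclidean_space. exp (- (e * norm x)\<^sup>2 / 2))"
proof -
  have "integrable lborel (\<lambda>x::'a. complex_of_real (exp (- (e * norm x)\<^sup>2 / 2)))"
    using gaussian_fourier_scaled(1)[OF e, of 0] by (simp del: complex_of_real_integrable_eq)
  then show ?thesis by (simp only: complex_of_real_integrable_eq)
qed

lemma gauss_weight_integral:
  assumes e: "e > 0"
  shows "(\<integral>x. exp (- (e * norm x)\<^sup>2 / 2) \<partial>(lborel :: 'a::euclidean_space measure)) = (sqrt (2 * pi) / e) ^ DIM('a)"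
proof -
  have "complex_of_real (\<integral>x. exp (- (e * norm x)\<^sup>2 / 2) \<partial>(lborel :: 'a measure))
    = complex_of_real ((sqrt (2 * pi) / e) ^ DIM('a))"
    using gaussian_fourier_scaled(2)[OF e, of "0::'a"] by simp
  then show ?thesis by (simp only: of_real_eq_iff)
qed

lemma gauss_kernel_integrable:
  assumes e: "e > 0"
  shows "integrable lborel (gauss_kernel e :: 'a::euclidean_space \<Rightarrow> real)"
  using gauss_weight_integrable[of "2 * pi / e", where 'a='a] e
  by (simp add: gauss_kernel_def[abs_def] mult_ac)

section \<open>Plancherel's formula with a Gaussian weight\<close>

text \<open>With \<open>z = (t, a)\<close>, integrating first over the lag \<open>a\<close> gives
  the integral of \<open>|p|\<close> independently of \<open>t\<close>, by reflection invariance;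
  then \<open>t\<close> contributes the integral of \<open>|q|\<close>.\<close>

lemma convolution_integrable:
  fixes p q :: "'a::euclidean_space \<Rightarrow> complex"
  assumes p: "integrable lborel p" and q: "integrable lborel q"
  shows "integrable lborel (\<lambda>z. p (fst z - snd z) * cnj (q (fst z)))"
proof (rule integrable_lborel_pairI)
  have [measurable]: "p \<in> borel_measurable borel" "q \<in> borel_measurable borel"
    using borel_measurable_integrable[OF p] borel_measurable_integrable[OF q] by auto
  show "(\<lambda>z. p (fst z - snd z) * cnj (q (fst z))) \<in> borel_measurable borel" by measurable
  have "(\<integral>\<^sup>+ t. \<integral>\<^sup>+ a. ennreal (cmod (p (t - a) * cnj (q t))) \<partial>lborel \<partial>lborel)
    = (\<integral>\<^sup>+ t. ennreal (cmod (q t)) * (\<integral>\<^sup>+ a. ennreal (cmod (p (t - a))) \<partial>lborel) \<partial>lborel)"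
    by (simp add: norm_mult ennreal_mult nn_integral_cmult[symmetric] mult.commute)
  also have "\<dots> = (\<integral>\<^sup>+ t. ennreal (cmod (q t)) * (\<integral>\<^sup>+ s. ennreal (cmod (p s)) \<partial>lborel) \<partial>lborel)"
    by (subst nn_integral_lborel_reflect[of "\<lambda>s. ennreal (cmod (p s))", symmetric]) auto
  also have "\<dots> = (\<integral>\<^sup>+ t. ennreal (cmod (q t)) \<partial>lborel) * (\<integral>\<^sup>+ s. ennreal (cmod (p s)) \<partial>lborel)"
    by (rule nn_integral_multc) measurable
  also have "\<dots> < \<infinity>"
    using p q unfolding integrable_iff_bounded by (simp add: ennreal_mult_less_top)
  finally show "(\<integral>\<^sup>+ t. \<integral>\<^sup>+ a. ennreal (norm (p (fst (t, a) - snd (t, a)) * cnj (q (fst (t, a))))) \<partial>lborel \<partial>lborel) < \<infinity>"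
    by simp
qed

text \<open>Substituting \<open>s = t - a\<close> in the product of the two integrals makes the
  characters combine into one that depends on the lag \<open>a\<close> only.\<close>

lemma fourier_product:
  fixes p q :: "'a::euclidean_space \<Rightarrow> complex"
  assumes p: "integrable lborel p" and q: "integrable lborel q"
  shows "(\<integral>s. p s * cis (- 2 * pi * (\<xi> \<bullet> s)) \<partial>lborel) * cnj (\<integral>t. q t * cis (- 2 * pi * (\<xi> \<bullet> t)) \<partial>lborel)
    = (\<integral>z. p (fst z - snd z) * cnj (q (fst z)) * cis (2 * pi * (\<xi> \<bullet> snd z)) \<partial>lborel)"
proof -
  have [measurable]: "p \<in> borel_measurable borel" "q \<in> borel_measurable borel"
    using borel_measurable_integrable[OF p] borel_measurable_integrable[OF q] by auto
  have "integrable lborel (\<lambda>z. p (fst z - snd z) * cnj (q (fst z)) * cis (2 * pi * (\<xi> \<bullet> snd z)))"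
    by (rule Bochner_Integration.integrable_bound[OF convolution_integrable[OF p q]]) (auto simp: norm_mult)
  from integral_lborel_fst[OF this]
  have "(\<integral>z. p (fst z - snd z) * cnj (q (fst z)) * cis (2 * pi * (\<xi> \<bullet> snd z)) \<partial>lborel)
    = (\<integral>t. \<integral>a. p (t - a) * cnj (q t) * cis (2 * pi * (\<xi> \<bullet> a)) \<partial>lborel \<partial>lborel)" by simp
  also have "\<dots> = (\<integral>t. (\<integral>s. p s * cis (- 2 * pi * (\<xi> \<bullet> s)) \<partial>lborel) * cnj (q t * cis (- 2 * pi * (\<xi> \<bullet> t))) \<partial>lborel)"
  proof (intro Bochner_Integration.integral_cong refl)
    fix t
    have "p (t - a) * cnj (q t) * cis (2 * pi * (\<xi> \<bullet> a)) =
      (p (t - a) * cis (- 2 * pi * (\<xi> \<bullet> (t - a)))) * cnj (q t * cis (- 2 * pi * (\<xi> \<bullet> t)))" for a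
    proof -
      have "cis (2 * pi * (\<xi> \<bullet> a)) = cis (- 2 * pi * (\<xi> \<bullet> (t - a))) * cnj (cis (- 2 * pi * (\<xi> \<bullet> t)))"
        by (simp add: cis_cnj cis_mult inner_diff_right algebra_simps)
      then show ?thesis by (simp add: mult_ac)
    qed
    then show "(\<integral>a. p (t - a) * cnj (q t) * cis (2 * pi * (\<xi> \<bullet> a)) \<partial>lborel)
      = (\<integral>s. p s * cis (- 2 * pi * (\<xi> \<bullet> s)) \<partial>lborel) * cnj (q t * cis (- 2 * pi * (\<xi> \<bullet> t)))"
      by (subst integral_lborel_reflect[of "\<lambda>s. p s * cis (- 2 * pi * (\<xi> \<bullet> s))" t])
        (simp_all only: integral_mult_left_zero, measurable)
  qed
  also have "\<dots> = (\<integral>s. p s * cis (- 2 * pi * (\<xi> \<bullet> s)) \<partial>lborel) * (\<integral>t. cnj (q t * cis (- 2 * pi * (\<xi> \<bullet> t))) \<partial>lborel)"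
    by (rule integral_mult_right_zero)
  finally show ?thesis by (simp only: Bochner_Integration.integral_cnj)
qed

text \<open>For merely integrable \<open>p\<close> and \<open>q\<close> the product of the
  transforms need not be integrable. The Gaussian weight makes Fubini's theorem applicable, and
  integrating out the frequency then turns the weight into \<open>gauss_kernel\<close> at the
  lag.\<close>

lemma gauss_plancherel:
  fixes p q :: "'a::euclidean_space \<Rightarrow> complex"
  assumes p: "integrable lborel p" and q: "integrable lborel q" and e: "e > 0"
  shows "(\<integral>\<xi>. complex_of_real (exp (- (e * norm \<xi>)\<^sup>2 / 2)) *
      ((\<integral>s. p s * cis (- 2 * pi * (\<xi> \<bullet> s)) \<partial>lborel) * cnj (\<integral>t. q t * cis (- 2 * pi * (\<xi> \<bullet> t)) \<partial>lborel)) \<partial>lborel)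
    = (\<integral>z. p (fst z - snd z) * cnj (q (fst z)) * complex_of_real (gauss_kernel e (snd z)) \<partial>lborel)"
proof -
  have [measurable]: "p \<in> borel_measurable borel" "q \<in> borel_measurable borel"
    using borel_measurable_integrable[OF p] borel_measurable_integrable[OF q] by auto
  define F where "F z = p (fst z - snd z) * cnj (q (fst z))" for z
  have F: "integrable lborel F" unfolding F_def[abs_def] by (rule convolution_integrable[OF p q])
  have [measurable]: "F \<in> borel_measurable borel" unfolding F_def[abs_def] by measurable
  define w where "w \<xi> = exp (- (e * norm \<xi>)\<^sup>2 / 2)" for \<xi> :: 'a
  have w: "integrable lborel w" unfolding w_def[abs_def] by (rule gauss_weight_integrable[OF e])
  have [measurable]: "w \<in> borel_measurable borel" unfolding w_def[abs_def] by measurable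
  have w0: "0 \<le> w \<xi>" for \<xi> by (simp add: w_def)
  define H where "H y = complex_of_real (w (fst y)) * (F (snd y) * cis (2 * pi * (fst y \<bullet> snd (snd y))))" for y
  have "integrable lborel H"
  proof (rule integrable_lborel_pairI)
    show "H \<in> borel_measurable borel" unfolding H_def[abs_def] by measurable
    have "(\<integral>\<^sup>+ \<xi>. \<integral>\<^sup>+ z. ennreal (cmod (H (\<xi>, z))) \<partial>lborel \<partial>lborel)
      = (\<integral>\<^sup>+ \<xi>. ennreal (w \<xi>) * (\<integral>\<^sup>+ z. ennreal (cmod (F z)) \<partial>lborel) \<partial>lborel)"
      by (simp add: H_def norm_mult w0 ennreal_mult nn_integral_cmult)
    also have "\<dots> = (\<integral>\<^sup>+ \<xi>. ennreal (norm (w \<xi>)) \<partial>lborel) * (\<integral>\<^sup>+ z. ennreal (cmod (F z)) \<partial>lborel)"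
      by (simp add: nn_integral_multc w0)
    also have "\<dots> < \<infinity>"
      using w F unfolding integrable_iff_bounded by (simp add: ennreal_mult_less_top)
    finally show "(\<integral>\<^sup>+ \<xi>. \<integral>\<^sup>+ z. ennreal (cmod (H (\<xi>, z))) \<partial>lborel \<partial>lborel) < \<infinity>" .
  qed
  note H = integral_lborel_fst[OF this, symmetric] integral_lborel_snd[OF this]
  have "(\<integral>\<xi>. \<integral>z. H (\<xi>, z) \<partial>lborel \<partial>lborel) = (\<integral>z. \<integral>\<xi>. H (\<xi>, z) \<partial>lborel \<partial>lborel)"
    by (simp only: H)
  also have "(\<lambda>\<xi>. \<integral>z. H (\<xi>, z) \<partial>lborel) = (\<lambda>\<xi>. complex_of_real (w \<xi>) *
      ((\<integral>s. p s * cis (- 2 * pi * (\<xi> \<bullet> s)) \<partial>lborel) * cnj (\<integral>t. q t * cis (- 2 * pi * (\<xi> \<bullet> t)) \<partial>lborel)))"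
    unfolding fourier_product[OF p q] H_def F_def fst_conv snd_conv integral_mult_right_zero ..
  also have "(\<lambda>z. \<integral>\<xi>. H (\<xi>, z) \<partial>lborel) = (\<lambda>z. F z * complex_of_real (gauss_kernel e (snd z)))"
  proof
    fix z
    have "(\<integral>\<xi>. H (\<xi>, z) \<partial>lborel) = (\<integral>\<xi>. F z * (complex_of_real (w \<xi>) * cis (2 * pi * (\<xi> \<bullet> snd z))) \<partial>lborel)"
      by (simp add: H_def mult_ac)
    then show "(\<integral>\<xi>. H (\<xi>, z) \<partial>lborel) = F z * complex_of_real (gauss_kernel e (snd z))"
      using gauss_weight_transform[OF e, of "snd z"] by (simp add: w_def)
  qed
  finally show ?thesis by (simp add: w_def F_def)
qed

section \<open>Moyal's identity in regularised form\<close>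

lemma L2_translate_minus:
  assumes "f \<in> L2"
  shows "(\<lambda>t. f (t - a)) \<in> L2" "L2_norm (\<lambda>t. f (t - a)) = L2_norm f"
  using L2_translate[OF assms, of "- a"] by simp_all

text \<open>At fixed \<open>x\<close> the inner products with shifts of \<open>g\<close> form the
  Fourier transform of a product of two functions; for square integrable \<open>f\<close> and
  \<open>g\<close> that product is in general only integrable, hence the weighted version of
  Plancherel's formula.\<close>

lemma L2_inner_tf_shift_fourier:
  "L2_inner f (tf_shift (x, \<xi>) g) = (\<integral>s. f s * cnj (g (s - x)) * cis (- 2 * pi * (\<xi> \<bullet> s)) \<partial>lborel)"
  by (simp add: L2_inner_def tf_shift_cis cis_cnj mult_ac)

text \<open>The weighted Plancherel formula is applied at each fixed \<open>x\<close>. Integrating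
  \<open>x\<close> out then correlates the windows at lag \<open>a\<close>, and integrating
  \<open>t\<close> out correlates the functions at the same lag. The kernel in \<open>a\<close> is
  what replaces evaluation at lag 0.\<close>

lemma moyal_regularised:
  fixes f1 f2 g1 g2 :: "real ^ 'd \<Rightarrow> complex"
  assumes L2: "f1 \<in> L2" "g1 \<in> L2" "f2 \<in> L2" "g2 \<in> L2" and e: "e > 0"
    and \<Phi>: "integrable lborel (\<lambda>w. L2_inner f1 (tf_shift w g1) * cnj (L2_inner f2 (tf_shift w g2)))"
  shows "(\<integral>w. complex_of_real (exp (- (e * norm (snd w))\<^sup>2 / 2)) *
      (L2_inner f1 (tf_shift w g1) * cnj (L2_inner f2 (tf_shift w g2))) \<partial>lborel)
    = (\<integral>a. complex_of_real (gauss_kernel e a) *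
      (L2_inner (\<lambda>t. f1 (t - a)) f2 * L2_inner g2 (\<lambda>t. g1 (t - a))) \<partial>lborel)"
proof -
  have [measurable]: "f1 \<in> borel_measurable borel" "g1 \<in> borel_measurable borel"
    "f2 \<in> borel_measurable borel" "g2 \<in> borel_measurable borel"
    using L2[THEN L2_measurable] by auto
  \<comment> \<open>The coordinates are \<open>y = (x, (t, a))\<close>: position, integration
    variable and lag.\<close>
  define G where "G y = f1 (fst (snd y) - snd (snd y)) * cnj (g1 (fst (snd y) - snd (snd y) - fst y)) *
    cnj (f2 (fst (snd y)) * cnj (g2 (fst (snd y) - fst y))) * complex_of_real (gauss_kernel e (snd (snd y)))" for y
  have gk0: "0 \<le> gauss_kernel e (a :: real ^ 'd)" for a using e by (simp add: gauss_kernel_def)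
  have Gm [measurable]: "G \<in> borel_measurable borel" unfolding G_def[abs_def] by measurable
  let ?M1 = "ennreal (L2_norm g1 * L2_norm g2)" and ?M2 = "ennreal (L2_norm f1 * L2_norm f2)"
  \<comment> \<open>The variable \<open>x\<close> occurs only in the windows, so Cauchy-Schwarz in
    \<open>x\<close> bounds the inner integral by the kernel, \<open>|f1 (t - a) * f2 t|\<close> and
    the two window norms. Cauchy-Schwarz in \<open>t\<close> and integrability of the kernel in
    \<open>a\<close> then give integrability of \<open>G\<close>.\<close>
  have Gx: "(\<integral>\<^sup>+ x. ennreal (cmod (G (x, t, a))) \<partial>lborel)
      \<le> ennreal (gauss_kernel e a) * (?M1 * ennreal (cmod (f1 (t - a)) * cmod (f2 t)))" for t a
  proof -
    have "(\<integral>\<^sup>+ x. ennreal (cmod (g1 (t - a - x)) * cmod (g2 (t - x))) \<partial>lborel)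
      = (\<integral>\<^sup>+ y. ennreal (cmod (g1 (y - a)) * cmod (g2 y)) \<partial>lborel)"
      by (subst nn_integral_lborel_reflect[of "\<lambda>y. ennreal (cmod (g1 (y - a)) * cmod (g2 y))" t])
        (simp_all add: diff_diff_eq add.commute)
    also have "\<dots> \<le> ?M1"
      using L2_nn_integral_mult_le[OF L2_translate_minus(1)[OF L2(2), of a] L2(4)]
      by (simp add: L2_translate_minus L2)
    finally have *: "(\<integral>\<^sup>+ x. ennreal (cmod (g1 (t - a - x)) * cmod (g2 (t - x))) \<partial>lborel) \<le> ?M1" .
    have "(\<integral>\<^sup>+ x. ennreal (cmod (G (x, t, a))) \<partial>lborel)
      = (\<integral>\<^sup>+ x. ennreal (gauss_kernel e a) * ennreal (cmod (f1 (t - a)) * cmod (f2 t)) *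
            ennreal (cmod (g1 (t - a - x)) * cmod (g2 (t - x))) \<partial>lborel)"
      by (simp add: G_def norm_mult gk0 ennreal_mult[symmetric] mult_ac)
    also have "\<dots> = ennreal (gauss_kernel e a) * ennreal (cmod (f1 (t - a)) * cmod (f2 t)) *
            (\<integral>\<^sup>+ x. ennreal (cmod (g1 (t - a - x)) * cmod (g2 (t - x))) \<partial>lborel)"
      by (rule nn_integral_cmult) measurable
    also have "\<dots> \<le> ennreal (gauss_kernel e a) * ennreal (cmod (f1 (t - a)) * cmod (f2 t)) * ?M1"
      by (intro mult_left_mono *) simp
    finally show ?thesis by (simp add: mult_ac)
  qed
  have "integrable lborel G"
  proof (rule integrable_lborel_pairI_snd)
    have "(\<integral>\<^sup>+ z. \<integral>\<^sup>+ x. ennreal (cmod (G (x, z))) \<partial>lborel \<partial>lborel)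
       \<le> (\<integral>\<^sup>+ z. ennreal (gauss_kernel e (snd z)) * (?M1 * ennreal (cmod (f1 (fst z - snd z)) * cmod (f2 (fst z)))) \<partial>lborel)"
      using Gx by (intro nn_integral_mono) (metis prod.collapse)
    also have "\<dots> = (\<integral>\<^sup>+ a. \<integral>\<^sup>+ t. ennreal (gauss_kernel e a) * (?M1 * ennreal (cmod (f1 (t - a)) * cmod (f2 t))) \<partial>lborel \<partial>lborel)"
      by (subst nn_integral_lborel_snd) auto
    also have "\<dots> = (\<integral>\<^sup>+ a. ennreal (gauss_kernel e a) * (?M1 * (\<integral>\<^sup>+ t. ennreal (cmod (f1 (t - a)) * cmod (f2 t)) \<partial>lborel)) \<partial>lborel)"
      by (simp add: nn_integral_cmult)
    also have "\<dots> \<le> (\<integral>\<^sup>+ a. ennreal (gauss_kernel e (a :: real ^ 'd)) * (?M1 * ?M2) \<partial>lborel)"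
    proof (intro nn_integral_mono mult_left_mono)
      fix a
      show "(\<integral>\<^sup>+ t. ennreal (cmod (f1 (t - a)) * cmod (f2 t)) \<partial>lborel) \<le> ?M2"
        using L2_nn_integral_mult_le[OF L2_translate_minus(1)[OF L2(1), of a] L2(3)]
        by (simp add: L2_translate_minus L2)
    qed auto
    also have "\<dots> = (\<integral>\<^sup>+ a. ennreal (norm (gauss_kernel e (a :: real ^ 'd))) \<partial>lborel) * (?M1 * ?M2)"
      by (subst nn_integral_multc) (auto simp: gk0)
    also have "\<dots> < \<infinity>"
      using gauss_kernel_integrable[OF e, where 'a="real ^ 'd"] unfolding integrable_iff_bounded
      by (simp add: ennreal_mult_less_top)
    finally show "(\<integral>\<^sup>+ z. \<integral>\<^sup>+ x. ennreal (cmod (G (x, z))) \<partial>lborel \<partial>lborel) < \<infinity>" .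
  qed (rule Gm)
  note G = integral_lborel_fst[OF this, symmetric] integral_lborel_snd[OF this] integrable_lborel_snd[OF this]
  have "(\<integral>w. complex_of_real (exp (- (e * norm (snd w))\<^sup>2 / 2)) *
      (L2_inner f1 (tf_shift w g1) * cnj (L2_inner f2 (tf_shift w g2))) \<partial>lborel)
     = (\<integral>x. \<integral>\<xi>. complex_of_real (exp (- (e * norm \<xi>)\<^sup>2 / 2)) *
      (L2_inner f1 (tf_shift (x, \<xi>) g1) * cnj (L2_inner f2 (tf_shift (x, \<xi>) g2))) \<partial>lborel \<partial>lborel)"
  proof (subst integral_lborel_fst)
    show "integrable lborel (\<lambda>w. complex_of_real (exp (- (e * norm (snd w))\<^sup>2 / 2)) *
      (L2_inner f1 (tf_shift w g1) * cnj (L2_inner f2 (tf_shift w g2))))"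
    proof (rule Bochner_Integration.integrable_bound[OF \<Phi>])
      show "AE w in lborel. norm (complex_of_real (exp (- (e * norm (snd w))\<^sup>2 / 2)) *
          (L2_inner f1 (tf_shift w g1) * cnj (L2_inner f2 (tf_shift w g2))))
        \<le> norm (L2_inner f1 (tf_shift w g1) * cnj (L2_inner f2 (tf_shift w g2)))"
        by (intro AE_I2) (simp add: norm_mult mult_left_le_one_le)
    qed (use borel_measurable_integrable[OF \<Phi>] in measurable)
  qed simp
  also have "\<dots> = (\<integral>x. \<integral>z. G (x, z) \<partial>lborel \<partial>lborel)"
  proof (intro Bochner_Integration.integral_cong refl)
    fix x
    have tr: "(\<lambda>t. f (t - x)) \<in> L2" if "f \<in> L2" for f :: "real ^ 'd \<Rightarrow> complex"
      by (rule L2_translate_minus[OF that])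
    show "(\<integral>\<xi>. complex_of_real (exp (- (e * norm \<xi>)\<^sup>2 / 2)) *
      (L2_inner f1 (tf_shift (x, \<xi>) g1) * cnj (L2_inner f2 (tf_shift (x, \<xi>) g2))) \<partial>lborel)
      = (\<integral>z. G (x, z) \<partial>lborel)"
      unfolding L2_inner_tf_shift_fourier
      by (subst gauss_plancherel[OF L2_integrable_mult[OF L2(1) tr[OF L2(2)]]
            L2_integrable_mult[OF L2(3) tr[OF L2(4)]] e]) (simp add: G_def)
  qed
  also have "\<dots> = (\<integral>z. \<integral>x. G (x, z) \<partial>lborel \<partial>lborel)" by (simp only: G)
  also have "\<dots> = (\<integral>a. \<integral>t. \<integral>x. G (x, (t, a)) \<partial>lborel \<partial>lborel \<partial>lborel)"
    by (rule integral_lborel_snd[OF G(3)])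
  also have "\<dots> = (\<integral>a. complex_of_real (gauss_kernel e a) *
      (L2_inner (\<lambda>t. f1 (t - a)) f2 * L2_inner g2 (\<lambda>t. g1 (t - a))) \<partial>lborel)"
  proof (intro Bochner_Integration.integral_cong refl)
    fix a
    have "(\<integral>x. G (x, (t, a)) \<partial>lborel) = complex_of_real (gauss_kernel e a) * L2_inner g2 (\<lambda>t. g1 (t - a)) *
         (f1 (t - a) * cnj (f2 t))" for t
    proof -
      have "(\<integral>x. G (x, (t, a)) \<partial>lborel) = (\<integral>x. complex_of_real (gauss_kernel e a) *
         (f1 (t - a) * cnj (f2 t)) * (g2 (t - x) * cnj (g1 (t - x - a))) \<partial>lborel)"
        by (simp add: G_def mult_ac diff_diff_eq add.commute)
      also have "\<dots> = complex_of_real (gauss_kernel e a) * (f1 (t - a) * cnj (f2 t)) *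
         (\<integral>x. g2 (t - x) * cnj (g1 (t - x - a)) \<partial>lborel)"
        by (rule integral_mult_right_zero)
      also have "(\<integral>x. g2 (t - x) * cnj (g1 (t - x - a)) \<partial>lborel) = L2_inner g2 (\<lambda>t. g1 (t - a))"
        unfolding L2_inner_def
        by (subst integral_lborel_reflect[of "\<lambda>y. g2 y * cnj (g1 (y - a))" t]) auto
      finally show ?thesis by (simp add: mult_ac)
    qed
    then have "(\<integral>t. \<integral>x. G (x, (t, a)) \<partial>lborel \<partial>lborel)
      = complex_of_real (gauss_kernel e a) * L2_inner g2 (\<lambda>t. g1 (t - a)) * L2_inner (\<lambda>t. f1 (t - a)) f2"
      by (simp only: L2_inner_def[of "\<lambda>t. f1 (t - a)"] integral_mult_right_zero)
    then show "(\<integral>t. \<integral>x. G (x, (t, a)) \<partial>lborel \<partial>lborel) = complex_of_real (gauss_kernel e a) *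
      (L2_inner (\<lambda>t. f1 (t - a)) f2 * L2_inner g2 (\<lambda>t. g1 (t - a)))"
      by (simp add: mult_ac)
  qed
  finally show ?thesis .
qed

lemma L2_inner_diff_left:
  assumes "f \<in> L2" "f' \<in> L2" "h \<in> L2"
  shows "L2_inner f h - L2_inner f' h = L2_inner (\<lambda>t. f t - f' t) h"
  using L2_integrable_mult[OF assms(1,3)] L2_integrable_mult[OF assms(2,3)]
  by (simp add: L2_inner_def left_diff_distrib)

lemma L2_inner_translate_tendsto:
  assumes f: "f \<in> L2" and h: "h \<in> L2" and X: "X \<longlonglongrightarrow> 0"
  shows "(\<lambda>n. L2_inner (\<lambda>t. f (t - X n)) h) \<longlonglongrightarrow> L2_inner f h"
proof (rule LIM_zero_cancel, rule Lim_null_comparison)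
  have tr: "(\<lambda>t. f (t - X n)) \<in> L2" for n by (rule L2_translate_minus[OF f])
  have X': "(\<lambda>n. - X n) \<longlonglongrightarrow> 0" using tendsto_minus[OF X] by simp
  show "\<forall>\<^sub>F n in sequentially. norm (L2_inner (\<lambda>t. f (t - X n)) h - L2_inner f h)
      \<le> L2_norm (\<lambda>t. f (t - X n) - f t) * L2_norm h"
    unfolding L2_inner_diff_left[OF tr f h]
    by (intro always_eventually allI norm_L2_inner_le L2_diff tr f h)
  show "(\<lambda>n. L2_norm (\<lambda>t. f (t - X n) - f t) * L2_norm h) \<longlonglongrightarrow> 0"
    using tendsto_mult_right[OF L2_translation_tendsto[OF f X'], of "L2_norm h"] by simp
qed

text \<open>The right side bounds the regularised integral for every width, since the weight is at
  most 1. Only the other side is passed to the limit, where the kernel concentrates at lag 0 and the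
  correlations are continuous.\<close>

theorem moyal_inequality:
  fixes f1 f2 g1 g2 :: "real ^ 'd \<Rightarrow> complex"
  assumes L2: "f1 \<in> L2" "g1 \<in> L2" "f2 \<in> L2" "g2 \<in> L2"
    and \<Phi>: "integrable lborel (\<lambda>w. L2_inner f1 (tf_shift w g1) * cnj (L2_inner f2 (tf_shift w g2)))"
  shows "cmod (L2_inner f1 f2 * L2_inner g2 g1) \<le>
    (\<integral>w. cmod (L2_inner f1 (tf_shift w g1)) * cmod (L2_inner f2 (tf_shift w g2)) \<partial>lborel)"
proof -
  have [measurable]: "f1 \<in> borel_measurable borel" "g1 \<in> borel_measurable borel"
    "f2 \<in> borel_measurable borel" "g2 \<in> borel_measurable borel"
    using L2[THEN L2_measurable] by auto
  define A where "A a = L2_inner (\<lambda>t. f1 (t - a)) f2 * L2_inner g2 (\<lambda>t. g1 (t - a))" for a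
  let ?D = "DIM(real ^ 'd)"
  \<comment> \<open>This is \<open>gauss_kernel 1\<close>, the fixed profile of which all the
    kernels are dilates.\<close>
  define k where "k r = sqrt (2 * pi) ^ ?D * exp (- (2 * pi * norm r)\<^sup>2 / 2)" for r :: "real ^ 'd"
  have [measurable]: "A \<in> borel_measurable borel" unfolding A_def[abs_def] L2_inner_def by measurable
  have [measurable]: "k \<in> borel_measurable borel" unfolding k_def[abs_def] by measurable
  have k0: "0 \<le> k r" for r by (simp add: k_def)
  have k: "integrable lborel k" "integral\<^sup>L lborel k = 1"
  proof -
    have eq: "k = (\<lambda>r. sqrt (2 * pi) ^ ?D * exp (- (2 * pi * norm r)\<^sup>2 / 2))"
      by (simp add: k_def fun_eq_iff)
    show "integrable lborel k"
      unfolding eq by (rule integrable_mult_right) (rule gauss_weight_integrable; simp)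
    have "integral\<^sup>L lborel k = sqrt (2 * pi) ^ ?D * (sqrt (2 * pi) / (2 * pi)) ^ ?D"
      unfolding eq integral_mult_right_zero by (subst gauss_weight_integral) simp_all
    also have "\<dots> = (sqrt (2 * pi) * (sqrt (2 * pi) / (2 * pi))) ^ ?D"
      by (rule power_mult_distrib[symmetric])
    also have "sqrt (2 * pi) * (sqrt (2 * pi) / (2 * pi)) = 1"
      unfolding times_divide_eq_right by (subst real_sqrt_mult_self) simp
    finally show "integral\<^sup>L lborel k = 1" by simp
  qed
  define E where "E n = inverse (real (Suc n))" for n
  have E: "E n > 0" for n by (simp add: E_def)
  define M where "M = (L2_norm f1 * L2_norm f2) * (L2_norm g2 * L2_norm g1)"
  have AM: "cmod (A a) \<le> M" for a
    unfolding A_def M_def norm_mult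
    using norm_L2_inner_le[OF L2_translate_minus(1)[OF L2(1), of a] L2(3)]
      norm_L2_inner_le[OF L2(4) L2_translate_minus(1)[OF L2(2), of a]]
    by (intro mult_mono) (auto simp: L2_translate_minus L2)
  have A0: "(\<lambda>n. A (E n *\<^sub>R r)) \<longlonglongrightarrow> A 0" for r
  proof -
    have "(\<lambda>n. E n *\<^sub>R r) \<longlonglongrightarrow> 0 *\<^sub>R r"
      unfolding E_def by (intro tendsto_scaleR LIMSEQ_inverse_real_of_nat tendsto_const)
    then have X: "(\<lambda>n. E n *\<^sub>R r) \<longlonglongrightarrow> 0" by simp
    have "(\<lambda>n. cnj (L2_inner (\<lambda>t. g1 (t - E n *\<^sub>R r)) g2)) \<longlonglongrightarrow> cnj (L2_inner g1 g2)"
      by (intro tendsto_cnj L2_inner_translate_tendsto L2 X)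
    then have "(\<lambda>n. L2_inner g2 (\<lambda>t. g1 (t - E n *\<^sub>R r))) \<longlonglongrightarrow> L2_inner g2 g1"
      by (simp only: L2_inner_commute[of g2, symmetric])
    with L2_inner_translate_tendsto[OF L2(1,3) X] show ?thesis
      unfolding A_def by (simp add: tendsto_mult)
  qed
  let ?B = "\<integral>w. cmod (L2_inner f1 (tf_shift w g1)) * cmod (L2_inner f2 (tf_shift w g2)) \<partial>lborel"
  have bound: "cmod (\<integral>r. complex_of_real (k r) * A (E n *\<^sub>R r) \<partial>lborel) \<le> ?B" for n
  proof -
    let ?K = "gauss_kernel (E n)"
    \<comment> \<open>Rescaling \<open>a\<close> by \<open>E n\<close> moves the width from the
      kernel into the argument of \<open>A\<close>, so that the limit is taken under a fixed
      Gaussian of mass 1, where \<open>k r * M\<close> dominates.\<close>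
    have "(\<integral>a. complex_of_real (?K a) * A a \<partial>lborel)
      = \<bar>E n\<bar> ^ ?D *\<^sub>R (\<integral>r. complex_of_real (?K (E n *\<^sub>R r)) * A (E n *\<^sub>R r) \<partial>lborel)"
      using E[of n] by (subst integral_lborel_affine[of "E n" _ 0]) auto
    also have "\<dots> = (\<integral>r. \<bar>E n\<bar> ^ ?D *\<^sub>R (complex_of_real (?K (E n *\<^sub>R r)) * A (E n *\<^sub>R r)) \<partial>lborel)"
      by simp
    also have "(\<lambda>r. \<bar>E n\<bar> ^ ?D *\<^sub>R (complex_of_real (?K (E n *\<^sub>R r)) * A (E n *\<^sub>R r)))
      = (\<lambda>r. complex_of_real (k r) * A (E n *\<^sub>R r))"
    proof
      fix r
      have "\<bar>E n\<bar> ^ ?D * ?K (E n *\<^sub>R r) = k r"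
        using E[of n] by (simp add: gauss_kernel_def k_def power_divide power_mult_distrib)
      then show "\<bar>E n\<bar> ^ ?D *\<^sub>R (complex_of_real (?K (E n *\<^sub>R r)) * A (E n *\<^sub>R r)) = complex_of_real (k r) * A (E n *\<^sub>R r)"
        by (simp only: scaleR_conv_of_real mult.assoc[symmetric] of_real_mult[symmetric])
    qed
    finally have "(\<integral>r. complex_of_real (k r) * A (E n *\<^sub>R r) \<partial>lborel)
      = (\<integral>w. complex_of_real (exp (- (E n * norm (snd w))\<^sup>2 / 2)) *
      (L2_inner f1 (tf_shift w g1) * cnj (L2_inner f2 (tf_shift w g2))) \<partial>lborel)"
      unfolding A_def using moyal_regularised[OF L2 E \<Phi>] by simp
    also have "cmod \<dots> \<le> (\<integral>w. norm (complex_of_real (exp (- (E n * norm (snd w))\<^sup>2 / 2)) *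
      (L2_inner f1 (tf_shift w g1) * cnj (L2_inner f2 (tf_shift w g2)))) \<partial>lborel)"
      by (rule integral_norm_bound)
    also have "\<dots> \<le> (\<integral>w. norm (L2_inner f1 (tf_shift w g1) * cnj (L2_inner f2 (tf_shift w g2))) \<partial>lborel)"
      by (rule integral_mono_AE'[OF integrable_norm[OF \<Phi>]]) (auto simp: norm_mult mult_left_le_one_le)
    finally show ?thesis by (simp add: norm_mult)
  qed
  have "(\<lambda>n. \<integral>r. complex_of_real (k r) * A (E n *\<^sub>R r) \<partial>lborel) \<longlonglongrightarrow> (\<integral>r. complex_of_real (k r) * A 0 \<partial>lborel)"
  proof (rule integral_dominated_convergence[where w="\<lambda>r. k r * M"])
    show "AE r in lborel. (\<lambda>n. complex_of_real (k r) * A (E n *\<^sub>R r)) \<longlonglongrightarrow> complex_of_real (k r) * A 0"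
      by (intro AE_I2 tendsto_mult_left A0)
    show "AE r in lborel. norm (complex_of_real (k r) * A (E n *\<^sub>R r)) \<le> k r * M" for n
      by (intro AE_I2) (auto simp: norm_mult k0 intro!: mult_left_mono AM)
  qed (use k in auto)
  then have "(\<lambda>n. cmod (\<integral>r. complex_of_real (k r) * A (E n *\<^sub>R r) \<partial>lborel)) \<longlonglongrightarrow> cmod (A 0)"
    using k by (intro tendsto_norm) simp
  from LIMSEQ_le_const2[OF this] bound show ?thesis by (auto simp: A_def)
qed

section \<open>Sums over separated sets\<close>

definition separated :: "real \<Rightarrow> 'a::metric_space set \<Rightarrow> bool" where
  "separated \<delta> Z \<longleftrightarrow> (\<forall>z\<in>Z. \<forall>z'\<in>Z. z \<noteq> z' \<longrightarrow> \<delta> \<le> dist z z')"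

text \<open>Balls of radius at most half the separation are disjoint, so at most one term is
  nonzero; a point of that ball is no closer to the origin than its centre by more than
  \<open>\<rho>\<close>.\<close>

lemma sum_indicator_ball_le:
  fixes Z :: "'a::euclidean_space set"
  assumes Z: "finite Z" "separated \<delta> Z" and \<rho>: "\<rho> \<le> \<delta> / 2" and r: "\<And>z. z \<in> Z \<Longrightarrow> r \<le> norm z"
  shows "(\<Sum>z\<in>Z. indicator (ball z \<rho>) y :: ennreal) \<le> indicator {y. r - \<rho> \<le> norm y} y"
proof (cases "\<exists>z\<in>Z. y \<in> ball z \<rho>")
  case True
  then obtain z where z: "z \<in> Z" "y \<in> ball z \<rho>" by blast
  have "y \<notin> ball z' \<rho>" if "z' \<in> Z" "z' \<noteq> z" for z'
  proof
    assume "y \<in> ball z' \<rho>"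
    then have "dist z' z < \<delta>"
      using z(2) \<rho> dist_triangle2[of z' z y] by (simp add: dist_commute)
    then show False using Z(2) that z(1) unfolding separated_def by fastforce
  qed
  then have "(\<Sum>z'\<in>Z. indicator (ball z' \<rho>) y :: ennreal) = (\<Sum>z'\<in>Z. if z' = z then 1 else 0)"
    using z(2) by (intro sum.cong) (auto simp: indicator_def)
  also have "\<dots> = 1" using Z(1) z(1) by simp
  finally have *: "(\<Sum>z'\<in>Z. indicator (ball z' \<rho>) y :: ennreal) = 1" .
  have "norm z \<le> norm y + norm (z - y)" using norm_triangle_ineq[of y "z - y"] by simp
  then have "r - \<rho> \<le> norm y" using z r[of z] by (simp add: dist_norm)
  then show ?thesis unfolding * by simp
next
  case False
  then have "(\<Sum>z\<in>Z. indicator (ball z \<rho>) y :: ennreal) = 0" by (intro sum.neutral) auto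
  then show ?thesis by simp
qed

text \<open>For nonnegative \<open>v\<close>, the mass of the product density
  \<open>v w * v y\<close> on pairs at distance at least \<open>s\<close>. For
  \<open>s \<le> 0\<close> the restriction is void and the value is the square of the integral.
  Extended nonnegative integrals keep the later interchanges free of integrability
  conditions.\<close>

definition self_overlap :: "('a::euclidean_space \<Rightarrow> real) \<Rightarrow> real \<Rightarrow> ennreal" where
  "self_overlap v s = (\<integral>\<^sup>+ w. \<integral>\<^sup>+ y. ennreal (v w) * (ennreal (v y) * indicator {y. s \<le> norm y} (y - w)) \<partial>lborel \<partial>lborel)"

lemma self_overlap_finite:
  assumes "integrable lborel v"
  shows "self_overlap v s \<le> (\<integral>\<^sup>+ w. ennreal (v w) \<partial>lborel) * (\<integral>\<^sup>+ y. ennreal (v y) \<partial>lborel)"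
    and "(\<integral>\<^sup>+ w. ennreal (v w) \<partial>lborel) < \<infinity>"
proof -
  have [measurable]: "v \<in> borel_measurable borel" using borel_measurable_integrable[OF assms] by simp
  have "self_overlap v s \<le> (\<integral>\<^sup>+ w. \<integral>\<^sup>+ y. ennreal (v w) * (ennreal (v y) * 1) \<partial>lborel \<partial>lborel)"
    unfolding self_overlap_def by (intro nn_integral_mono mult_left_mono) (auto split: split_indicator)
  also have "\<dots> = (\<integral>\<^sup>+ w. ennreal (v w) \<partial>lborel) * (\<integral>\<^sup>+ y. ennreal (v y) \<partial>lborel)"
    by (simp add: nn_integral_cmult nn_integral_multc)
  finally show "self_overlap v s \<le> (\<integral>\<^sup>+ w. ennreal (v w) \<partial>lborel) * (\<integral>\<^sup>+ y. ennreal (v y) \<partial>lborel)" .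
  have "(\<integral>\<^sup>+ w. ennreal (v w) \<partial>lborel) \<le> (\<integral>\<^sup>+ w. ennreal (norm (v w)) \<partial>lborel)"
    by (intro nn_integral_mono ennreal_leI) auto
  also have "\<dots> < \<infinity>" using assms unfolding integrable_iff_bounded by blast
  finally show "(\<integral>\<^sup>+ w. ennreal (v w) \<partial>lborel) < \<infinity>" .
qed

text \<open>Any given pair has finite distance, so the integrand vanishes eventually at each point,
  and the unrestricted product density dominates.\<close>

lemma self_overlap_tendsto:
  assumes "integrable lborel v"
  shows "(\<lambda>n. self_overlap v (real n)) \<longlonglongrightarrow> 0"
proof -
  have [measurable]: "v \<in> borel_measurable borel" using borel_measurable_integrable[OF assms] by simp
  let ?F = "\<lambda>s z. ennreal (v (fst z)) * (ennreal (v (snd z)) * indicator {y. s \<le> norm y} (snd z - fst z))"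
  have eq: "self_overlap v s = (\<integral>\<^sup>+ z. ?F s z \<partial>lborel)" for s
    by (subst nn_integral_lborel_fst) (auto simp: self_overlap_def)
  have "(\<lambda>n. \<integral>\<^sup>+ z. ?F (real n) z \<partial>lborel) \<longlonglongrightarrow> (\<integral>\<^sup>+ z. 0 \<partial>(lborel :: ('a \<times> 'a) measure))"
  proof (rule nn_integral_dominated_convergence[where w="\<lambda>z. ennreal (v (fst z)) * ennreal (v (snd z))"])
    show "AE z in lborel. ?F (real n) z \<le> ennreal (v (fst z)) * ennreal (v (snd z))" for n
      by (intro AE_I2 mult_left_mono) (auto split: split_indicator)
    have "(\<integral>\<^sup>+ z. ennreal (v (fst z)) * ennreal (v (snd z)) \<partial>lborel)
        = (\<integral>\<^sup>+ w. ennreal (v w) \<partial>lborel) * (\<integral>\<^sup>+ y. ennreal (v y) \<partial>lborel)"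
      by (subst nn_integral_lborel_fst) (auto simp: nn_integral_cmult nn_integral_multc)
    then show "(\<integral>\<^sup>+ z. ennreal (v (fst z)) * ennreal (v (snd z)) \<partial>lborel) < \<infinity>"
      using self_overlap_finite(2)[OF assms] by (simp add: ennreal_mult_less_top)
    show "AE z in lborel. (\<lambda>n. ?F (real n) z) \<longlonglongrightarrow> 0"
    proof (intro AE_I2 tendsto_eventually)
      fix z :: "'a \<times> 'a"
      obtain N where "norm (snd z - fst z) < real N" using reals_Archimedean2 by blast
      then show "\<forall>\<^sub>F n in sequentially. ?F (real n) z = 0"
        by (intro eventually_sequentiallyI[of N]) (auto simp: indicator_def)
    qed
  qed auto
  then show ?thesis unfolding eq by simp
qed

text \<open>
  Averaging the hypothesis over \<open>u\<close> in a small ball replaces the point value \<open>v z\<close> by an integral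
  of \<open>v\<close> over a ball centred at \<open>z + w\<close>; these balls are disjoint for separated \<open>z\<close>.
\<close>

lemma sum_le_self_overlap:
  fixes v :: "'a::euclidean_space \<Rightarrow> real"
  assumes v: "integrable lborel v" and nn: "\<And>z. 0 \<le> v z"
    and conv: "\<And>z u. ennreal (v z * v u) \<le> (\<integral>\<^sup>+ w. ennreal (v (w + u)) * ennreal (v (w - z)) \<partial>lborel)"
    and c: "\<And>u. norm u < \<rho> \<Longrightarrow> c \<le> v u" "c > 0" "\<rho> > 0" and \<delta>: "\<rho> \<le> \<delta> / 2"
    and Z: "finite Z" "separated \<delta> Z" "\<And>z. z \<in> Z \<Longrightarrow> r \<le> norm z"
  shows "ennreal (c * measure lborel (ball (0::'a) \<rho>) * (\<Sum>z\<in>Z. v z)) \<le> self_overlap v (r - \<rho>)"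
proof -
  have [measurable]: "v \<in> borel_measurable borel" using borel_measurable_integrable[OF v] by simp
  have [measurable]: "ball (x::'a) \<rho> \<in> sets borel" for x by simp
  let ?I = "\<lambda>(x::'a) y. indicator (ball x \<rho>) y :: ennreal"
  have one: "ennreal (c * measure lborel (ball (0::'a) \<rho>) * v z)
      \<le> (\<integral>\<^sup>+ w. ennreal (v w) * (\<integral>\<^sup>+ y. ennreal (v y) * ?I z (y - w) \<partial>lborel) \<partial>lborel)" for z
  proof -
    have "ennreal (c * measure lborel (ball (0::'a) \<rho>) * v z)
        = ennreal (v z * c) * emeasure lborel (ball (0::'a) \<rho>)"
      using c nn emeasure_bounded_finite[of "ball (0::'a) \<rho>"]
      by (subst emeasure_eq_ennreal_measure) (auto simp: ennreal_mult[symmetric] mult_ac)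
    also have "\<dots> = (\<integral>\<^sup>+ u. ennreal (v z * c) * ?I 0 u \<partial>lborel)"
      by (simp add: nn_integral_cmult_indicator)
    also have "\<dots> \<le> (\<integral>\<^sup>+ u. ?I 0 u * (\<integral>\<^sup>+ w. ennreal (v (w + u)) * ennreal (v (w - z)) \<partial>lborel) \<partial>lborel)"
    proof (intro nn_integral_mono)
      fix u
      show "ennreal (v z * c) * ?I 0 u \<le> ?I 0 u * (\<integral>\<^sup>+ w. ennreal (v (w + u)) * ennreal (v (w - z)) \<partial>lborel)"
      proof (cases "u \<in> ball 0 \<rho>")
        case True
        then have "ennreal (v z * c) \<le> ennreal (v z * v u)"
          using c nn by (intro ennreal_leI mult_left_mono) auto
        also note conv[of z u]
        finally show ?thesis using True by simp
      qed simp
    qed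
    \<comment> \<open>Translating \<open>w\<close> by \<open>z\<close> frees the second factor from
      \<open>z\<close>, so that it can serve as a common weight for all \<open>z\<close>.\<close>
    also have "\<dots> = (\<integral>\<^sup>+ u. \<integral>\<^sup>+ w. ?I 0 u * (ennreal (v (z + w + u)) * ennreal (v w)) \<partial>lborel \<partial>lborel)"
      by (subst nn_integral_lborel_translate[of "\<lambda>w. ennreal (v (w + _)) * ennreal (v (w - z))" z])
        (auto simp: nn_integral_cmult)
    also have "\<dots> = (\<integral>\<^sup>+ w. \<integral>\<^sup>+ u. ?I 0 u * (ennreal (v (z + w + u)) * ennreal (v w)) \<partial>lborel \<partial>lborel)"
    proof (rule lborel_pair.Fubini')
      have "(\<lambda>p. ?I 0 (snd p) * (ennreal (v (z + fst p + snd p)) * ennreal (v (fst p)))) \<in> borel_measurable borel"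
        by measurable
      then show "(\<lambda>(w, u). ?I 0 u * (ennreal (v (z + w + u)) * ennreal (v w)))
          \<in> borel_measurable (lborel \<Otimes>\<^sub>M lborel)"
        by (simp add: lborel_prod split_beta')
    qed
    also have "\<dots> = (\<integral>\<^sup>+ w. ennreal (v w) * (\<integral>\<^sup>+ u. ?I z (z + u) * ennreal (v (z + w + u)) \<partial>lborel) \<partial>lborel)"
      by (subst nn_integral_cmult[symmetric])
        (auto intro!: nn_integral_cong simp: mult_ac dist_norm split: split_indicator)
    \<comment> \<open>Substitution \<open>y = z + w + u\<close>: the average over \<open>u\<close>
      near 0 becomes an integral of \<open>v\<close> over the ball of radius \<open>\<rho>\<close>
      centred at \<open>z + w\<close>.\<close>
    also have "\<dots> = (\<integral>\<^sup>+ w. ennreal (v w) * (\<integral>\<^sup>+ y. ennreal (v y) * ?I z (y - w) \<partial>lborel) \<partial>lborel)"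
    proof (intro nn_integral_cong)
      fix w
      show "ennreal (v w) * (\<integral>\<^sup>+ u. ?I z (z + u) * ennreal (v (z + w + u)) \<partial>lborel)
          = ennreal (v w) * (\<integral>\<^sup>+ y. ennreal (v y) * ?I z (y - w) \<partial>lborel)"
        by (subst nn_integral_lborel_translate[of "\<lambda>y. ennreal (v y) * ?I z (y - w)" "z + w"])
          (auto simp: algebra_simps)
    qed
    finally show ?thesis .
  qed
  have "ennreal (c * measure lborel (ball (0::'a) \<rho>) * (\<Sum>z\<in>Z. v z))
     = (\<Sum>z\<in>Z. ennreal (c * measure lborel (ball (0::'a) \<rho>) * v z))"
    using c nn by (simp add: sum_distrib_left sum_ennreal)
  also have "\<dots> \<le> (\<Sum>z\<in>Z. \<integral>\<^sup>+ w. ennreal (v w) * (\<integral>\<^sup>+ y. ennreal (v y) * ?I z (y - w) \<partial>lborel) \<partial>lborel)"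
    by (intro sum_mono one)
  also have "\<dots> = (\<integral>\<^sup>+ w. \<integral>\<^sup>+ y. ennreal (v w) * (ennreal (v y) * (\<Sum>z\<in>Z. ?I z (y - w))) \<partial>lborel \<partial>lborel)"
  proof -
    have [measurable]: "(\<lambda>w. \<integral>\<^sup>+ y. ennreal (v y) * ?I z (y - w) \<partial>lborel) \<in> borel_measurable lborel" for z
      by measurable
    have "(\<integral>\<^sup>+ y. ennreal (v w) * (ennreal (v y) * (\<Sum>z\<in>Z. ?I z (y - w))) \<partial>lborel)
      = (\<Sum>z\<in>Z. ennreal (v w) * (\<integral>\<^sup>+ y. ennreal (v y) * ?I z (y - w) \<partial>lborel))" for w
      unfolding sum_distrib_left by (subst nn_integral_sum) (auto simp: nn_integral_cmult)
    then show ?thesis by (simp add: nn_integral_sum)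
  qed
  \<comment> \<open>Separation enters only here: the indicators add up to at most 1, and the lower
    bound \<open>r\<close> on the points becomes a lower bound on
    \<open>norm (y - w)\<close>.\<close>
  also have "\<dots> \<le> self_overlap v (r - \<rho>)"
    unfolding self_overlap_def
    by (intro nn_integral_mono mult_left_mono sum_indicator_ball_le[OF Z(1,2) \<delta> Z(3)]) auto
  finally show ?thesis .
qed

text \<open>A total bound comes from the finite mass of \<open>v\<close>, and a small tail from the
  decay of \<open>self_overlap\<close>. Both depend on the set of points only through its
  separation, which gives the uniformity needed for the deformed sets.\<close>

lemma self_convolution_tail:
  fixes v :: "'a::euclidean_space \<Rightarrow> real"
  assumes v: "integrable lborel v" and nn: "\<And>z. 0 \<le> v z"
    and conv: "\<And>z u. ennreal (v z * v u) \<le> (\<integral>\<^sup>+ w. ennreal (v (w + u)) * ennreal (v (w - z)) \<partial>lborel)"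
    and c: "\<And>u. norm u < \<rho> \<Longrightarrow> c \<le> v u" "c > 0" "\<rho> > 0" and \<delta>: "\<delta> > 0"
  shows "\<exists>B>0. \<forall>Z. finite Z \<longrightarrow> separated \<delta> Z \<longrightarrow> (\<Sum>z\<in>Z. v z) \<le> B"
    and "\<eta> > 0 \<Longrightarrow> \<exists>r>0. \<forall>Z. finite Z \<longrightarrow> separated \<delta> Z \<longrightarrow> (\<forall>z\<in>Z. r \<le> norm z) \<longrightarrow> (\<Sum>z\<in>Z. v z) \<le> \<eta>"
proof -
  \<comment> \<open>Shrinking the ball keeps the lower bound \<open>c\<close> on \<open>v\<close>
    and makes the balls disjoint at separation \<open>\<delta>\<close>.\<close>
  define \<rho>' where "\<rho>' = min \<rho> (\<delta> / 2)"
  have \<rho>': "\<rho>' > 0" "\<rho>' \<le> \<rho>" "\<rho>' \<le> \<delta> / 2" using c \<delta> by (auto simp: \<rho>'_def)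
  define b where "b = c * measure lborel (ball (0::'a) \<rho>')"
  have b: "b > 0" using \<rho>'(1) c(2) by (simp add: b_def content_ball)
  have main: "ennreal (b * (\<Sum>z\<in>Z. v z)) \<le> self_overlap v (r - \<rho>')"
    if "finite Z" "separated \<delta> Z" "\<And>z. z \<in> Z \<Longrightarrow> r \<le> norm z" for Z r
    unfolding b_def by (rule sum_le_self_overlap[OF v nn conv _ c(2) \<rho>'(1) \<rho>'(3) that]) (use c(1) \<rho>'(2) in auto)
  let ?T = "(\<integral>\<^sup>+ w. ennreal (v w) \<partial>lborel) * (\<integral>\<^sup>+ y. ennreal (v y) \<partial>lborel)"
  have T: "?T < \<infinity>" using self_overlap_finite(2)[OF v] by (simp add: ennreal_mult_less_top)
  show "\<exists>B>0. \<forall>Z. finite Z \<longrightarrow> separated \<delta> Z \<longrightarrow> (\<Sum>z\<in>Z. v z) \<le> B"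
  proof (intro exI[of _ "(enn2real ?T + 1) / b"] conjI allI impI)
    show "(enn2real ?T + 1) / b > 0" using b by (intro divide_pos_pos) (auto intro: add_nonneg_pos)
    fix Z :: "'a set" assume Z: "finite Z" "separated \<delta> Z"
    \<comment> \<open>The radius 0 imposes no condition on \<open>Z\<close>.\<close>
    have "ennreal (b * (\<Sum>z\<in>Z. v z)) \<le> ?T"
      using main[OF Z, of 0] self_overlap_finite(1)[OF v, of "0 - \<rho>'"] by (auto intro: order_trans)
    also have "\<dots> = ennreal (enn2real ?T)" using T by simp
    finally have "b * (\<Sum>z\<in>Z. v z) \<le> enn2real ?T" by (simp add: ennreal_le_iff)
    then show "(\<Sum>z\<in>Z. v z) \<le> (enn2real ?T + 1) / b" using b by (simp add: field_simps)
  qed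
  assume \<eta>: "\<eta> > 0"
  have "\<forall>\<^sub>F n in sequentially. self_overlap v (real n) < ennreal (b * \<eta>)"
    using b \<eta> by (intro order_tendstoD(2)[OF self_overlap_tendsto[OF v]]) simp
  then obtain n where n: "self_overlap v (real n) < ennreal (b * \<eta>)"
    by (auto simp: eventually_sequentially)
  show "\<exists>r>0. \<forall>Z. finite Z \<longrightarrow> separated \<delta> Z \<longrightarrow> (\<forall>z\<in>Z. r \<le> norm z) \<longrightarrow> (\<Sum>z\<in>Z. v z) \<le> \<eta>"
  \<comment> \<open>The summand \<open>\<rho>'\<close> compensates for the loss of one ball radius
    in \<open>main\<close>.\<close>
  proof (intro exI[of _ "real n + \<rho>'"] conjI allI impI)
    show "real n + \<rho>' > 0" using \<rho>' by simp
    fix Z :: "'a set" assume Z: "finite Z" "separated \<delta> Z" "\<forall>z\<in>Z. real n + \<rho>' \<le> norm z"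
    have "ennreal (b * (\<Sum>z\<in>Z. v z)) \<le> self_overlap v (real n)"
      using main[OF Z(1,2), of "real n + \<rho>'"] Z(3) by simp
    with n have "ennreal (b * (\<Sum>z\<in>Z. v z)) \<le> ennreal (b * \<eta>)" by simp
    then have "b * (\<Sum>z\<in>Z. v z) \<le> b * \<eta>" using b \<eta> by (subst (asm) ennreal_le_iff) auto
    then show "(\<Sum>z\<in>Z. v z) \<le> \<eta>" using b by simp
  qed
qed

section \<open>The ambiguity function of a window in \<open>M1\<close>\<close>

text \<open>Moyal's inequality with \<open>f1 = g2 = g\<close>, \<open>f2 = tf_shift z g\<close> and
  \<open>g1 = tf_shift u g\<close>. The left side splits into the two values of \<open>v\<close>,
  and on the right the phases of composed shifts disappear under the modulus.\<close>

lemma ambiguity_convolution: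
  fixes g :: "real ^ 'd \<Rightarrow> complex"
  assumes "g \<in> M1"
  defines "v \<equiv> \<lambda>z. cmod (L2_inner g (tf_shift z g))"
  shows "ennreal (v z * v u) \<le> (\<integral>\<^sup>+ w. ennreal (v (w + u)) * ennreal (v (w - z)) \<partial>lborel)"
proof -
  have g: "g \<in> L2" and v: "integrable lborel v" using assms by (auto simp: M1_def)
  have [measurable]: "g \<in> borel_measurable borel" using L2_measurable[OF g] by simp
  have [measurable]: "v \<in> borel_measurable borel" using borel_measurable_integrable[OF v] by simp
  have 1: "cmod (L2_inner g (tf_shift w (tf_shift u g))) = v (w + u)" for w
    unfolding v_def tf_shift_add[abs_def] L2_inner_scale_right by (simp add: norm_mult)
  have 2: "cmod (L2_inner (tf_shift z g) (tf_shift w g)) = v (w - z)" for w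
    unfolding v_def by (rule norm_L2_inner_tf_shift_tf_shift[OF g])
  have vz: "integrable lborel (\<lambda>w. v (w - z))"
    using integrable_lborel_translate[OF v, of "- z"] by simp
  \<comment> \<open>One factor is bounded by the squared norm of \<open>g\<close>, and the other is
    integrable because \<open>g\<close> lies in \<open>M1\<close>.\<close>
  have i: "integrable lborel (\<lambda>w. v (w + u) * v (w - z))"
  proof (rule Bochner_Integration.integrable_bound[OF integrable_mult_right[OF vz, of "(L2_norm g)\<^sup>2"]])
    have "v y \<le> (L2_norm g)\<^sup>2" for y
      using norm_L2_inner_le[OF g tf_shift_L2(1)[OF g], of y]
      by (simp add: v_def tf_shift_L2 g power2_eq_square)
    then show "AE w in lborel. norm (v (w + u) * v (w - z)) \<le> norm ((L2_norm g)\<^sup>2 * v (w - z))"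
      by (intro AE_I2) (simp add: v_def abs_mult mult_right_mono)
  qed measurable
  have "cmod (L2_inner g (tf_shift z g) * L2_inner g (tf_shift u g)) \<le>
    (\<integral>w. cmod (L2_inner g (tf_shift w (tf_shift u g))) * cmod (L2_inner (tf_shift z g) (tf_shift w g)) \<partial>lborel)"
  proof (rule moyal_inequality)
    show "integrable lborel (\<lambda>w. L2_inner g (tf_shift w (tf_shift u g)) * cnj (L2_inner (tf_shift z g) (tf_shift w g)))"
    proof (rule Bochner_Integration.integrable_bound[OF i])
      show "(\<lambda>w. L2_inner g (tf_shift w (tf_shift u g)) * cnj (L2_inner (tf_shift z g) (tf_shift w g)))
          \<in> borel_measurable lborel"
        unfolding L2_inner_def tf_shift_cis by measurable
    qed (auto simp: norm_mult 1 2)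
  qed (auto intro: g tf_shift_L2)
  then have "v z * v u \<le> (\<integral>w. v (w + u) * v (w - z) \<partial>lborel)"
    unfolding 1 2 by (simp add: norm_mult v_def)
  then have "ennreal (v z * v u) \<le> (\<integral>\<^sup>+ w. ennreal (v (w + u) * v (w - z)) \<partial>lborel)"
    using i by (subst nn_integral_eq_integral) (auto simp: v_def intro: ennreal_leI)
  then show ?thesis by (simp add: ennreal_mult v_def)
qed

text \<open>At 0 the ambiguity function equals the squared norm of \<open>g\<close>, and strong
  continuity keeps it above half of that on a ball. This supplies the lower bound on
  \<open>v\<close> that the averaging argument needs.\<close>

lemma ambiguity_tail:
  fixes g :: "real ^ 'd \<Rightarrow> complex"
  assumes g: "g \<in> M1" and pos: "L2_norm g > 0" and \<delta>: "\<delta> > 0"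
  defines "v \<equiv> \<lambda>z. cmod (L2_inner g (tf_shift z g))"
  shows "\<exists>B>0. \<forall>Z. finite Z \<longrightarrow> separated \<delta> Z \<longrightarrow> (\<Sum>z\<in>Z. v z) \<le> B"
    and "\<eta> > 0 \<Longrightarrow> \<exists>r>0. \<forall>Z. finite Z \<longrightarrow> separated \<delta> Z \<longrightarrow> (\<forall>z\<in>Z. r \<le> norm z) \<longrightarrow> (\<Sum>z\<in>Z. v z) \<le> \<eta>"
proof -
  have gL: "g \<in> L2" and v: "integrable lborel v" using g by (auto simp: M1_def v_def)
  obtain d where d: "d > 0" "\<And>z. norm z < d \<Longrightarrow> L2_norm (\<lambda>t. tf_shift z g t - g t) < L2_norm g / 2"
    using tf_shift_near_zero[OF gL, of "L2_norm g / 2"] pos by auto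
  have c: "(L2_norm g)\<^sup>2 / 2 \<le> v u" if u: "norm u < d" for u
  proof -
    have "v u = cmod (L2_inner (tf_shift u g) g)"
      unfolding v_def by (subst L2_inner_commute) simp
    moreover have "L2_inner (tf_shift u g) g - L2_inner g g = L2_inner (\<lambda>t. tf_shift u g t - g t) g"
      by (intro L2_inner_diff_left tf_shift_L2 gL)
    moreover have "cmod (L2_inner (\<lambda>t. tf_shift u g t - g t) g) \<le> L2_norm g / 2 * L2_norm g"
      using norm_L2_inner_le[OF L2_diff[OF tf_shift_L2(1)[OF gL] gL] gL, of u] d(2)[OF u] pos
      by (meson less_imp_le mult_right_mono order_trans)
    moreover have "cmod (L2_inner g g) = (L2_norm g)\<^sup>2"
      by (simp add: L2_norm_sq_inner[symmetric] del: of_real_power)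
    ultimately show ?thesis
      using norm_triangle_ineq3[of "L2_inner (tf_shift u g) g" "L2_inner g g"]
      by (simp add: power2_eq_square)
  qed
  have nn: "0 \<le> v z" for z by (simp add: v_def)
  have conv: "ennreal (v z * v u) \<le> (\<integral>\<^sup>+ w. ennreal (v (w + u)) * ennreal (v (w - z)) \<partial>lborel)" for z u
    unfolding v_def by (rule ambiguity_convolution[OF g])
  have c0: "(L2_norm g)\<^sup>2 / 2 > 0" using pos by simp
  note * = self_convolution_tail[OF v nn conv c c0 d(1) \<delta>]
  show "\<exists>B>0. \<forall>Z. finite Z \<longrightarrow> separated \<delta> Z \<longrightarrow> (\<Sum>z\<in>Z. v z) \<le> B" by (rule *(1))
  show "\<eta> > 0 \<Longrightarrow> \<exists>r>0. \<forall>Z. finite Z \<longrightarrow> separated \<delta> Z \<longrightarrow> (\<forall>z\<in>Z. r \<le> norm z) \<longrightarrow> (\<Sum>z\<in>Z. v z) \<le> \<eta>"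
    by (rule *(2))
qed

section \<open>Localisation\<close>

text \<open>Up to normalisation, the integral over \<open>u\<close> of the product of the indicators
  of \<open>ball u 1\<close> at \<open>a\<close> and at \<open>b\<close>; hence the weight that a
  pair receives when restrictions to unit balls are averaged.\<close>

definition ball_overlap :: "'a::euclidean_space \<Rightarrow> 'a \<Rightarrow> real" where
  "ball_overlap a b = measure lborel (ball a 1 \<inter> ball b 1) / measure lborel (ball (0::'a) 1)"

lemma fmeasurable_bounded_borel:
  fixes S :: "'a::euclidean_space set"
  shows "bounded S \<Longrightarrow> S \<in> sets borel \<Longrightarrow> S \<in> fmeasurable lborel"
  by (intro fmeasurableI emeasure_bounded_finite) auto

lemma measure_unit_ball_pos: "measure lborel (ball (0::'a::euclidean_space) 1) > 0"
  by (simp add: content_ball)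

lemma measure_ball_Int: "measure lborel (ball (a::'a) 1 \<inter> ball b 1) = ball_overlap a b * measure lborel (ball (0::'a::euclidean_space) 1)"
  using measure_unit_ball_pos[where 'a='a] by (simp add: ball_overlap_def)

lemma ball_overlap_bounds:
  fixes a b :: "'a::euclidean_space"
  shows "0 \<le> ball_overlap a b" "ball_overlap a b \<le> 1"
proof -
  have "measure lborel (ball a 1 \<inter> ball b 1) \<le> measure lborel (ball a 1)"
    by (intro measure_mono_fmeasurable fmeasurable_bounded_borel) auto
  also have "\<dots> = measure lborel (ball (0::'a) 1)" by (simp add: content_ball)
  finally show "ball_overlap a b \<le> 1"
    using measure_unit_ball_pos[where 'a='a] by (simp add: ball_overlap_def)
  show "0 \<le> ball_overlap a b" by (simp add: ball_overlap_def)
qed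

text \<open>The ball around \<open>a\<close> of radius \<open>1 - norm (a - b)\<close> lies in both
  unit balls; its relative volume is a power with exponent the dimension, to which Bernoulli's
  inequality applies. At distance above 1 the right side exceeds 1.\<close>

lemma ball_overlap_near:
  fixes a b :: "'a::euclidean_space"
  shows "1 - ball_overlap a b \<le> real DIM('a) * norm (a - b)"
proof (cases "norm (a - b) \<le> 1")
  case True
  let ?r = "1 - norm (a - b)"
  have "ball a ?r \<subseteq> ball a 1 \<inter> ball b 1"
  proof
    fix y assume y: "y \<in> ball a ?r"
    then have "dist b y < 1" using dist_triangle[of b y a] by (simp add: dist_norm norm_minus_commute)
    moreover have "dist a y < 1" using y norm_ge_zero[of "a - b"] unfolding mem_ball by linarith
    ultimately show "y \<in> ball a 1 \<inter> ball b 1" by simp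
  qed
  then have "measure lborel (ball a ?r) \<le> measure lborel (ball a 1 \<inter> ball b 1)"
    by (intro measure_mono_fmeasurable fmeasurable_bounded_borel bounded_Int) auto
  moreover have "measure lborel (ball a ?r) = measure lborel (ball (0::'a) 1) * ?r ^ DIM('a)"
    using True by (simp add: content_ball)
  ultimately have "?r ^ DIM('a) \<le> ball_overlap a b"
    using measure_unit_ball_pos[where 'a='a] by (simp add: ball_overlap_def field_simps)
  moreover have "1 + real DIM('a) * (- norm (a - b)) \<le> (1 + (- norm (a - b))) ^ DIM('a)"
    using True by (intro Bernoulli_inequality) simp
  ultimately show ?thesis by simp
next
  case False
  have "1 * 1 \<le> real DIM('a) * norm (a - b)"
    using False DIM_positive[where 'a='a] by (intro mult_mono) (auto simp: Suc_le_eq)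
  then show ?thesis using ball_overlap_bounds(1)[of a b] by simp
qed

text \<open>A packing argument: the disjoint balls of radius \<open>\<delta>/2\<close> fit into one
  ball whose volume does not depend on its centre. The absolute value admits negative
  \<open>R\<close>.\<close>

lemma card_separated_bounded:
  assumes \<delta>: "\<delta> > 0"
  shows "\<exists>N>0. \<forall>(c::'a::euclidean_space) H. finite H \<longrightarrow> separated \<delta> H \<longrightarrow> H \<subseteq> cball c R \<longrightarrow> real (card H) \<le> N"
proof -
  define b where "b = measure lborel (ball (0::'a) (\<delta>/2))"
  define V where "V = measure lborel (ball (0::'a) (\<bar>R\<bar> + \<delta>))"
  have b: "b > 0" using \<delta> by (simp add: b_def content_ball)
  have V: "V > 0" using \<delta> by (simp add: V_def content_ball)
  show ?thesis
  proof (intro exI[of _ "V / b"] conjI allI impI)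
    show "V / b > 0" using b V by simp
    fix c :: 'a and H assume H: "finite H" "separated \<delta> H" "H \<subseteq> cball c R"
    have "disjoint_family_on (\<lambda>z. ball z (\<delta>/2)) H"
      unfolding disjoint_family_on_def
    proof (intro ballI impI)
      fix z z' assume zz: "z \<in> H" "z' \<in> H" "z \<noteq> z'"
      then have d: "\<delta> \<le> dist z z'" using H(2) by (simp add: separated_def)
      have False if "dist z y < \<delta>/2" "dist z' y < \<delta>/2" for y
        using dist_triangle2[of z z' y] that d by linarith
      then show "ball z (\<delta>/2) \<inter> ball z' (\<delta>/2) = {}" by auto
    qed
    then have "measure lborel (\<Union>z\<in>H. ball z (\<delta>/2)) = (\<Sum>z\<in>H. measure lborel (ball z (\<delta>/2)))"
      using H(1) emeasure_bounded_finite[OF bounded_ball[of _ "\<delta>/2"]]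
      by (intro measure_finite_Union) (auto simp: less_top)
    also have "\<dots> = real (card H) * b" using \<delta> by (simp add: b_def content_ball)
    finally have "real (card H) * b = measure lborel (\<Union>z\<in>H. ball z (\<delta>/2))" by simp
    also have "\<dots> \<le> measure lborel (ball c (\<bar>R\<bar> + \<delta>))"
    proof (intro measure_mono_fmeasurable fmeasurable_bounded_borel)
      have "open (\<Union>z\<in>H. ball z (\<delta>/2))" by auto
      then show "(\<Union>z\<in>H. ball z (\<delta>/2)) \<in> sets lborel" by simp
      show "(\<Union>z\<in>H. ball z (\<delta>/2)) \<subseteq> ball c (\<bar>R\<bar> + \<delta>)"
      proof
        fix y assume "y \<in> (\<Union>z\<in>H. ball z (\<delta>/2))"
        then obtain z where z: "z \<in> H" "dist z y < \<delta>/2" by auto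
        have "dist c z \<le> R" using z H(3) by auto
        then show "y \<in> ball c (\<bar>R\<bar> + \<delta>)"
          using z dist_triangle[of c y z] \<delta> unfolding mem_ball by linarith
      qed
    qed auto
    also have "\<dots> = V" using \<delta> by (simp add: V_def content_ball)
    finally show "real (card H) \<le> V / b" using b by (simp add: field_simps)
  qed
qed

text \<open>
  The quadratic form of \<open>M\<close> is compared with the average over \<open>u\<close> of its restrictions to
  the unit balls centred at \<open>u\<close>, as in the IMS localisation formula.
\<close>

lemma localisation:
  fixes x :: "'i \<Rightarrow> 'a::euclidean_space" and M :: "'i \<Rightarrow> 'i \<Rightarrow> complex"
  defines "P u F \<equiv> {i \<in> F. x i \<in> ball u 1}"
  assumes F: "finite F"
    and local: "\<And>u. \<alpha> * (\<Sum>i\<in>P u F. w i) \<le> Re (\<Sum>i\<in>P u F. \<Sum>j\<in>P u F. M i j)"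
  shows "\<alpha> * (\<Sum>i\<in>F. w i) \<le> Re (\<Sum>i\<in>F. \<Sum>j\<in>F. M i j) +
    (\<Sum>i\<in>F. \<Sum>j\<in>F. cmod (M i j) * (1 - ball_overlap (x i) (x j)))"
proof -
  let ?m = "measure lborel (ball (0::'a) 1)"
  let ?I = "\<lambda>i u. indicator (ball (x i) 1) u :: real"
  let ?J = "\<lambda>i j u. indicator (ball (x i) 1 \<inter> ball (x j) 1) u :: real"
  have restr: "(\<Sum>i\<in>P u F. h i) = (\<Sum>i\<in>F. ?I i u * h i)" for u and h :: "'i \<Rightarrow> real"
  proof -
    have "(\<Sum>i\<in>P u F. h i) = (\<Sum>i\<in>F. if x i \<in> ball u 1 then h i else 0)"
      unfolding P_def by (rule sum.inter_filter[OF F])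
    also have "\<dots> = (\<Sum>i\<in>F. ?I i u * h i)"
      by (intro sum.cong refl) (auto simp: indicator_def dist_commute)
    finally show ?thesis .
  qed
  have l: "\<alpha> * (\<Sum>i\<in>P u F. w i) = (\<Sum>i\<in>F. \<alpha> * w i * ?I i u)" for u
    by (simp add: restr sum_distrib_left mult_ac)
  have r: "Re (\<Sum>i\<in>P u F. \<Sum>j\<in>P u F. M i j) = (\<Sum>i\<in>F. \<Sum>j\<in>F. Re (M i j) * ?J i j u)" for u
    by (simp add: restr sum_distrib_left indicator_inter_arith mult_ac)
  have int_I: "integrable lborel (?I i)" for i
    by (intro integrable_real_indicator emeasure_bounded_finite) auto
  have int_J: "integrable lborel (?J i j)" for i j
    by (intro integrable_real_indicator emeasure_bounded_finite bounded_Int) auto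
  \<comment> \<open>Since \<open>x i \<in> ball u 1\<close> is symmetric in the two points,
    integrating over \<open>u\<close> gives every diagonal weight the volume of the unit ball and
    every pair the volume of an intersection of two.\<close>
  have "(\<integral>u. (\<Sum>i\<in>F. \<alpha> * w i * ?I i u) \<partial>lborel) \<le> (\<integral>u. (\<Sum>i\<in>F. \<Sum>j\<in>F. Re (M i j) * ?J i j u) \<partial>lborel)"
  proof (rule integral_mono)
    show "(\<Sum>i\<in>F. \<alpha> * w i * ?I i u) \<le> (\<Sum>i\<in>F. \<Sum>j\<in>F. Re (M i j) * ?J i j u)" for u
      using local[of u] unfolding l r .
  qed (intro Bochner_Integration.integrable_sum integrable_mult_right int_I int_J)+
  also have "(\<integral>u. (\<Sum>i\<in>F. \<alpha> * w i * ?I i u) \<partial>lborel) = ?m * (\<alpha> * (\<Sum>i\<in>F. w i))"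
    using int_I by (simp add: Bochner_Integration.integral_sum content_ball sum_distrib_left mult_ac)
  also have "(\<integral>u. (\<Sum>i\<in>F. \<Sum>j\<in>F. Re (M i j) * ?J i j u) \<partial>lborel)
    = ?m * (\<Sum>i\<in>F. \<Sum>j\<in>F. Re (M i j) * ball_overlap (x i) (x j))"
    using int_J by (simp add: Bochner_Integration.integral_sum Bochner_Integration.integrable_sum
        measure_ball_Int sum_distrib_left mult_ac)
  finally have "\<alpha> * (\<Sum>i\<in>F. w i) \<le> (\<Sum>i\<in>F. \<Sum>j\<in>F. Re (M i j) * ball_overlap (x i) (x j))"
    using measure_unit_ball_pos[where 'a='a] by simp
  \<comment> \<open>Restoring the missing part \<open>1 - ball_overlap\<close> of each entry costs
    at most its modulus.\<close>
  also have "\<dots> \<le> (\<Sum>i\<in>F. \<Sum>j\<in>F. Re (M i j) + cmod (M i j) * (1 - ball_overlap (x i) (x j)))"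
  proof (intro sum_mono)
    fix i j
    have "(- Re (M i j)) * (1 - ball_overlap (x i) (x j)) \<le> cmod (M i j) * (1 - ball_overlap (x i) (x j))"
      using ball_overlap_bounds(2)[of "x i" "x j"] abs_Re_le_cmod[of "M i j"]
      by (intro mult_right_mono) auto
    then show "Re (M i j) * ball_overlap (x i) (x j) \<le> Re (M i j) + cmod (M i j) * (1 - ball_overlap (x i) (x j))"
      by (simp add: algebra_simps)
  qed
  finally show ?thesis by (simp add: sum.distrib)
qed

section \<open>Schur's test and finite families of shifts\<close>

text \<open>The arithmetic-geometric mean inequality separates the coefficients; by symmetry of
  \<open>W\<close> the resulting column sums are row sums as well.\<close>

lemma schur_bound:
  fixes c :: "'i \<Rightarrow> complex" and W :: "'i \<Rightarrow> 'i \<Rightarrow> real"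
  assumes W: "\<And>i j. 0 \<le> W i j" "\<And>i j. W i j = W j i" and K: "\<And>i. i \<in> F \<Longrightarrow> (\<Sum>j\<in>F. W i j) \<le> K"
  shows "(\<Sum>i\<in>F. \<Sum>j\<in>F. cmod (c i) * cmod (c j) * W i j) \<le> K * (\<Sum>i\<in>F. (cmod (c i))\<^sup>2)"
proof -
  have "(\<Sum>i\<in>F. \<Sum>j\<in>F. cmod (c i) * cmod (c j) * W i j)
      \<le> (\<Sum>i\<in>F. \<Sum>j\<in>F. ((cmod (c i))\<^sup>2 * W i j + (cmod (c j))\<^sup>2 * W i j) / 2)"
  proof (intro sum_mono)
    fix i j
    have "(2 * (cmod (c i) * cmod (c j))) * W i j \<le> ((cmod (c i))\<^sup>2 + (cmod (c j))\<^sup>2) * W i j"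
      using sum_squares_bound[of "cmod (c i)" "cmod (c j)"] W(1) by (intro mult_right_mono) (auto simp: mult.assoc)
    then show "cmod (c i) * cmod (c j) * W i j \<le> ((cmod (c i))\<^sup>2 * W i j + (cmod (c j))\<^sup>2 * W i j) / 2"
      by (simp add: algebra_simps)
  qed
  also have "\<dots> = ((\<Sum>i\<in>F. \<Sum>j\<in>F. (cmod (c i))\<^sup>2 * W i j) + (\<Sum>i\<in>F. \<Sum>j\<in>F. (cmod (c j))\<^sup>2 * W i j)) / 2"
    by (simp add: sum.distrib flip: sum_divide_distrib)
  also have "(\<Sum>i\<in>F. \<Sum>j\<in>F. (cmod (c j))\<^sup>2 * W i j) = (\<Sum>i\<in>F. \<Sum>j\<in>F. (cmod (c i))\<^sup>2 * W i j)"
    by (subst sum.swap) (simp add: W(2))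
  also have "((\<Sum>i\<in>F. \<Sum>j\<in>F. (cmod (c i))\<^sup>2 * W i j) + (\<Sum>i\<in>F. \<Sum>j\<in>F. (cmod (c i))\<^sup>2 * W i j)) / 2
    = (\<Sum>i\<in>F. (cmod (c i))\<^sup>2 * (\<Sum>j\<in>F. W i j))"
    by (simp flip: sum_distrib_left)
  also have "\<dots> \<le> (\<Sum>i\<in>F. (cmod (c i))\<^sup>2 * K)"
    by (intro sum_mono mult_left_mono K) auto
  finally show ?thesis by (simp add: sum_distrib_left mult.commute)
qed

text \<open>The common shift by \<open>z\<close> is unitary and drops out of the norm. What it
  leaves on each vector is a scalar of modulus 1, harmless because lower bounds hold for all
  coefficients.\<close>

lemma tf_shift_family_norm:
  assumes g: "g \<in> L2"
  shows "L2_norm (\<lambda>t. \<Sum>i\<in>F. c i * tf_shift (z + w i) g t)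
    = L2_norm (\<lambda>t. \<Sum>i\<in>F. c i * cis (2 * pi * (snd (w i) \<bullet> fst z)) * tf_shift (w i) g t)"
proof -
  let ?h = "\<lambda>t. \<Sum>i\<in>F. (c i * cis (2 * pi * (snd (w i) \<bullet> fst z))) * tf_shift (w i) g t"
  have "?h \<in> L2" by (intro L2_sum L2_scale tf_shift_L2 g)
  from tf_shift_L2(2)[OF this, of z] show ?thesis
    unfolding tf_shift_sum[abs_def] by (simp add: tf_shift_add mult.assoc)
qed

lemma sum_norm_le_sqrt_card:
  fixes c :: "'i \<Rightarrow> complex"
  assumes "real (card F) \<le> N"
  shows "(\<Sum>i\<in>F. cmod (c i)) \<le> sqrt N * sqrt (\<Sum>i\<in>F. (cmod (c i))\<^sup>2)"
proof -
  have "(\<Sum>i\<in>F. cmod (c i) * 1)\<^sup>2 \<le> (\<Sum>i\<in>F. (cmod (c i))\<^sup>2) * (\<Sum>i\<in>F. 1\<^sup>2)"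
    by (rule Cauchy_Schwarz_ineq_sum)
  also have "\<dots> \<le> (\<Sum>i\<in>F. (cmod (c i))\<^sup>2) * N"
    using assms by (intro mult_left_mono) (auto intro: sum_nonneg)
  finally have "(\<Sum>i\<in>F. cmod (c i))\<^sup>2 \<le> N * (\<Sum>i\<in>F. (cmod (c i))\<^sup>2)" by (simp add: mult.commute)
  then show ?thesis
    unfolding real_sqrt_mult[symmetric] by (rule real_le_rsqrt)
qed

text \<open>
  After factoring out one common time-frequency shift on either side, the phases are absorbed in the
  coefficients and only strong continuity of \<open>tf_shift\<close> on a bounded set is used.
\<close>

lemma local_lower_bound:
  assumes g: "g \<in> L2"
    and lower: "\<And>c. A * sqrt (\<Sum>l\<in>F. (cmod (c l))\<^sup>2) \<le> L2_norm (\<lambda>t. \<Sum>l\<in>F. c l * tf_shift l g t)"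
    and N: "real (card F) \<le> N" and e: "sqrt N * e \<le> A / 2" "0 \<le> A"
    and close: "\<And>l. l \<in> F \<Longrightarrow> L2_norm (\<lambda>t. tf_shift (\<tau> l - \<tau> b) g t - tf_shift (l - b) g t) \<le> e"
  shows "A\<^sup>2 / 4 * (\<Sum>l\<in>F. (cmod (c l))\<^sup>2) \<le> (L2_norm (\<lambda>t. \<Sum>l\<in>F. c l * tf_shift (\<tau> l) g t))\<^sup>2"
proof -
  define p where "p l = cis (2 * pi * (snd (\<tau> l - \<tau> b) \<bullet> fst (\<tau> b)))" for l
  define q where "q l = cis (2 * pi * (snd (l - b) \<bullet> fst b))" for l
  \<comment> \<open>These coefficients are matched so that, after removal of the shift by
    \<open>b\<close>, the original family carries the same scalars \<open>c l * p l\<close> as the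
    deformed family after removal of the shift by \<open>\<tau> b\<close>. Their moduli are those of
    \<open>c\<close>.\<close>
  define c' where "c' l = c l * p l * cnj (q l)" for l
  have cmods: "cmod (p l) = 1" "cmod (q l) = 1" "cnj (q l) * q l = 1" for l
    by (simp_all add: p_def q_def cis_cnj cis_mult)
  let ?s = "sqrt (\<Sum>l\<in>F. (cmod (c l))\<^sup>2)"
  have 1: "L2_norm (\<lambda>t. \<Sum>l\<in>F. c l * tf_shift (\<tau> l) g t)
      = L2_norm (\<lambda>t. \<Sum>l\<in>F. c l * p l * tf_shift (\<tau> l - \<tau> b) g t)"
    using tf_shift_family_norm[OF g, where F=F and c=c and z="\<tau> b" and w="\<lambda>l. \<tau> l - \<tau> b"] by (simp add: p_def)
  have "c' l * q l = c l * p l" for l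
    by (simp add: c'_def mult.assoc cmods)
  then have 2: "L2_norm (\<lambda>t. \<Sum>l\<in>F. c' l * tf_shift l g t)
      = L2_norm (\<lambda>t. \<Sum>l\<in>F. c l * p l * tf_shift (l - b) g t)"
    using tf_shift_family_norm[OF g, where F=F and c=c' and z=b and w="\<lambda>l. l - b"] by (simp add: q_def)
  have in1: "(\<lambda>t. \<Sum>l\<in>F. c l * p l * tf_shift (l - b) g t) \<in> L2"
    and in2: "(\<lambda>t. \<Sum>l\<in>F. c l * p l * tf_shift (\<tau> l - \<tau> b) g t) \<in> L2"
    by (intro L2_sum L2_scale tf_shift_L2 g)+
  have "L2_norm (\<lambda>t. (\<Sum>l\<in>F. c l * p l * tf_shift (l - b) g t) - (\<Sum>l\<in>F. c l * p l * tf_shift (\<tau> l - \<tau> b) g t))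
     = L2_norm (\<lambda>t. \<Sum>l\<in>F. c l * p l * (tf_shift (l - b) g t - tf_shift (\<tau> l - \<tau> b) g t))"
    by (simp add: sum_subtractf right_diff_distrib)
  also have "\<dots> \<le> (\<Sum>l\<in>F. L2_norm (\<lambda>t. c l * p l * (tf_shift (l - b) g t - tf_shift (\<tau> l - \<tau> b) g t)))"
    by (intro L2_sum L2_scale L2_diff tf_shift_L2 g)
  also have "\<dots> \<le> (\<Sum>l\<in>F. cmod (c l) * e)"
    unfolding L2_norm_scale norm_mult cmods mult_1_right
    by (intro sum_mono mult_left_mono) (auto simp: L2_norm_minus_commute[of "tf_shift (_ - b) g"] intro: close)
  also have "\<dots> \<le> A / 2 * ?s"
  proof (cases "F = {}")
    case False
    then obtain l where "l \<in> F" by blast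
    \<comment> \<open>\<open>e\<close> is known to be nonnegative only because it bounds a norm at
      some point of \<open>F\<close>; hence the separate treatment of the empty set.\<close>
    then have e0: "0 \<le> e" using close[of l] L2_norm_nonneg order_trans by blast
    have "(\<Sum>l\<in>F. cmod (c l) * e) = (\<Sum>l\<in>F. cmod (c l)) * e" by (simp add: sum_distrib_right)
    also have "\<dots> \<le> (sqrt N * ?s) * e"
      by (intro mult_right_mono sum_norm_le_sqrt_card N e0)
    also have "\<dots> = (sqrt N * e) * ?s" by simp
    also have "\<dots> \<le> A / 2 * ?s" by (intro mult_right_mono e) (auto intro: sum_nonneg)
    finally show ?thesis .
  qed simp
  finally have 3: "L2_norm (\<lambda>t. (\<Sum>l\<in>F. c l * p l * tf_shift (l - b) g t) - (\<Sum>l\<in>F. c l * p l * tf_shift (\<tau> l - \<tau> b) g t))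
      \<le> A / 2 * ?s" .
  have "A * ?s \<le> L2_norm (\<lambda>t. \<Sum>l\<in>F. c' l * tf_shift l g t)"
    using lower[of c'] by (simp add: c'_def norm_mult cmods)
  with 1 2 3 L2_norm_triangle_diff[OF in1 in2]
  have "A / 2 * ?s \<le> L2_norm (\<lambda>t. \<Sum>l\<in>F. c l * tf_shift (\<tau> l) g t)" by (simp add: field_simps)
  then have "(A / 2 * ?s)\<^sup>2 \<le> (L2_norm (\<lambda>t. \<Sum>l\<in>F. c l * tf_shift (\<tau> l) g t))\<^sup>2"
    using e(2) by (intro power_mono) (auto intro!: mult_nonneg_nonneg sum_nonneg)
  then show ?thesis by (simp add: power_mult_distrib power_divide sum_nonneg)
qed

section \<open>Riesz sequences from finite sections\<close>

text \<open>Extending finitely supported coefficients by zero makes the partial sums eventually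
  constant. The sum \<open>f\<close> is fixed only up to null sets, so it is compared with the
  finite sum through norms.\<close>

lemma riesz_sequence_finite_lower:
  fixes I :: "'i set"
  assumes "riesz_sequence I \<phi>"
  obtains A where "A > 0"
    "\<And>F (c :: 'i \<Rightarrow> complex). finite F \<Longrightarrow> F \<subseteq> I \<Longrightarrow> A * sqrt (\<Sum>i\<in>F. (cmod (c i))\<^sup>2) \<le> L2_norm (\<lambda>t. \<Sum>i\<in>F. c i * \<phi> i t)"
proof -
  from assms obtain A B where A: "A > 0" and \<phi>: "\<And>i. i \<in> I \<Longrightarrow> \<phi> i \<in> L2"
    and ex: "\<And>c. c \<in> ell2 I \<Longrightarrow> \<exists>f. L2_has_sum (\<lambda>i t. c i * \<phi> i t) f I \<and> A * ell2_norm I c \<le> L2_norm f"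
    unfolding riesz_sequence_def by blast
  show thesis
  proof (rule that[OF A])
    fix F and c :: "'i \<Rightarrow> complex" assume F: "finite F" "F \<subseteq> I"
    define c' where "c' i = (if i \<in> F then c i else 0)" for i
    have hs: "((\<lambda>i. (cmod (c' i))\<^sup>2) has_sum (\<Sum>i\<in>F. (cmod (c i))\<^sup>2)) I"
    proof (subst has_sum_cong_neutral[where T=F and g="\<lambda>i. (cmod (c i))\<^sup>2"])
      show "((\<lambda>i. (cmod (c i))\<^sup>2) has_sum (\<Sum>i\<in>F. (cmod (c i))\<^sup>2)) F" by (rule has_sum_finite[OF F(1)])
    qed (use F in \<open>auto simp: c'_def\<close>)
    then have "c' \<in> ell2 I" and norm: "ell2_norm I c' = sqrt (\<Sum>i\<in>F. (cmod (c i))\<^sup>2)"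
      by (auto simp: ell2_def ell2_norm_def summable_on_def infsumI)
    from ex[OF this(1)] obtain f where f: "f \<in> L2" "A * ell2_norm I c' \<le> L2_norm f"
      and lim: "((\<lambda>G. L2_norm (\<lambda>t. (\<Sum>i\<in>G. c' i * \<phi> i t) - f t)) \<longlongrightarrow> 0) (finite_subsets_at_top I)"
      by (auto simp: L2_has_sum_def)
    let ?S = "\<lambda>t. \<Sum>i\<in>F. c i * \<phi> i t"
    have "(\<Sum>i\<in>G. c' i * \<phi> i t) = ?S t" if "finite G" "F \<subseteq> G" for G t
      using that F by (intro sum.mono_neutral_cong_right) (auto simp: c'_def)
    then have "\<forall>\<^sub>F G in finite_subsets_at_top I.
        L2_norm (\<lambda>t. (\<Sum>i\<in>G. c' i * \<phi> i t) - f t) = L2_norm (\<lambda>t. ?S t - f t)"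
      unfolding eventually_finite_subsets_at_top using F by (intro exI[of _ F]) simp
    from tendsto_cong[THEN iffD1, OF this lim]
    have zero: "L2_norm (\<lambda>t. ?S t - f t) = 0"
      by (simp only: tendsto_const_iff[OF finite_subsets_at_top_neq_bot])
    have "?S \<in> L2" using F \<phi> by (intro L2_sum L2_scale) auto
    from L2_norm_abs_diff[OF this f(1)] zero have "L2_norm ?S = L2_norm f" by simp
    then show "A * sqrt (\<Sum>i\<in>F. (cmod (c i))\<^sup>2) \<le> L2_norm ?S"
      using f(2) by (simp add: norm)
  qed
qed

text \<open>The upper bound turns summability of the squared coefficients into a Cauchy condition
  over finite subsets, completeness supplies the sum, and both inequalities survive the limit. As
  completeness is about sequences, a sequence of finite sets is extracted first and convergence over
  all finite sets recovered afterwards.\<close>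

theorem riesz_sequenceI_finite:
  fixes I :: "'i set"
  assumes \<phi>: "\<And>i. i \<in> I \<Longrightarrow> \<phi> i \<in> L2" and AB: "0 < A" "A \<le> B"
    and lower: "\<And>F (c :: 'i \<Rightarrow> complex). finite F \<Longrightarrow> F \<subseteq> I \<Longrightarrow>
      A * sqrt (\<Sum>i\<in>F. (cmod (c i))\<^sup>2) \<le> L2_norm (\<lambda>t. \<Sum>i\<in>F. c i * \<phi> i t)"
    and upper: "\<And>F (c :: 'i \<Rightarrow> complex). finite F \<Longrightarrow> F \<subseteq> I \<Longrightarrow>
      L2_norm (\<lambda>t. \<Sum>i\<in>F. c i * \<phi> i t) \<le> B * sqrt (\<Sum>i\<in>F. (cmod (c i))\<^sup>2)"
  shows "riesz_sequence I \<phi>"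
proof -
  have "\<exists>f. L2_has_sum (\<lambda>i t. c i * \<phi> i t) f I \<and> A * ell2_norm I c \<le> L2_norm f \<and> L2_norm f \<le> B * ell2_norm I c"
    if c: "c \<in> ell2 I" for c
  proof -
    let ?n = "\<lambda>F. \<Sum>i\<in>F. (cmod (c i))\<^sup>2"
    define S where "S F t = (\<Sum>i\<in>F. c i * \<phi> i t)" for F t
    have SL: "S F \<in> L2" if "F \<subseteq> I" for F
      unfolding S_def[abs_def] using that \<phi> by (intro L2_sum L2_scale) auto
    define s where "s = (\<Sum>\<^sub>\<infinity>i\<in>I. (cmod (c i))\<^sup>2)"
    have lim: "(?n \<longlongrightarrow> s) (finite_subsets_at_top I)"
      using c has_sum_infsum unfolding ell2_def s_def has_sum_def by blast
    have tail: "\<exists>F. finite F \<and> F \<subseteq> I \<and> (\<forall>G. finite G \<longrightarrow> F \<subseteq> G \<longrightarrow> G \<subseteq> I \<longrightarrow>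
        L2_norm (\<lambda>t. S G t - S F t) < e)" if e: "e > 0" for e
    proof -
      \<comment> \<open>Two finite sums within \<open>?e / 2\<close> of the total differ by less
        than \<open>?e\<close>, which the upper bound converts into a norm of at most
        \<open>e / 2\<close>.\<close>
      let ?e = "(e / (2 * B))\<^sup>2"
      have e': "?e > 0" using e AB by simp
      from tendstoD[OF lim, of "?e / 2"] e' obtain F where F: "finite F" "F \<subseteq> I"
        and near: "\<And>G. finite G \<Longrightarrow> F \<subseteq> G \<Longrightarrow> G \<subseteq> I \<Longrightarrow> dist (?n G) s < ?e / 2"
        unfolding eventually_finite_subsets_at_top by (metis half_gt_zero)
      have "L2_norm (\<lambda>t. S G t - S F t) < e" if G: "finite G" "F \<subseteq> G" "G \<subseteq> I" for G
      proof -
        have n: "?n (G - F) = ?n G - ?n F" using G by (intro sum_diff) auto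
        have "?n (G - F) < ?e"
          using near[OF G] near[OF F(1) order_refl F(2)] unfolding n dist_real_def by linarith
        then have "sqrt (?n (G - F)) \<le> e / (2 * B)"
          using e AB by (intro real_le_lsqrt) (auto intro: sum_nonneg)
        then have "B * sqrt (?n (G - F)) \<le> e / 2" using AB by (simp add: field_simps)
        moreover have "S G t - S F t = S (G - F) t" for t
          unfolding S_def using G by (intro sum_diff[symmetric]) auto
        moreover have "L2_norm (S (G - F)) \<le> B * sqrt (?n (G - F))"
          unfolding S_def[abs_def] using G by (intro upper) auto
        ultimately show ?thesis using e by simp
      qed
      then show ?thesis using F by blast
    qed
    then obtain F where F: "\<And>k. finite (F k) \<and> F k \<subseteq> I"
      and Ftail: "\<And>k G. finite G \<Longrightarrow> F k \<subseteq> G \<Longrightarrow> G \<subseteq> I \<Longrightarrow> L2_norm (\<lambda>t. S G t - S (F k) t) < inverse (real (Suc k))"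
      using tail[of "inverse (real (Suc _))"] by (metis inverse_positive_iff_positive of_nat_0_less_iff zero_less_Suc)
    \<comment> \<open>The sets \<open>F k\<close> need not be nested; with unions, every later set
      contains \<open>F k\<close>, and \<open>near\<close> compares any two such sets.\<close>
    define U where "U k = (\<Union>j\<le>k. F j)" for k
    have U: "finite (U k)" "U k \<subseteq> I" "F k \<subseteq> U k" for k using F by (auto simp: U_def)
    have Umono: "F k \<subseteq> U m" if "k \<le> m" for k m using that by (auto simp: U_def)
    have near: "L2_norm (\<lambda>t. S G t - S H t) < 2 * inverse (real (Suc k))"
      if "finite G" "F k \<subseteq> G" "G \<subseteq> I" "finite H" "F k \<subseteq> H" "H \<subseteq> I" for G H k
    proof -
      have "L2_norm (\<lambda>t. S G t - S H t) \<le> L2_norm (\<lambda>t. S G t - S (F k) t) + L2_norm (\<lambda>t. S (F k) t - S H t)"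
        using that F by (intro L2_norm_triangle3 SL) auto
      then show ?thesis
        using Ftail[OF that(1-3)] Ftail[OF that(4-6)] L2_norm_minus_commute[of "S (F k)" "S H"] by linarith
    qed
    have small: "\<exists>k. 2 * inverse (real (Suc k)) < e" if e: "e > 0" for e
    proof -
      obtain k where "inverse (real (Suc k)) < e / 2" using reals_Archimedean[of "e / 2"] e by auto
      then show ?thesis by (intro exI[of _ k]) simp
    qed
    obtain f where f: "f \<in> L2" "(\<lambda>k. L2_norm (\<lambda>t. S (U k) t - f t)) \<longlonglongrightarrow> 0"
    proof (rule L2_complete[of "\<lambda>k. S (U k)"])
      show "S (U k) \<in> L2" for k by (intro SL U)
      fix e :: real assume "e > 0"
      then obtain k where k: "2 * inverse (real (Suc k)) < e" using small by blast
      show "\<exists>N. \<forall>m\<ge>N. \<forall>n\<ge>N. L2_norm (\<lambda>t. S (U m) t - S (U n) t) < e"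
        using near[OF U(1) Umono U(2) U(1) Umono U(2), of k] k by (meson less_trans)
    qed blast
    have conv: "((\<lambda>G. L2_norm (\<lambda>t. S G t - f t)) \<longlongrightarrow> 0) (finite_subsets_at_top I)"
    proof (rule tendstoI)
      fix e :: real assume e: "e > 0"
      then obtain k where k: "2 * inverse (real (Suc k)) < e / 2" using small[of "e / 2"] by auto
      have "\<forall>\<^sub>F m in sequentially. L2_norm (\<lambda>t. S (U m) t - f t) < e / 2"
        using order_tendstoD(2)[OF f(2), of "e / 2"] e by simp
      then obtain m where m: "m \<ge> k" "L2_norm (\<lambda>t. S (U m) t - f t) < e / 2"
        unfolding eventually_sequentially by (meson nle_le order_trans)
      have "dist (L2_norm (\<lambda>t. S G t - f t)) 0 < e" if G: "finite G" "F k \<subseteq> G" "G \<subseteq> I" for G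
      proof -
        have "L2_norm (\<lambda>t. S G t - f t) \<le> L2_norm (\<lambda>t. S G t - S (U m) t) + L2_norm (\<lambda>t. S (U m) t - f t)"
          using G U by (intro L2_norm_triangle3 SL f) auto
        then show ?thesis
          using near[OF G U(1) Umono[OF m(1)] U(2)] k m(2) by (simp add: dist_real_def)
      qed
      then show "\<forall>\<^sub>F G in finite_subsets_at_top I. dist (L2_norm (\<lambda>t. S G t - f t)) 0 < e"
        unfolding eventually_finite_subsets_at_top using F by blast
    qed
    have fin: "\<forall>\<^sub>F G in finite_subsets_at_top I. finite G \<and> G \<subseteq> I"
      by (rule eventually_finite_subsets_at_top_weakI) simp
    have norm_lim: "((\<lambda>G. L2_norm (S G)) \<longlongrightarrow> L2_norm f) (finite_subsets_at_top I)"
    proof (rule LIM_zero_cancel, rule Lim_null_comparison[OF _ conv])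
      show "\<forall>\<^sub>F G in finite_subsets_at_top I. norm (L2_norm (S G) - L2_norm f) \<le> L2_norm (\<lambda>t. S G t - f t)"
        using fin by eventually_elim (use L2_norm_abs_diff[OF SL f(1)] in auto)
    qed
    have sqrt_lim: "((\<lambda>G. sqrt (?n G)) \<longlongrightarrow> ell2_norm I c) (finite_subsets_at_top I)"
      unfolding ell2_norm_def s_def[symmetric] by (intro tendsto_real_sqrt lim)
    show ?thesis
    proof (intro exI[of _ f] conjI)
      show "L2_has_sum (\<lambda>i t. c i * \<phi> i t) f I"
        unfolding L2_has_sum_def using f(1) conv \<phi> by (auto simp: S_def intro: L2_scale)
      show "A * ell2_norm I c \<le> L2_norm f"
        by (rule tendsto_le[OF finite_subsets_at_top_neq_bot norm_lim tendsto_mult_left[OF sqrt_lim]])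
          (use fin in eventually_elim, simp add: S_def[abs_def] lower)
      show "L2_norm f \<le> B * ell2_norm I c"
        by (rule tendsto_le[OF finite_subsets_at_top_neq_bot tendsto_mult_left[OF sqrt_lim] norm_lim])
          (use fin in eventually_elim, simp add: S_def[abs_def] upper)
    qed
  qed
  then show ?thesis unfolding riesz_sequence_def using \<phi> AB by blast
qed

section \<open>Deformations\<close>

text \<open>Two points that are too close give vectors that are almost parallel up to a phase. The
  combination cancelling them has norm below \<open>A\<close> while its coefficient vector has
  length \<open>sqrt 2\<close>.\<close>

lemma tf_shift_lower_separated:
  assumes g: "g \<in> L2" and A: "A > 0"
    and lower: "\<And>F (c :: _ \<Rightarrow> complex). finite F \<Longrightarrow> F \<subseteq> \<Lambda> \<Longrightarrow>
      A * sqrt (\<Sum>l\<in>F. (cmod (c l))\<^sup>2) \<le> L2_norm (\<lambda>t. \<Sum>l\<in>F. c l * tf_shift l g t)"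
  obtains \<delta> where "\<delta> > 0" "separated \<delta> \<Lambda>"
proof -
  obtain d where d: "d > 0" "\<And>z. norm z < d \<Longrightarrow> L2_norm (\<lambda>t. tf_shift z g t - g t) < A"
    using tf_shift_near_zero[OF g A] by blast
  have "d \<le> dist l l'" if l: "l \<in> \<Lambda>" "l' \<in> \<Lambda>" "l \<noteq> l'" for l l'
  proof (rule ccontr)
    assume "\<not> d \<le> dist l l'"
    then have small: "norm (l' - l) < d" by (simp add: dist_norm norm_minus_commute)
    \<comment> \<open>The phase by which the shift to \<open>l'\<close> differs from the composite
      of the shifts by \<open>l\<close> and \<open>l' - l\<close>; without it the two vectors need
      not nearly cancel.\<close>
    define p where "p = cis (2 * pi * (snd (l' - l) \<bullet> fst l))"
    define c where "c k = (if k = l then p else - 1)" for k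
    have "(\<Sum>k\<in>{l, l'}. c k * tf_shift k g t) = tf_shift l (\<lambda>t. - p * (tf_shift (l' - l) g t - g t)) t" for t
    proof -
      have "tf_shift l' g t = p * tf_shift l (tf_shift (l' - l) g) t"
        using tf_shift_add[of l "l' - l" g t] by (simp add: p_def)
      then show ?thesis
        using l(3) by (simp add: c_def tf_shift_cis[of l] algebra_simps)
    qed
    then have "L2_norm (\<lambda>t. \<Sum>k\<in>{l, l'}. c k * tf_shift k g t)
        = L2_norm (tf_shift l (\<lambda>t. - p * (tf_shift (l' - l) g t - g t)))"
      by (simp only:)
    also have "\<dots> = L2_norm (\<lambda>t. - p * (tf_shift (l' - l) g t - g t))"
      by (intro tf_shift_L2(2) L2_scale L2_diff tf_shift_L2(1) g)
    also have "\<dots> = cmod (- p) * L2_norm (\<lambda>t. tf_shift (l' - l) g t - g t)"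
      by (rule L2_norm_scale)
    also have "\<dots> < A" using d(2)[OF small] by (simp add: p_def)
    finally have "A * sqrt (\<Sum>k\<in>{l, l'}. (cmod (c k))\<^sup>2) < A"
      using lower[of "{l, l'}" c] l by simp
    moreover have "(\<Sum>k\<in>{l, l'}. (cmod (c k))\<^sup>2) = 2" using l(3) by (simp add: c_def p_def)
    moreover have "A * 1 \<le> A * sqrt 2" using A by (intro mult_left_mono) auto
    ultimately show False by simp
  qed
  then show thesis using d(1) by (intro that[of d]) (auto simp: separated_def)
qed

lemma lipschitz_deformation_uniform:
  assumes "lipschitz_deformation \<Lambda> \<tau> \<Lambda>s" "R > 0" "e > 0"
  shows "\<forall>\<^sub>F n in sequentially. \<forall>l\<in>\<Lambda>. \<forall>l'\<in>\<Lambda>. norm (l - l') \<le> R \<longrightarrow>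
    norm ((\<tau> n l - \<tau> n l') - (l - l')) < e"
proof -
  let ?S = "{(l, l') \<in> \<Lambda> \<times> \<Lambda>. norm (l - l') \<le> R}"
  have "(\<lambda>n. SUP (l, l') \<in> ?S. ennreal (norm ((\<tau> n l - \<tau> n l') - (l - l')))) \<longlonglongrightarrow> 0"
    using assms(1,2) by (simp add: lipschitz_deformation_def)
  from order_tendstoD(2)[OF this, of "ennreal e"] assms(3)
  have "\<forall>\<^sub>F n in sequentially. (SUP (l, l') \<in> ?S. ennreal (norm ((\<tau> n l - \<tau> n l') - (l - l')))) < ennreal e"
    by simp
  then show ?thesis
  proof eventually_elim
    case (elim n)
    show ?case
    proof (intro ballI impI)
      fix l l' assume "l \<in> \<Lambda>" "l' \<in> \<Lambda>" "norm (l - l') \<le> R"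
      then have "ennreal (norm ((\<tau> n l - \<tau> n l') - (l - l')))
          \<le> (SUP (l, l') \<in> ?S. ennreal (norm ((\<tau> n l - \<tau> n l') - (l - l'))))"
        by (intro SUP_upper2[of "(l, l')"]) auto
      with elim have "ennreal (norm ((\<tau> n l - \<tau> n l') - (l - l'))) < ennreal e" by (rule order_le_less_trans[rotated])
      then show "norm ((\<tau> n l - \<tau> n l') - (l - l')) < e" by (simp add: ennreal_less_iff)
    qed
  qed
qed

lemma separated_subset: "separated \<delta> S \<Longrightarrow> H \<subseteq> S \<Longrightarrow> separated \<delta> H"
  unfolding separated_def by blast

text \<open>Images at distance at most 1 come from points within \<open>R\<close>, and for these the
  difference changes by less than half of the original separation. All other images are more than 1
  apart.\<close>

lemma separated_image:
  fixes \<tau> :: "'a::real_normed_vector \<Rightarrow> 'a"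
  assumes \<Lambda>: "separated \<delta> \<Lambda>" and \<delta>: "\<delta> > 0"
    and far: "\<And>l l'. l \<in> \<Lambda> \<Longrightarrow> l' \<in> \<Lambda> \<Longrightarrow> norm (\<tau> l - \<tau> l') \<le> 1 \<Longrightarrow> norm (l - l') \<le> R"
    and close: "\<And>l l'. l \<in> \<Lambda> \<Longrightarrow> l' \<in> \<Lambda> \<Longrightarrow> norm (l - l') \<le> R \<Longrightarrow> norm ((\<tau> l - \<tau> l') - (l - l')) < \<delta> / 2"
    and l: "l \<in> \<Lambda>" "l' \<in> \<Lambda>" "l \<noteq> l'"
  shows "min 1 (\<delta> / 2) \<le> norm (\<tau> l - \<tau> l')"
proof (cases "norm (\<tau> l - \<tau> l') \<le> 1")
  case True
  then have "norm ((\<tau> l - \<tau> l') - (l - l')) < \<delta> / 2" using l by (intro close far)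
  moreover have "\<delta> \<le> norm (l - l')" using \<Lambda> l by (simp add: separated_def dist_norm)
  ultimately show ?thesis
    using norm_triangle_ineq2[of "l - l'" "\<tau> l - \<tau> l'"] by (simp add: norm_minus_commute)
qed simp

lemma gram_entry_norm:
  assumes "g \<in> L2"
  shows "cmod (a * cnj b * L2_inner (tf_shift z g) (tf_shift w g)) =
    cmod a * cmod b * cmod (L2_inner g (tf_shift (w - z) g))"
  by (simp add: norm_mult norm_L2_inner_tf_shift_tf_shift[OF assms])

lemma Re_gram_sum:
  assumes "g \<in> L2"
  shows "Re (\<Sum>i\<in>F. \<Sum>j\<in>F. c i * cnj (c j) * L2_inner (tf_shift (\<tau> i) g) (tf_shift (\<tau> j) g))
    = (L2_norm (\<lambda>t. \<Sum>i\<in>F. c i * tf_shift (\<tau> i) g t))\<^sup>2"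
  by (subst L2_norm_sum_sq[symmetric]) (auto intro: tf_shift_L2 assms simp del: of_real_power)

text \<open>Sections over balls satisfy the bound with \<open>A^2 / 4\<close>, Schur's test bounds
  the localisation error by \<open>A^2 / 8\<close>, and the difference remains. The overlaps are
  taken at the undeformed points, where cardinality and closeness are controlled, while the matrix
  entries involve the deformed ones.\<close>

lemma deformed_lower_bound:
  fixes g :: "real ^ 'd \<Rightarrow> complex"
  assumes g: "g \<in> L2" and A: "A > 0" and R: "R > 0"
    and lower: "\<And>F (c :: _ \<Rightarrow> complex). finite F \<Longrightarrow> F \<subseteq> \<Lambda> \<Longrightarrow>
      A * sqrt (\<Sum>l\<in>F. (cmod (c l))\<^sup>2) \<le> L2_norm (\<lambda>t. \<Sum>l\<in>F. c l * tf_shift l g t)"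
    and card: "\<And>c H. finite H \<Longrightarrow> H \<subseteq> \<Lambda> \<Longrightarrow> H \<subseteq> cball c (2 * R) \<Longrightarrow> real (card H) \<le> N"
    and N: "N > 0"
    and close: "\<And>l l'. l \<in> \<Lambda> \<Longrightarrow> l' \<in> \<Lambda> \<Longrightarrow> norm (l - l') \<le> 2 * R \<Longrightarrow>
      L2_norm (\<lambda>t. tf_shift (\<tau> l - \<tau> l') g t - tf_shift (l - l') g t) \<le> A / (2 * sqrt N)"
    and rows: "\<And>F l. finite F \<Longrightarrow> F \<subseteq> \<Lambda> \<Longrightarrow> l \<in> F \<Longrightarrow>
      (\<Sum>l'\<in>F. cmod (L2_inner g (tf_shift (\<tau> l' - \<tau> l) g)) *
        (1 - ball_overlap ((1/R) *\<^sub>R l) ((1/R) *\<^sub>R l'))) \<le> A\<^sup>2 / 8"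
    and F: "finite F" "F \<subseteq> \<Lambda>"
  shows "A\<^sup>2 / 8 * (\<Sum>l\<in>F. (cmod (c l))\<^sup>2) \<le> (L2_norm (\<lambda>t. \<Sum>l\<in>F. c l * tf_shift (\<tau> l) g t))\<^sup>2"
proof -
  define M where "M i j = c i * cnj (c j) * L2_inner (tf_shift (\<tau> i) g) (tf_shift (\<tau> j) g)" for i j
  \<comment> \<open>Dividing by \<open>R\<close> turns balls of radius \<open>R\<close> into the
    unit balls of \<open>localisation\<close>; two points in one of them are at most
    \<open>2 * R\<close> apart before rescaling.\<close>
  define x where "x l = (1/R) *\<^sub>R l" for l :: "(real ^ 'd) \<times> (real ^ 'd)"
  let ?w = "\<lambda>l. (cmod (c l))\<^sup>2"
  have loc: "A\<^sup>2 / 4 * (\<Sum>i\<in>{i \<in> F. x i \<in> ball u 1}. ?w i)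
      \<le> Re (\<Sum>i\<in>{i \<in> F. x i \<in> ball u 1}. \<Sum>j\<in>{i \<in> F. x i \<in> ball u 1}. M i j)" for u
  proof (cases "{i \<in> F. x i \<in> ball u 1} = {}")
    case False
    let ?P = "{i \<in> F. x i \<in> ball u 1}"
    from False obtain l0 where l0: "l0 \<in> ?P" by blast
    have near: "norm (l - l0) \<le> 2 * R" if "l \<in> ?P" for l
    proof -
      have "norm (x l - x l0) < 2"
        using l0 that dist_triangle[of "x l" "x l0" u] by (simp add: dist_norm norm_minus_commute)
      moreover have "norm (x l - x l0) = norm (l - l0) / R"
        unfolding x_def scaleR_diff_right[symmetric] using R by simp
      ultimately show ?thesis using R by (simp add: field_simps)
    qed
    have P: "finite ?P" "?P \<subseteq> \<Lambda>" using F by auto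
    have "?P \<subseteq> cball l0 (2 * R)" using near by (auto simp: dist_norm norm_minus_commute)
    then have cardP: "real (card ?P) \<le> N" by (intro card P)
    have e: "sqrt N * (A / (2 * sqrt N)) \<le> A / 2" using N by simp
    have "A\<^sup>2 / 4 * (\<Sum>l\<in>?P. ?w l) \<le> (L2_norm (\<lambda>t. \<Sum>l\<in>?P. c l * tf_shift (\<tau> l) g t))\<^sup>2"
    proof (rule local_lower_bound[OF g _ cardP e, where \<tau>=\<tau> and b=l0])
      show "A * sqrt (\<Sum>l\<in>?P. (cmod (c l))\<^sup>2) \<le> L2_norm (\<lambda>t. \<Sum>l\<in>?P. c l * tf_shift l g t)" for c
        by (rule lower[OF P])
      show "L2_norm (\<lambda>t. tf_shift (\<tau> l - \<tau> l0) g t - tf_shift (l - l0) g t) \<le> A / (2 * sqrt N)" if "l \<in> ?P" for l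
        using that P l0 by (intro close near) auto
    qed (use A in simp)
    then show ?thesis unfolding M_def Re_gram_sum[OF g] .
  next
    case True
    show ?thesis unfolding True by simp
  qed
  have W: "cmod (M i j) * (1 - ball_overlap (x i) (x j)) = cmod (c i) * cmod (c j) *
      (cmod (L2_inner g (tf_shift (\<tau> j - \<tau> i) g)) * (1 - ball_overlap (x i) (x j)))" for i j
    by (simp add: M_def gram_entry_norm[OF g])
  have "(\<Sum>i\<in>F. \<Sum>j\<in>F. cmod (M i j) * (1 - ball_overlap (x i) (x j))) \<le> A\<^sup>2 / 8 * (\<Sum>l\<in>F. ?w l)"
    unfolding W
  proof (rule schur_bound)
    show "0 \<le> cmod (L2_inner g (tf_shift (\<tau> j - \<tau> i) g)) * (1 - ball_overlap (x i) (x j))" for i j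
      using ball_overlap_bounds(2)[of "x i" "x j"] by simp
    show "cmod (L2_inner g (tf_shift (\<tau> j - \<tau> i) g)) * (1 - ball_overlap (x i) (x j)) =
        cmod (L2_inner g (tf_shift (\<tau> i - \<tau> j) g)) * (1 - ball_overlap (x j) (x i))" for i j
      using norm_L2_inner_tf_shift_minus[OF g, of "\<tau> i - \<tau> j"]
      by (simp add: ball_overlap_def Int_commute)
    show "(\<Sum>j\<in>F. cmod (L2_inner g (tf_shift (\<tau> j - \<tau> i) g)) * (1 - ball_overlap (x i) (x j))) \<le> A\<^sup>2 / 8"
      if "i \<in> F" for i
      unfolding x_def by (rule rows[OF F that])
  qed
  with localisation[OF F(1) loc] show ?thesis
    unfolding M_def Re_gram_sum[OF g] by simp
qed

text \<open>Subtracting a fixed point preserves separation, so a row sum of the Gram matrix becomes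
  a sum over a separated set, with constants independent of the row.\<close>

lemma row_sum_reindex:
  fixes \<tau> :: "'i \<Rightarrow> 'a::real_normed_vector" and v :: "'a \<Rightarrow> real"
  assumes F: "finite F" and inj: "inj_on \<tau> F"
    and sep: "\<And>l l'. l \<in> F \<Longrightarrow> l' \<in> F \<Longrightarrow> l \<noteq> l' \<Longrightarrow> \<delta> \<le> norm (\<tau> l - \<tau> l')"
  obtains Z where "finite Z" "separated \<delta> Z" "Z = (\<lambda>l. \<tau> l - a) ` F" "(\<Sum>l\<in>F. v (\<tau> l - a)) = (\<Sum>z\<in>Z. v z)"
proof -
  have "inj_on (\<lambda>l. \<tau> l - a) F" using inj by (auto simp: inj_on_def)
  then have "(\<Sum>l\<in>F. v (\<tau> l - a)) = (\<Sum>z\<in>(\<lambda>l. \<tau> l - a) ` F. v z)" by (simp add: sum.reindex)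
  moreover have "separated \<delta> ((\<lambda>l. \<tau> l - a) ` F)"
    using sep by (auto simp: separated_def dist_norm)
  ultimately show thesis using F by (intro that) auto
qed

theorem theorem7p2:
  fixes g :: "real ^ 'd \<Rightarrow> complex"
    and \<Lambda> :: "((real ^ 'd) \<times> (real ^ 'd)) set"
    and \<tau> :: "nat \<Rightarrow> (real ^ 'd) \<times> (real ^ 'd) \<Rightarrow> (real ^ 'd) \<times> (real ^ 'd)"
    and \<Lambda>s :: "nat \<Rightarrow> ((real ^ 'd) \<times> (real ^ 'd)) set"
  assumes "g \<in> M1"
    and "gabor_riesz_sequence g \<Lambda>"
    and "lipschitz_deformation \<Lambda> \<tau> \<Lambda>s"
  shows "\<forall>\<^sub>F n in sequentially. gabor_riesz_sequence g (\<Lambda>s n)"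
proof -
  have g: "g \<in> L2" using assms(1) by (simp add: M1_def)
  obtain A where A: "A > 0" and lower: "\<And>F (c :: _ \<Rightarrow> complex). finite F \<Longrightarrow> F \<subseteq> \<Lambda> \<Longrightarrow>
      A * sqrt (\<Sum>l\<in>F. (cmod (c l))\<^sup>2) \<le> L2_norm (\<lambda>t. \<Sum>l\<in>F. c l * tf_shift l g t)"
    using riesz_sequence_finite_lower[OF assms(2)] by blast
  have \<Lambda>s: "\<Lambda>s n = \<tau> n ` \<Lambda>" if "n \<ge> 1" for n
    using assms(3) that by (simp add: lipschitz_deformation_def deformation_def)
  \<comment> \<open>A single vector with coefficient 1 already has norm at least \<open>A\<close>.
    An empty \<open>\<Lambda>\<close> says nothing about \<open>g\<close> and is treated
    apart.\<close>
  have "L2_norm g > 0" if "l \<in> \<Lambda>" for l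
    using lower[of "{l}" "\<lambda>_. 1"] that A by (simp add: tf_shift_L2[OF g])
  then consider "\<Lambda> = {}" | "L2_norm g > 0" by blast
  then show ?thesis
  proof cases
    case 1
    have "riesz_sequence {} (\<lambda>z. tf_shift z g)"
      by (rule riesz_sequenceI_finite[where A=1 and B=1]) (auto simp: L2_norm_def)
    then show ?thesis
      by (intro eventually_sequentiallyI[of 1]) (simp add: \<Lambda>s 1)
  next
    case 2
    define v where "v z = cmod (L2_inner g (tf_shift z g))" for z
    let ?D = "real DIM((real ^ 'd) \<times> (real ^ 'd))"
    have far: "\<exists>R'>0. \<exists>n0. \<forall>n\<ge>n0. \<forall>l\<in>\<Lambda>. \<forall>l'\<in>\<Lambda>. norm (\<tau> n l - \<tau> n l') \<le> R \<longrightarrow> norm (l - l') \<le> R'"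
      if "R > 0" for R
      using assms(3) that unfolding lipschitz_deformation_def by blast
    obtain \<delta> where \<delta>: "\<delta> > 0" "separated \<delta> \<Lambda>"
      using tf_shift_lower_separated[OF g A lower] by blast
    \<comment> \<open>The separation inherited by the deformed sets, the same for all large
      \<open>n\<close>; the 1 is the radius at which (L2) is invoked to obtain
      \<open>R1\<close>.\<close>
    define \<delta>' where "\<delta>' = min 1 (\<delta> / 2)"
    have \<delta>': "\<delta>' > 0" using \<delta> by (simp add: \<delta>'_def)
    obtain R1 n1 where R1: "R1 > 0" and far1: "\<And>n l l'. n \<ge> n1 \<Longrightarrow> l \<in> \<Lambda> \<Longrightarrow> l' \<in> \<Lambda> \<Longrightarrow>
        norm (\<tau> n l - \<tau> n l') \<le> 1 \<Longrightarrow> norm (l - l') \<le> R1"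
      using far[OF zero_less_one] by blast
    \<comment> \<open>\<open>B\<close> bounds all rows of the deformed Gram matrices: it yields the
      upper Riesz bound and also weighs the near pairs in the localisation error.\<close>
    obtain B where B: "B > 0" "\<And>Z. finite Z \<Longrightarrow> separated \<delta>' Z \<Longrightarrow> (\<Sum>z\<in>Z. v z) \<le> B"
      using ambiguity_tail(1)[OF assms(1) 2 \<delta>'] unfolding v_def by blast
    \<comment> \<open>Pairs whose deformed points are at distance at least \<open>r\<close> use up
      one half of the permitted row error \<open>A^2 / 8\<close>.\<close>
    obtain r where r: "r > 0" "\<And>Z. finite Z \<Longrightarrow> separated \<delta>' Z \<Longrightarrow> \<forall>z\<in>Z. r \<le> norm z \<Longrightarrow>
        (\<Sum>z\<in>Z. v z) \<le> A\<^sup>2 / 16"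
    proof -
      have "A\<^sup>2 / 16 > 0" using A by simp
      from ambiguity_tail(2)[OF assms(1) 2 \<delta>' this] show thesis
        unfolding v_def[symmetric] using that by blast
    qed
    obtain R2 n2 where R2: "R2 > 0" and far2: "\<And>n l l'. n \<ge> n2 \<Longrightarrow> l \<in> \<Lambda> \<Longrightarrow> l' \<in> \<Lambda> \<Longrightarrow>
        norm (\<tau> n l - \<tau> n l') \<le> r \<Longrightarrow> norm (l - l') \<le> R2"
      using far[OF r(1)] by blast
    \<comment> \<open>The solution of \<open>?D * R2 / R = A^2 / (16 * B)\<close>: points within
      \<open>R2\<close> then have overlap defect at most \<open>A^2 / (16 * B)\<close>, and a row of
      total weight \<open>B\<close> contributes the other half of the permitted error.\<close>
    define R where "R = 16 * B * ?D * R2 / A\<^sup>2"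
    have R: "R > 0" using A B R2 by (simp add: R_def)
    \<comment> \<open>\<open>N\<close> and then \<open>d\<close> depend on \<open>R\<close> but not
      on \<open>n\<close>, so (L1) at radius \<open>2 * R\<close> can be required to hold with
      tolerance \<open>d\<close>.\<close>
    obtain N where N: "N > 0" "\<And>c H. finite H \<Longrightarrow> separated \<delta> H \<Longrightarrow> H \<subseteq> cball (c :: (real ^ 'd) \<times> (real ^ 'd)) (2 * R) \<Longrightarrow> real (card H) \<le> N"
      using card_separated_bounded[OF \<delta>(1), where 'a="(real ^ 'd) \<times> (real ^ 'd)" and R="2 * R"] by blast
    obtain d where d: "d > 0" "\<And>z w. norm z \<le> 2 * R \<Longrightarrow> norm (w - z) < d \<Longrightarrow>
        L2_norm (\<lambda>t. tf_shift w g t - tf_shift z g t) < A / (2 * sqrt N)"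
      using tf_shift_uniform[OF g, of "A / (2 * sqrt N)" "2 * R"] A N(1) by auto
    have ev1: "\<forall>\<^sub>F n in sequentially. \<forall>l\<in>\<Lambda>. \<forall>l'\<in>\<Lambda>. norm (l - l') \<le> R1 \<longrightarrow> norm ((\<tau> n l - \<tau> n l') - (l - l')) < \<delta> / 2"
      by (rule lipschitz_deformation_uniform[OF assms(3) R1]) (use \<delta> in simp)
    have ev2: "\<forall>\<^sub>F n in sequentially. \<forall>l\<in>\<Lambda>. \<forall>l'\<in>\<Lambda>. norm (l - l') \<le> 2 * R \<longrightarrow> norm ((\<tau> n l - \<tau> n l') - (l - l')) < d"
      by (rule lipschitz_deformation_uniform[OF assms(3) _ d(1)]) (use R in simp)
    show ?thesis
      using ev1 ev2 eventually_ge_at_top[of 1] eventually_ge_at_top[of n1] eventually_ge_at_top[of n2]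
    proof eventually_elim
      case (elim n)
      have sep: "\<delta>' \<le> norm (\<tau> n l - \<tau> n l')" if "l \<in> \<Lambda>" "l' \<in> \<Lambda>" "l \<noteq> l'" for l l'
        unfolding \<delta>'_def using that elim by (intro separated_image[OF \<delta>(2,1), of "\<tau> n" R1] far1) auto
      have inj: "inj_on (\<tau> n) \<Lambda>"
        using sep \<delta>' by (force simp: inj_on_def)
      have rowB: "(\<Sum>l'\<in>F. v (\<tau> n l' - \<tau> n l)) \<le> B" if F: "finite F" "F \<subseteq> \<Lambda>" for F l
      proof -
        obtain Z where "finite Z" "separated \<delta>' Z" "(\<Sum>l'\<in>F. v (\<tau> n l' - \<tau> n l)) = (\<Sum>z\<in>Z. v z)"
          using row_sum_reindex[OF F(1) inj_on_subset[OF inj F(2)] sep[OF subsetD[OF F(2)] subsetD[OF F(2)]]] by blast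
        then show ?thesis using B(2) by simp
      qed
      have row_tail: "(\<Sum>l'\<in>F. v (\<tau> n l' - \<tau> n l)) \<le> A\<^sup>2 / 16"
        if F: "finite F" "F \<subseteq> \<Lambda>" "\<And>l'. l' \<in> F \<Longrightarrow> r \<le> norm (\<tau> n l' - \<tau> n l)" for F l
      proof -
        obtain Z where Z: "finite Z" "separated \<delta>' Z" "Z = (\<lambda>l'. \<tau> n l' - \<tau> n l) ` F"
          "(\<Sum>l'\<in>F. v (\<tau> n l' - \<tau> n l)) = (\<Sum>z\<in>Z. v z)"
          using row_sum_reindex[OF F(1) inj_on_subset[OF inj F(2)] sep[OF subsetD[OF F(2)] subsetD[OF F(2)]]] by blast
        then show ?thesis using r(2)[OF Z(1,2)] F(3) by (simp only: Z(3,4)) blast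
      qed
      have rows: "(\<Sum>l'\<in>F. v (\<tau> n l' - \<tau> n l) * (1 - ball_overlap ((1/R) *\<^sub>R l) ((1/R) *\<^sub>R l'))) \<le> A\<^sup>2 / 8"
        if F: "finite F" "F \<subseteq> \<Lambda>" "l \<in> F" for F l
      proof -
        let ?o = "\<lambda>l'. 1 - ball_overlap ((1/R) *\<^sub>R l) ((1/R) *\<^sub>R l')"
        \<comment> \<open>The split is by deformed distance, which governs \<open>v\<close>. On the
          far part the overlap defect is bounded by 1 and \<open>v\<close> is small in sum; on the
          near part (L2) brings the original points within \<open>R2\<close>, where the defect is
          small.\<close>
        let ?F1 = "{l' \<in> F. r \<le> norm (\<tau> n l' - \<tau> n l)}" and ?F2 = "{l' \<in> F. \<not> r \<le> norm (\<tau> n l' - \<tau> n l)}"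
        have v0: "0 \<le> v z" for z by (simp add: v_def)
        have "(\<Sum>l'\<in>?F1. v (\<tau> n l' - \<tau> n l) * ?o l') \<le> (\<Sum>l'\<in>?F1. v (\<tau> n l' - \<tau> n l))"
          using ball_overlap_bounds(1) v0 by (intro sum_mono mult_left_le) auto
        also have "\<dots> \<le> A\<^sup>2 / 16" using F by (intro row_tail) auto
        finally have 1: "(\<Sum>l'\<in>?F1. v (\<tau> n l' - \<tau> n l) * ?o l') \<le> A\<^sup>2 / 16" .
        have "?o l' \<le> A\<^sup>2 / (16 * B)" if "l' \<in> ?F2" for l'
        proof -
          have "norm (l' - l) \<le> R2" using that F elim by (intro far2[of n]) auto
          have "?o l' \<le> ?D * norm ((1/R) *\<^sub>R l - (1/R) *\<^sub>R l')" by (rule ball_overlap_near)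
          also have "norm ((1/R) *\<^sub>R l - (1/R) *\<^sub>R l') = norm (l' - l) / R"
            unfolding scaleR_diff_right[symmetric] using R by (simp add: norm_minus_commute)
          also have "?D * (norm (l' - l) / R) \<le> ?D * (R2 / R)"
            using \<open>norm (l' - l) \<le> R2\<close> R by (intro mult_left_mono divide_right_mono) auto
          also have "\<dots> = A\<^sup>2 / (16 * B)"
            using A B R2 by (simp add: R_def field_simps)
          finally show ?thesis .
        qed
        then have "(\<Sum>l'\<in>?F2. v (\<tau> n l' - \<tau> n l) * ?o l') \<le> (\<Sum>l'\<in>?F2. v (\<tau> n l' - \<tau> n l) * (A\<^sup>2 / (16 * B)))"
          using v0 by (intro sum_mono mult_left_mono) auto
        also have "\<dots> = (\<Sum>l'\<in>?F2. v (\<tau> n l' - \<tau> n l)) * (A\<^sup>2 / (16 * B))" by (rule sum_distrib_right[symmetric])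
        also have "\<dots> \<le> B * (A\<^sup>2 / (16 * B))"
          using F B by (intro mult_right_mono rowB) auto
        also have "\<dots> = A\<^sup>2 / 16" using B by simp
        finally have 2: "(\<Sum>l'\<in>?F2. v (\<tau> n l' - \<tau> n l) * ?o l') \<le> A\<^sup>2 / 16" .
        have "(\<Sum>l'\<in>F. v (\<tau> n l' - \<tau> n l) * ?o l')
          = (\<Sum>l'\<in>?F1. v (\<tau> n l' - \<tau> n l) * ?o l') + (\<Sum>l'\<in>?F2. v (\<tau> n l' - \<tau> n l) * ?o l')"
          using F(1) by (subst sum.union_disjoint[symmetric]) (auto intro!: sum.cong)
        then show ?thesis using 1 2 by simp
      qed
      have lower_n: "A\<^sup>2 / 8 * (\<Sum>l\<in>F. (cmod (c l))\<^sup>2) \<le> (L2_norm (\<lambda>t. \<Sum>l\<in>F. c l * tf_shift (\<tau> n l) g t))\<^sup>2"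
        if F: "finite F" "F \<subseteq> \<Lambda>" for F c
      proof (rule deformed_lower_bound[OF g A R lower _ N(1) _ _ F])
        show "real (card H) \<le> N" if "finite H" "H \<subseteq> \<Lambda>" "H \<subseteq> cball c (2 * R)" for c H
          using that separated_subset[OF \<delta>(2)] by (intro N(2)) auto
        show "L2_norm (\<lambda>t. tf_shift (\<tau> n l - \<tau> n l') g t - tf_shift (l - l') g t) \<le> A / (2 * sqrt N)"
          if "l \<in> \<Lambda>" "l' \<in> \<Lambda>" "norm (l - l') \<le> 2 * R" for l l'
          by (rule less_imp_le, rule d(2)) (use that elim in auto)
        show "(\<Sum>l'\<in>F. cmod (L2_inner g (tf_shift (\<tau> n l' - \<tau> n l) g)) *
            (1 - ball_overlap ((1/R) *\<^sub>R l) ((1/R) *\<^sub>R l'))) \<le> A\<^sup>2 / 8"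
          if "finite F" "F \<subseteq> \<Lambda>" "l \<in> F" for F l
          using rows[OF that] by (simp add: v_def)
      qed
      \<comment> \<open>No localisation is required here: phases are discarded by taking moduli, and
        Schur's test applies to the whole Gram matrix.\<close>
      have upper_n: "(L2_norm (\<lambda>t. \<Sum>l\<in>F. c l * tf_shift (\<tau> n l) g t))\<^sup>2 \<le> B * (\<Sum>l\<in>F. (cmod (c l))\<^sup>2)"
        if F: "finite F" "F \<subseteq> \<Lambda>" for F c
      proof -
        have "(L2_norm (\<lambda>t. \<Sum>l\<in>F. c l * tf_shift (\<tau> n l) g t))\<^sup>2
          \<le> cmod (\<Sum>i\<in>F. \<Sum>j\<in>F. c i * cnj (c j) * L2_inner (tf_shift (\<tau> n i) g) (tf_shift (\<tau> n j) g))"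
          unfolding Re_gram_sum[OF g, symmetric] by (rule complex_Re_le_cmod)
        also have "\<dots> \<le> (\<Sum>i\<in>F. \<Sum>j\<in>F. cmod (c i) * cmod (c j) * v (\<tau> n j - \<tau> n i))"
          unfolding v_def gram_entry_norm[OF g, symmetric]
          by (intro order_trans[OF norm_sum] sum_mono norm_sum)
        also have "\<dots> \<le> B * (\<Sum>l\<in>F. (cmod (c l))\<^sup>2)"
        proof (rule schur_bound)
          show "v (\<tau> n j - \<tau> n i) = v (\<tau> n i - \<tau> n j)" for i j
            using norm_L2_inner_tf_shift_minus[OF g, of "\<tau> n i - \<tau> n j"] by (simp add: v_def)
        qed (auto simp: v_def[abs_def] intro: rowB[OF F, unfolded v_def])
        finally show ?thesis .
      qed
      show "gabor_riesz_sequence g (\<Lambda>s n)"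
      \<comment> \<open>\<open>A / sqrt 8\<close> is the square root of the surviving constant
        \<open>A^2 / 8\<close>; the maximum secures the order of the two Riesz constants.\<close>
      proof (rule riesz_sequenceI_finite[where A="A / sqrt 8" and B="max (A / sqrt 8) (sqrt B)"])
        fix F and c :: "_ \<Rightarrow> complex" assume F: "finite F" "F \<subseteq> \<Lambda>s n"
        \<comment> \<open>The Riesz property is indexed by the points of the deformed set, the
          estimates by \<open>\<Lambda>\<close>; injectivity of \<open>\<tau> n\<close>, a
          consequence of separation, makes the two indexings agree.\<close>
        then obtain F' where F': "F' \<subseteq> \<Lambda>" "F = \<tau> n ` F'" "finite F'"
          unfolding \<Lambda>s[OF elim(3)] using finite_subset_image by blast
        have re: "(\<Sum>z\<in>F. h z) = (\<Sum>l\<in>F'. h (\<tau> n l))" for h :: "_ \<Rightarrow> 'x::comm_monoid_add"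
          unfolding F'(2) using inj_on_subset[OF inj F'(1)] by (simp add: sum.reindex)
        let ?s = "\<Sum>l\<in>F'. (cmod (c (\<tau> n l)))\<^sup>2"
        let ?L = "L2_norm (\<lambda>t. \<Sum>z\<in>F. c z * tf_shift z g t)"
        have L: "?L = L2_norm (\<lambda>t. \<Sum>l\<in>F'. c (\<tau> n l) * tf_shift (\<tau> n l) g t)"
          unfolding re ..
        have "sqrt (A\<^sup>2 / 8 * ?s) \<le> ?L"
          unfolding L by (intro real_le_lsqrt lower_n F' L2_norm_nonneg)
        then show "A / sqrt 8 * sqrt (\<Sum>z\<in>F. (cmod (c z))\<^sup>2) \<le> ?L"
          unfolding re using A by (simp add: real_sqrt_mult real_sqrt_divide)
        have "?L \<le> sqrt (B * ?s)"
          unfolding L by (intro real_le_rsqrt upper_n F')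
        also have "\<dots> \<le> max (A / sqrt 8) (sqrt B) * sqrt ?s"
          unfolding real_sqrt_mult by (intro mult_right_mono) (auto intro: sum_nonneg)
        finally show "?L \<le> max (A / sqrt 8) (sqrt B) * sqrt (\<Sum>z\<in>F. (cmod (c z))\<^sup>2)"
          unfolding re .
      qed (use A in \<open>auto intro: tf_shift_L2 g\<close>)
    qed
  qed
qed

end
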